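(* Let $g,d,n$ be positive integers, let $A\in SM_d(\mathbb{R})^g$ be such that the free spectrahedron $\mathcal{D}_A$ is bounded, and let $X\in\mathcal{D}_A(n)$. Let $\mu$ be the dimension of the space of all $\beta\in M_{n\times1}(\mathbb{R})^g$ satisfying $\ker L_A(X)\subseteq\ker\Lambda_A(\beta^T)$. Run the Arveson dilation algorithm (described in the context) on $X$. (a) With probability $1$, the algorithm terminates after $k\le\mu\le ng$ steps, and the result $Y^k\in SM_{n+k}(\mathbb{R})^g$ is an Arveson extreme point of $\mathcal{D}_A$ which is a dilation of $X$. Moreover, if the algorithm is designed so that each $\hat\gamma^j$ is a classical extreme point of the spectrahedron $\left\{\gamma\in\mathbb{R}^g: L_A\begin{pmatrix}Y^j&c_j\hat\beta^j\\ c_j(\hat\beta^j)^T&\gamma\end{pmatrix}\succeq0\right\}$, then this method always succeeds in at most $\mu$ steps. (b) In addition, if $U$ is a real orthogonal matrix such that $U^TY^kU=\bigoplus_{i=1}^{r}Z^i$ with each $Z^i\in SM_{n_i}(\mathbb{R})^g$ irreducible, then each $Z^i$ is a free extreme point of $\mathcal{D}_A$, and $X$ may be expressed as a matrix convex combination of the $Z^i$ satisfying the free Caratheodory bound: there are $V_i\in M_{n_i\times n}(\mathbb{R})$ with $$X=\sum_{i=1}^{r}V_i^TZ^iV_i,\qquad\sum_{i=1}^{r}V_i^TV_i=I_n,\qquad\sum_{i=1}^{r}n_i=n+k\le n(g+1),\qquad k\le\mu .$$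
   Context: Notation. $SM_n(\mathbb{R})^g$ denotes the set of $g$-tuples of real symmetric $n\times n$ matrices; $M_{m\times n}(\mathbb{R})^g$ the set of $g$-tuples of real $m\times n$ matrices. Transposes, direct sums, products with matrices and block tuples are taken entrywise, e.g. $V^TXV=(V^TX_1V,\dots,V^TX_gV)$. For $A\in SM_d(\mathbb{R})^g$ and a $g$-tuple $X$ of matrices, $\Lambda_A(X):=A_1\otimes X_1+\dots+A_g\otimes X_g$, and for $X\in SM_n(\mathbb{R})^g$, $L_A(X):=I_{dn}-\Lambda_A(X)$. The free spectrahedron is $\mathcal{D}_A:=\bigcup_{n\ge1}\mathcal{D}_A(n)$ with $\mathcal{D}_A(n):=\{X\in SM_n(\mathbb{R})^g:L_A(X)\succeq0\}$. It is bounded if there is a real $C$ such that $CI_n-\sum_iX_i^2\succeq0$ for all $n$ and all $X\in\mathcal{D}_A(n)$. Extreme points. $X\in\mathcal{D}_A(n)$ is an Arveson extreme point of $\mathcal{D}_A$ if $\begin{pmatrix}X&\beta\\ \beta^T&\gamma\end{pmatrix}\in\mathcal{D}_A$ implies $\beta=0$ (for tuples $\beta$, $\gamma$ of matrices of compatible sizes). Tuples $X,Y\in SM_n(\mathbb{R})^g$ are unitarily equivalent if $U^TXU=Y$ for some real orthogonal $U$. $X\in\mathcal{D}_A(n)$ is a free extreme point of $\mathcal{D}_A$ if, whenever $X=\sum_{i}V_i^TY^iV_i$ is a finite sum with $Y^i\in\mathcal{D}_A(n_i)$, $0\neq V_i\in M_{n_i\times n}(\mathbb{R})$ and $\sum_iV_i^TV_i=I_n$,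 then for each $i$ either $n_i=n$ and $Y^i$ is unitarily equivalent to $X$, or $n_i>n$ and there is $Z^i\in\mathcal{D}_A$ such that $Y^i$ is unitarily equivalent to $X\oplus Z^i$. A tuple $X\in SM_n(\mathbb{R})^g$ is irreducible if $X_1,\dots,X_g$ have no common reducing subspace in $\mathbb{R}^n$ other than $\{0\}$ and $\mathbb{R}^n$. A tuple $Y\in SM_{n+k}(\mathbb{R})^g$ is a dilation of $X\in SM_n(\mathbb{R})^g$ if it has the form $\begin{pmatrix}X&\beta\\ \beta^T&\gamma\end{pmatrix}$ (with $Y=X$ if $k=0$). Arveson dilation algorithm. Input: $X\in\mathcal{D}_A(n)$. Set $Y^0:=X$. For $j=0,1,2,\dots$, while $Y^j$ is not an Arveson extreme point of $\mathcal{D}_A$, perform one step: let $\hat\beta^j\in M_{(n+j)\times1}(\mathbb{R})^g$ be a nonzero solution of $\ker L_A(Y^j)\subseteq\ker\Lambda_A((\hat\beta^j)^T)$; let $c_j$ be the maximum of $c\in\mathbb{R}$ over all $(c,\gamma)\in\mathbb{R}\times\mathbb{R}^g$ with $L_A\begin{pmatrix}Y^j&c\hat\beta^j\\ c(\hat\beta^j)^T&\gamma\end{pmatrix}\succeq0$; let $\hat\gamma^j$ be a maximizer of $\ell(\gamma)$ over all $\gamma\in\mathbb{R}^g$ with $L_A\begin{pmatrix}Y^j&c_j\hat\beta^j\\ c_j(\hat\beta^j)^T&\gamma\end{pmatrix}\succeq0$, where $\ell:\mathbb{R}^g\to\mathbb{R}$ is any linear functional (the choice of $\ell$ may vary with $j$);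 and set $Y^{j+1}:=\begin{pmatrix}Y^j&c_j\hat\beta^j\\ c_j(\hat\beta^j)^T&\hat\gamma^j\end{pmatrix}$. The algorithm terminates when $Y^j$ is an Arveson extreme point. The phrase "with probability $1$" in (a) is as in the source, which specifies no probability distribution for the functionals $\ell$; it is used there in the sense that a maximizer $\hat\gamma^j$ of a linear functional over the spectrahedron displayed in (a) is, with probability $1$, a classical extreme point of that spectrahedron. *)

theory Defs
  imports
    "HOL-Analysis.Analysis"
    "Jordan_Normal_Form.Matrix_Kernel"
begin

text \<open>
  The number of matrices in a tuple is the cardinality of the finite type \<open>'g\<close>; the sizes of the
  matrices are natural numbers, passed explicitly.
\<close>

type_synonym 'g mat_tuple = "'g \<Rightarrow> real mat"

definition tuples :: "nat \<Rightarrow> nat \<Rightarrow> 'g mat_tuple set" where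
  "tuples m n = {X. \<forall>i. X i \<in> carrier_mat m n}"

definition sym_tuples :: "nat \<Rightarrow> 'g mat_tuple set" where
  "sym_tuples n = {X. \<forall>i. X i \<in> carrier_mat n n \<and> transpose_mat (X i) = X i}"

text \<open>The type of matrices of arbitrary size has no zero element, so \<^const>\<open>sum\<close> is not available for them.\<close>

definition mat_sum :: "nat \<Rightarrow> nat \<Rightarrow> 'i set \<Rightarrow> ('i \<Rightarrow> real mat) \<Rightarrow> real mat" where
  "mat_sum m n I M = mat m n (\<lambda>pq. \<Sum>i\<in>I. M i $$ pq)"

definition kronecker :: "real mat \<Rightarrow> real mat \<Rightarrow> real mat" where
  "kronecker A B = mat (dim_row A * dim_row B) (dim_col A * dim_col B)
     (\<lambda>(p, q). A $$ (p div dim_row B, q div dim_col B) * B $$ (p mod dim_row B, q mod dim_col B))"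

definition psd :: "real mat \<Rightarrow> bool" where
  "psd M \<longleftrightarrow> M \<in> carrier_mat (dim_row M) (dim_row M) \<and> transpose_mat M = M \<and>
     (\<forall>v \<in> carrier_vec (dim_row M). 0 \<le> scalar_prod v (M *\<^sub>v v))"


subsection \<open>Free spectrahedra\<close>

text \<open>\<open>A\<close> has \<open>d \<times> d\<close> entries and \<open>X\<close> has \<open>m \<times> n\<close> entries.\<close>

definition Lam :: "nat \<Rightarrow> 'g::finite mat_tuple \<Rightarrow> nat \<Rightarrow> nat \<Rightarrow> 'g mat_tuple \<Rightarrow> real mat" where
  "Lam d A m n X = mat_sum (d * m) (d * n) UNIV (\<lambda>i. kronecker (A i) (X i))"

definition pencil :: "nat \<Rightarrow> 'g::finite mat_tuple \<Rightarrow> nat \<Rightarrow> 'g mat_tuple \<Rightarrow> real mat" where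
  "pencil d A n X = 1\<^sub>m (d * n) - Lam d A n n X"

definition free_spec :: "nat \<Rightarrow> 'g::finite mat_tuple \<Rightarrow> nat \<Rightarrow> 'g mat_tuple set" where
  "free_spec d A n = {X \<in> sym_tuples n. psd (pencil d A n X)}"

definition bounded_free_spec :: "nat \<Rightarrow> 'g::finite mat_tuple \<Rightarrow> bool" where
  "bounded_free_spec d A \<longleftrightarrow>
     (\<exists>C. \<forall>n\<ge>1. \<forall>X \<in> free_spec d A n. psd (C \<cdot>\<^sub>m 1\<^sub>m n - mat_sum n n UNIV (\<lambda>i. X i * X i)))"


subsection \<open>Extreme points\<close>

definition block_tuple :: "'g mat_tuple \<Rightarrow> 'g mat_tuple \<Rightarrow> 'g mat_tuple \<Rightarrow> 'g mat_tuple" where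
  "block_tuple X \<beta> \<gamma> = (\<lambda>i. four_block_mat (X i) (\<beta> i) (transpose_mat (\<beta> i)) (\<gamma> i))"

definition is_dilation :: "nat \<Rightarrow> 'g mat_tuple \<Rightarrow> nat \<Rightarrow> 'g mat_tuple \<Rightarrow> bool" where
  "is_dilation n X k Y \<longleftrightarrow> Y \<in> sym_tuples (n + k) \<and>
     (\<exists>\<beta> \<in> tuples n k. \<exists>\<gamma> \<in> tuples k k. Y = block_tuple X \<beta> \<gamma>)"

definition arveson_extreme :: "nat \<Rightarrow> 'g::finite mat_tuple \<Rightarrow> nat \<Rightarrow> 'g mat_tuple \<Rightarrow> bool" where
  "arveson_extreme d A n X \<longleftrightarrow> X \<in> free_spec d A n \<and>
     (\<forall>m. \<forall>\<beta> \<in> tuples n m. \<forall>\<gamma> \<in> tuples m m.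
        block_tuple X \<beta> \<gamma> \<in> free_spec d A (n + m) \<longrightarrow> \<beta> = (\<lambda>i. 0\<^sub>m n m))"

definition unitarily_equiv :: "nat \<Rightarrow> 'g mat_tuple \<Rightarrow> 'g mat_tuple \<Rightarrow> bool" where
  "unitarily_equiv n X Y \<longleftrightarrow>
     (\<exists>U \<in> carrier_mat n n. transpose_mat U * U = 1\<^sub>m n \<and> (\<forall>i. transpose_mat U * X i * U = Y i))"

definition direct_sum :: "nat \<Rightarrow> 'g mat_tuple \<Rightarrow> nat \<Rightarrow> 'g mat_tuple \<Rightarrow> 'g mat_tuple" where
  "direct_sum m X n Y = (\<lambda>i. four_block_mat (X i) (0\<^sub>m m n) (0\<^sub>m n m) (Y i))"

definition free_extreme :: "nat \<Rightarrow> 'g::finite mat_tuple \<Rightarrow> nat \<Rightarrow> 'g mat_tuple \<Rightarrow> bool" where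
  "free_extreme d A n X \<longleftrightarrow> X \<in> free_spec d A n \<and>
     (\<forall>(r::nat) m Y V.
        (\<forall>j<r. 1 \<le> m j \<and> Y j \<in> free_spec d A (m j) \<and>
               V j \<in> carrier_mat (m j) n \<and> V j \<noteq> 0\<^sub>m (m j) n) \<and>
        mat_sum n n {..<r} (\<lambda>j. transpose_mat (V j) * V j) = 1\<^sub>m n \<and>
        (\<forall>i. X i = mat_sum n n {..<r} (\<lambda>j. transpose_mat (V j) * Y j i * V j))
        \<longrightarrow> (\<forall>j<r. (m j = n \<and> unitarily_equiv n (Y j) X) \<or>
                   (m j > n \<and> (\<exists>Z \<in> free_spec d A (m j - n).
                      unitarily_equiv (m j) (Y j) (direct_sum n X (m j - n) Z)))))"

definition reducing_subspace :: "nat \<Rightarrow> 'g mat_tuple \<Rightarrow> real vec set \<Rightarrow> bool" where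
  "reducing_subspace n X W \<longleftrightarrow> VectorSpace.subspace class_ring W (module_vec TYPE(real) n) \<and>
     (\<forall>i. (\<forall>w \<in> W. X i *\<^sub>v w \<in> W) \<and>
          (\<forall>w \<in> vec_module.orthogonal_complement n W.
             X i *\<^sub>v w \<in> vec_module.orthogonal_complement n W))"

definition irreducible_tuple :: "nat \<Rightarrow> 'g mat_tuple \<Rightarrow> bool" where
  "irreducible_tuple n X \<longleftrightarrow> X \<in> sym_tuples n \<and>
     (\<forall>W. reducing_subspace n X W \<longrightarrow> W = {0\<^sub>v n} \<or> W = carrier_vec n)"


subsection \<open>The dilation subspace\<close>

definition dilation_subspace ::
    "nat \<Rightarrow> 'g::finite mat_tuple \<Rightarrow> nat \<Rightarrow> 'g mat_tuple \<Rightarrow> 'g mat_tuple set" where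
  "dilation_subspace d A n X = {\<beta> \<in> tuples n 1.
     mat_kernel (pencil d A n X) \<subseteq> mat_kernel (Lam d A 1 n (\<lambda>i. transpose_mat (\<beta> i)))}"

definition tuple_module :: "nat \<Rightarrow> nat \<Rightarrow> (real, 'g mat_tuple) module" where
  "tuple_module m n = \<lparr>
     carrier = tuples m n,
     mult = undefined,
     one = undefined,
     zero = (\<lambda>i. 0\<^sub>m m n),
     add = (\<lambda>\<beta> \<beta>' i. \<beta> i + \<beta>' i),
     smult = (\<lambda>c \<beta> i. c \<cdot>\<^sub>m \<beta> i)\<rparr>"

definition dilation_dim :: "nat \<Rightarrow> 'g::finite mat_tuple \<Rightarrow> nat \<Rightarrow> 'g mat_tuple \<Rightarrow> nat" where
  "dilation_dim d A n X =
     vectorspace.dim class_ring ((tuple_module n 1)\<lparr>carrier := dilation_subspace d A n X\<rparr>)"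


subsection \<open>The Arveson dilation algorithm\<close>

definition border :: "'g::finite mat_tuple \<Rightarrow> 'g mat_tuple \<Rightarrow> real \<Rightarrow> real^'g \<Rightarrow> 'g mat_tuple" where
  "border Y \<beta> c \<gamma> = block_tuple Y (\<lambda>i. c \<cdot>\<^sub>m \<beta> i) (\<lambda>i. mat 1 1 (\<lambda>_. vec_nth \<gamma> i))"

definition border_spec ::
    "nat \<Rightarrow> 'g::finite mat_tuple \<Rightarrow> nat \<Rightarrow> 'g mat_tuple \<Rightarrow> 'g mat_tuple \<Rightarrow> real \<Rightarrow> (real^'g) set" where
  "border_spec d A n Y \<beta> c = {\<gamma>. psd (pencil d A (n + 1) (border Y \<beta> c \<gamma>))}"

definition direction ::
    "nat \<Rightarrow> 'g::finite mat_tuple \<Rightarrow> nat \<Rightarrow> 'g mat_tuple \<Rightarrow> 'g mat_tuple \<Rightarrow> bool" where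
  "direction d A n Y \<beta> \<longleftrightarrow> \<beta> \<in> dilation_subspace d A n Y \<and> \<beta> \<noteq> (\<lambda>i. 0\<^sub>m n 1)"

definition max_scaling ::
    "nat \<Rightarrow> 'g::finite mat_tuple \<Rightarrow> nat \<Rightarrow> 'g mat_tuple \<Rightarrow> 'g mat_tuple \<Rightarrow> real \<Rightarrow> bool" where
  "max_scaling d A n Y \<beta> c \<longleftrightarrow>
     is_arg_max (\<lambda>t. t) (\<lambda>t. \<exists>\<gamma>. \<gamma> \<in> border_spec d A n Y \<beta> t) c"

text \<open>
  The linear functional given by \<open>l\<close> is \<open>\<gamma> \<mapsto> inner l \<gamma>\<close>. The set consists of the maximizers that
  the variant \<open>adm\<close> of the algorithm may select.
\<close>

definition corner_choices ::
    "(real^'g::finite \<Rightarrow> (real^'g) set \<Rightarrow> bool) \<Rightarrow> (real^'g) set \<Rightarrow> real^'g \<Rightarrow> (real^'g) set" where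
  "corner_choices adm S l = {\<gamma>. is_arg_max (inner l) (\<lambda>\<gamma>. \<gamma> \<in> S) \<gamma> \<and> adm \<gamma> S}"

text \<open>
  The predicate \<open>terminates_within d A n F adm P b k Y\<close>: started in the state reached after \<open>k\<close>
  steps with current tuple \<open>Y\<close>, which has size \<open>n + k\<close>, the algorithm performs at most \<open>b\<close> further
  steps, whatever choices of \<open>\<beta>\<close>, of \<open>c\<close> and of the maximizer \<open>\<gamma>\<close> are made, never gets stuck
  (admissible choices exist as long as the tuple is not Arveson extreme), and stops in an Arveson
  extreme point \<open>Y'\<close>, after \<open>k'\<close> steps in total, with \<open>P k' Y'\<close>.

  In each step the functional \<open>l\<close> is only required to be generic for the filter \<open>F\<close>:
  for \<open>F = principal UNIV\<close> it is arbitrary, and for \<open>F = ae_filter lborel\<close> the condition reads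
  \<open>AE l in lborel. \<dots>\<close>. The latter means that, given the history of the run and the current
  \<open>\<beta>\<close> and \<open>c\<close>, the claim about the rest of the run holds with probability 1 for \<open>l\<close> drawn from any
  distribution that is absolutely continuous with respect to Lebesgue measure. Nesting the almost
  everywhere quantifiers lets \<open>\<beta>\<close>, \<open>c\<close> and \<open>\<gamma>\<close> depend on the history in an arbitrary, possibly
  nonmeasurable, way, for which a single product measure on sequences of functionals would not do.
\<close>

primrec terminates_within ::
    "nat \<Rightarrow> 'g::finite mat_tuple \<Rightarrow> nat \<Rightarrow> (real^'g) filter \<Rightarrow>
     (real^'g \<Rightarrow> (real^'g) set \<Rightarrow> bool) \<Rightarrow> (nat \<Rightarrow> 'g mat_tuple \<Rightarrow> bool) \<Rightarrow>
     nat \<Rightarrow> nat \<Rightarrow> 'g mat_tuple \<Rightarrow> bool" where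
  "terminates_within d A n F adm P 0 k Y \<longleftrightarrow> arveson_extreme d A (n + k) Y \<and> P k Y"
| "terminates_within d A n F adm P (Suc b) k Y \<longleftrightarrow>
     (if arveson_extreme d A (n + k) Y then P k Y
      else (\<exists>\<beta>. direction d A (n + k) Y \<beta>) \<and>
        (\<forall>\<beta>. direction d A (n + k) Y \<beta> \<longrightarrow>
          (\<exists>c. max_scaling d A (n + k) Y \<beta> c) \<and>
          (\<forall>c. max_scaling d A (n + k) Y \<beta> c \<longrightarrow>
            (\<forall>\<^sub>F l in F.
              (\<exists>\<gamma>. \<gamma> \<in> corner_choices adm (border_spec d A (n + k) Y \<beta> c) l) \<and>
              (\<forall>\<gamma> \<in> corner_choices adm (border_spec d A (n + k) Y \<beta> c) l.
                 terminates_within d A n F adm P b (Suc k) (border Y \<beta> c \<gamma>))))))"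

end

theory Submission
  imports Defs
begin

text \<open>
  Why the algorithm stops. Write \<open>K(Y)\<close> for the space of dilation directions of \<open>Y\<close>, that is, of all
  columns \<open>\<beta>\<close> with \<open>ker L\<^sub>A(Y) \<subseteq> ker \<Lambda>\<^sub>A(\<beta>\<^sup>T)\<close>. A kernel inclusion for a positive semidefinite matrix is
  the same as an estimate \<open>\<bar>\<Lambda>\<^sub>A(\<beta>\<^sup>T)v\<bar>\<^sup>2 \<le> K \<langle>L\<^sub>A(Y)v, v\<rangle>\<close>, so every direction can be realized by a
  dilation after scaling, and \<open>Y\<close> is Arveson extreme exactly if \<open>K(Y) = 0\<close> (\<open>arveson_iff_rigid\<close>).
  Let \<open>Y'\<close> arise from \<open>Y\<close> by one step with column \<open>c \<beta>\<close> and corner \<open>\<gamma>\<close>. Deleting the last entry maps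
  \<open>K(Y')\<close> into \<open>K(Y)\<close>. This map is injective because \<open>\<gamma>\<close> is an extreme point
  (\<open>extreme_corner_no_vertical_direction\<close>), and its image misses \<open>\<beta>\<close> because \<open>c\<close> is maximal
  (\<open>max_scaling_no_repeated_direction\<close>: a second dilation along \<open>\<beta>\<close> could be rotated into the first
  one and would enlarge \<open>c\<close>). Hence the dimension drops in every step, and at most \<open>\<mu>\<close> steps are
  possible. Boundedness makes all optimization problems compact, so the required maximizers exist.

  Why a random functional suffices. For almost every functional the maximizer over a compact convex
  set is unique, and a unique maximizer is an extreme point. The functionals with two maximizers that
  are separated in a coordinate by rational thresholds form a closed set that meets every line in
  this coordinate direction at most once, and such a set is null (\<open>unique_maximizer_ae\<close>).

  Why the summands are free extreme. The condition \<open>K = 0\<close> passes from a tuple to its direct summands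
  (\<open>rigid_summand\<close>). If \<open>K(X) = 0\<close> and \<open>X = \<Sum>\<^sub>j V\<^sub>j\<^sup>T Y\<^sub>j V\<^sub>j\<close> is a matrix convex combination, then the
  columns of \<open>V\<^sub>j\<^sup>T Y\<^sub>j - X V\<^sub>j\<^sup>T\<close> are dilation directions of \<open>X\<close>, so \<open>Y\<^sub>j V\<^sub>j = V\<^sub>j X\<close>
  (\<open>rigid_convex_combination_intertwines\<close>). Then \<open>V\<^sub>j\<^sup>T V\<^sub>j\<close> commutes with \<open>X\<close>, and for irreducible \<open>X\<close> and
  \<open>V\<^sub>j \<noteq> 0\<close> it is a positive multiple of the identity; so \<open>V\<^sub>j\<close> is a multiple of an isometry that splits \<open>X\<close> off
  from \<open>Y\<^sub>j\<close>. The Caratheodory bound is the count \<open>n + k \<le> n + \<mu> \<le> n + n g\<close>.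
\<close>

section \<open>Linear algebra over finite index sets\<close>

text \<open>
  Induction on the rows. If the new row \<open>M a\<close> is nonzero at some \<open>e\<close> in the common kernel of the other
  rows, subtract from \<open>f\<close> the multiple of \<open>M a\<close> that agrees with \<open>f\<close> at \<open>e\<close>. The difference vanishes on
  the common kernel of the other rows, because each of its elements is moved into the kernel of
  \<open>M a\<close> by a multiple of \<open>e\<close>.
\<close>
lemma functional_in_row_span:
  fixes M :: "'b \<Rightarrow> 'a \<Rightarrow> real" and f :: "'a \<Rightarrow> real"
  assumes "finite J" and "finite I"
    and "\<And>v. (\<forall>a\<in>J. (\<Sum>b\<in>I. M a b * v b) = 0) \<Longrightarrow> (\<Sum>b\<in>I. f b * v b) = 0"
  shows "\<exists>u. \<forall>b\<in>I. f b = (\<Sum>a\<in>J. u a * M a b)"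
  using assms(1,3)
proof (induction J arbitrary: f)
  case empty
  have "(\<Sum>b\<in>I. f b * f b) = 0"
    by (rule empty.prems) simp
  then have "\<forall>b\<in>I. f b * f b = 0"
    using \<open>finite I\<close> by (subst (asm) sum_nonneg_eq_0_iff) auto
  then show ?case by simp
next
  case (insert a J)
  let ?app = "\<lambda>f v. \<Sum>b\<in>I. f b * (v b :: real)"
  show ?case
  proof (cases "\<exists>e. (\<forall>a'\<in>J. ?app (M a') e = 0) \<and> ?app (M a) e \<noteq> 0")
    case False
    then have "\<exists>u. \<forall>b\<in>I. f b = (\<Sum>a\<in>J. u a * M a b)"
      by (intro insert.IH insert.prems) auto
    then obtain u where u: "\<forall>b\<in>I. f b = (\<Sum>a\<in>J. u a * M a b)" by blast
    have "(\<Sum>x\<in>insert a J. (u(a := 0)) x * M x b) = (\<Sum>x\<in>J. u x * M x b)" for b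
      using insert.hyps by (auto intro!: sum.cong)
    then show ?thesis using u by (intro exI[of _ "u(a := 0)"]) auto
  next
    case True
    then obtain e where e: "\<forall>a'\<in>J. ?app (M a') e = 0" "?app (M a) e \<noteq> 0" by blast
    define c where "c = ?app f e / ?app (M a) e"
    have "\<exists>u. \<forall>b\<in>I. f b - c * M a b = (\<Sum>a\<in>J. u a * M a b)"
    proof (rule insert.IH)
      fix v assume v: "\<forall>a\<in>J. ?app (M a) v = 0"
      define t where "t = ?app (M a) v / ?app (M a) e"
      define w where "w = (\<lambda>b. v b - t * e b)"
      have app_w: "?app h w = ?app h v - t * ?app h e" for h
        unfolding w_def by (simp add: right_diff_distrib sum_subtractf sum_distrib_left mult_ac)
      have "?app f w = 0"
        using v e by (intro insert.prems) (simp add: app_w t_def)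
      then have "?app f v = c * ?app (M a) v" by (simp add: app_w c_def t_def)
      then show "(\<Sum>b\<in>I. (f b - c * M a b) * v b) = 0"
        by (simp add: algebra_simps sum_subtractf sum_distrib_left)
    qed
    then obtain u where u: "\<forall>b\<in>I. f b - c * M a b = (\<Sum>a\<in>J. u a * M a b)" by blast
    have "(\<Sum>x\<in>insert a J. (u(a := c)) x * M x b) = c * M a b + (\<Sum>x\<in>J. u x * M x b)" for b
      using insert.hyps by (auto intro!: sum.cong)
    moreover have "f b = c * M a b + (\<Sum>x\<in>J. u x * M x b)" if "b \<in> I" for b
      using u that by (metis add.commute diff_add_cancel)
    ultimately show ?thesis by (intro exI[of _ "u(a := c)"]) simp
  qed
qed

text \<open>
  Gaussian elimination: a row with a nonzero entry is used up to eliminate one unknown. All bounds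
  on dimensions below are instances of this count.
\<close>
lemma homogeneous_system_nonzero_solution:
  fixes M :: "'b \<Rightarrow> 'a \<Rightarrow> real"
  assumes "finite J" and "finite I" and "card J < card I"
  shows "\<exists>v. (\<exists>b\<in>I. v b \<noteq> 0) \<and> (\<forall>a\<in>J. (\<Sum>b\<in>I. M a b * v b) = 0)"
  using assms
proof (induction J arbitrary: I M)
  case empty
  then have "I \<noteq> {}" by auto
  then show ?case by (intro exI[of _ "\<lambda>_. 1"]) auto
next
  case (insert a J)
  show ?case
  proof (cases "\<forall>b\<in>I. M a b = 0")
    case True
    have "card J < card I" using insert by auto
    then obtain v where "(\<exists>b\<in>I. v b \<noteq> 0) \<and> (\<forall>a\<in>J. (\<Sum>b\<in>I. M a b * v b) = 0)"
      using insert.IH[of I M] insert.prems by blast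
    then show ?thesis using True by auto
  next
    case False
    then obtain p where p: "p \<in> I" "M a p \<noteq> 0" by blast
    define I' where "I' = I - {p}"
    define M' where "M' x b = M x b - M x p / M a p * M a b" for x b
    have "card J < card I'" using insert p unfolding I'_def by auto
    then obtain v where v: "\<exists>b\<in>I'. v b \<noteq> 0" "\<forall>x\<in>J. (\<Sum>b\<in>I'. M' x b * v b) = 0"
      using insert.IH[of I' M'] insert.prems unfolding I'_def by blast
    define w where "w = v(p := - (\<Sum>b\<in>I'. M a b * v b) / M a p)"
    have I: "(\<Sum>b\<in>I. M x b * w b) = M x p * w p + (\<Sum>b\<in>I'. M x b * v b)" for x
      using p insert.prems unfolding I'_def w_def
      by (subst sum.remove[of I p]) (auto intro!: sum.cong)
    have "(\<Sum>b\<in>I. M a b * w b) = 0" using p by (simp add: I) (simp add: w_def)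
    moreover have "(\<Sum>b\<in>I. M x b * w b) = 0" if "x \<in> J" for x
    proof -
      define t where "t = M x p / M a p"
      have "(\<Sum>b\<in>I'. (M x b - t * M a b) * v b) = 0"
        using v(2) that unfolding M'_def t_def by simp
      then have "(\<Sum>b\<in>I'. M x b * v b) = t * (\<Sum>b\<in>I'. M a b * v b)"
        by (simp add: algebra_simps sum_subtractf sum_distrib_left)
      then show ?thesis unfolding I using p by (simp add: w_def t_def)
    qed
    moreover have "\<exists>b\<in>I. w b \<noteq> 0"
      using v(1) unfolding w_def I'_def by auto
    ultimately show ?thesis by (intro exI[of _ w]) auto
  qed
qed

lemma quadratic_nonneg_discriminant:
  fixes a b c :: real
  assumes "\<And>t. 0 \<le> a + 2 * t * b + t\<^sup>2 * c" and "0 \<le> c"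
  shows "b\<^sup>2 \<le> a * c"
proof (cases "c = 0")
  case True
  show ?thesis
  proof (rule ccontr)
    assume "\<not> ?thesis"
    then have "b \<noteq> 0" using True by auto
    then have "a + 2 * (- (a + 1) / (2 * b)) * b = -1" by (simp add: field_simps)
    with assms(1)[of "- (a + 1) / (2 * b)"] True show False by simp
  qed
next
  case False
  with assms(2) have c: "c > 0" by simp
  have "0 \<le> a + 2 * (- b / c) * b + (- b / c)\<^sup>2 * c" by (rule assms(1))
  also have "\<dots> = a - b\<^sup>2 / c" using c by (simp add: power2_eq_square field_simps)
  finally show ?thesis using c by (simp add: field_simps)
qed

text \<open>
  Vectors are functions of which only the values on \<open>I\<close> count. This allows sizes that vary within a
  proof, and products of index sets.
\<close>
definition bilform :: "'a set \<Rightarrow> ('a \<Rightarrow> 'a \<Rightarrow> real) \<Rightarrow> ('a \<Rightarrow> real) \<Rightarrow> ('a \<Rightarrow> real) \<Rightarrow> real" where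
  "bilform I M u v = (\<Sum>a\<in>I. \<Sum>b\<in>I. M a b * u a * v b)"

lemma bilform_commute:
  assumes "\<And>a b. a \<in> I \<Longrightarrow> b \<in> I \<Longrightarrow> M a b = M b a"
  shows "bilform I M u v = bilform I M v u"
  unfolding bilform_def by (subst sum.swap) (auto intro!: sum.cong simp: assms)

lemma bilform_row: "bilform I M u v = (\<Sum>b\<in>I. (\<Sum>a\<in>I. u a * M a b) * v b)"
  unfolding bilform_def by (subst sum.swap) (simp add: sum_distrib_right sum_distrib_left mult_ac)

lemma bilform_col: "bilform I M u v = (\<Sum>a\<in>I. u a * (\<Sum>b\<in>I. M a b * v b))"
  unfolding bilform_def by (simp add: sum_distrib_left mult_ac)

lemma bilform_add_scaled:
  assumes "\<And>a b. a \<in> I \<Longrightarrow> b \<in> I \<Longrightarrow> M a b = M b a"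
  shows "bilform I M (\<lambda>a. u a + t * v a) (\<lambda>a. u a + t * v a)
    = bilform I M u u + 2 * t * bilform I M u v + t\<^sup>2 * bilform I M v v"
proof -
  have "bilform I M (\<lambda>a. u a + t * v a) (\<lambda>a. u a + t * v a)
    = bilform I M u u + t * bilform I M u v + t * bilform I M v u + t\<^sup>2 * bilform I M v v"
    unfolding bilform_def
    by (simp add: algebra_simps sum.distrib sum_distrib_left power2_eq_square)
  then show ?thesis using bilform_commute[of I M v u] assms by simp
qed

lemma psd_cauchy_schwarz:
  assumes "\<And>a b. a \<in> I \<Longrightarrow> b \<in> I \<Longrightarrow> M a b = M b a" and "\<And>v. 0 \<le> bilform I M v v"
  shows "(bilform I M u v)\<^sup>2 \<le> bilform I M u u * bilform I M v v"
  using assms by (intro quadratic_nonneg_discriminant) (simp flip: bilform_add_scaled)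

lemma psd_zero_imp_kernel:
  assumes "\<And>a b. a \<in> I \<Longrightarrow> b \<in> I \<Longrightarrow> M a b = M b a" and "\<And>v. 0 \<le> bilform I M v v"
    and "bilform I M v v = 0"
  shows "bilform I M u v = 0"
  using psd_cauchy_schwarz[OF assms(1,2), of u v] assms(3) by simp

text \<open>
  The quantitative form of a kernel inclusion, used in place of a smallest positive eigenvalue: \<open>f\<close>
  is a combination \<open>u\<^sup>T M\<close> of the rows of \<open>M\<close>, and Cauchy-Schwarz for the form of \<open>M\<close> bounds the square
  of \<open>f v = u\<^sup>T M v\<close> by \<open>(u\<^sup>T M u) (v\<^sup>T M v)\<close>.
\<close>
lemma functional_dominated_by_psd:
  assumes "finite I"
    and "\<And>a b. a \<in> I \<Longrightarrow> b \<in> I \<Longrightarrow> M a b = M b a" and "\<And>v. 0 \<le> bilform I M v v"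
    and "\<And>v. (\<And>u. bilform I M u v = 0) \<Longrightarrow> (\<Sum>b\<in>I. f b * v b) = 0"
  shows "\<exists>K>0. \<forall>v. (\<Sum>b\<in>I. f b * v b)\<^sup>2 \<le> K * bilform I M v v"
proof -
  have "\<exists>u. \<forall>b\<in>I. f b = (\<Sum>a\<in>I. u a * M a b)"
    by (rule functional_in_row_span[OF assms(1,1)], rule assms(4)) (simp add: bilform_col)
  then obtain u where u: "\<forall>b\<in>I. f b = (\<Sum>a\<in>I. u a * M a b)" by blast
  have eq: "(\<Sum>b\<in>I. f b * v b) = bilform I M u v" for v
    unfolding bilform_row using u by (auto intro!: sum.cong)
  have "(\<Sum>b\<in>I. f b * v b)\<^sup>2 \<le> (bilform I M u u + 1) * bilform I M v v" for v
    using psd_cauchy_schwarz[OF assms(2,3), of u v] assms(3)[of v] by (simp add: eq algebra_simps)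
  \<comment> \<open>The summand 1 keeps the constant positive when the functional is zero.\<close>
  then show ?thesis using assms(3)[of u] by (intro exI[of _ "bilform I M u u + 1"]) auto
qed

lemma functionals_dominated_by_psd:
  assumes "finite I" and "finite P"
    and "\<And>a b. a \<in> I \<Longrightarrow> b \<in> I \<Longrightarrow> M a b = M b a" and "\<And>v. 0 \<le> bilform I M v v"
    and "\<And>p v. p \<in> P \<Longrightarrow> (\<And>u. bilform I M u v = 0) \<Longrightarrow> (\<Sum>b\<in>I. f p b * v b) = 0"
  shows "\<exists>K>0. \<forall>v. (\<Sum>p\<in>P. (\<Sum>b\<in>I. f p b * v b)\<^sup>2) \<le> K * bilform I M v v"
proof -
  have "\<forall>p\<in>P. \<exists>K>0. \<forall>v. (\<Sum>b\<in>I. f p b * v b)\<^sup>2 \<le> K * bilform I M v v"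
    using assms by (intro ballI functional_dominated_by_psd) auto
  then obtain K where K: "\<And>p. p \<in> P \<Longrightarrow> K p > 0"
    "\<And>p v. p \<in> P \<Longrightarrow> (\<Sum>b\<in>I. f p b * v b)\<^sup>2 \<le> K p * bilform I M v v" by metis
  have "(\<Sum>p\<in>P. (\<Sum>b\<in>I. f p b * v b)\<^sup>2) \<le> (\<Sum>p\<in>P. K p) * bilform I M v v" for v
    unfolding sum_distrib_right by (intro sum_mono K)
  moreover have "(\<Sum>p\<in>P. K p) * bilform I M v v \<le> ((\<Sum>p\<in>P. K p) + 1) * bilform I M v v" for v
    using assms(4)[of v] by (simp add: algebra_simps)
  moreover have "(\<Sum>p\<in>P. K p) \<ge> 0" using K(1) by (intro sum_nonneg) (auto intro: less_imp_le)
  ultimately show ?thesis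
    by (intro exI[of _ "(\<Sum>p\<in>P. K p) + 1"]) (auto intro: order_trans)
qed

lemma abs_product_le_sum_squares:
  fixes v :: "'a \<Rightarrow> real"
  assumes "finite I" "a \<in> I" "b \<in> I"
  shows "\<bar>v a\<bar> * \<bar>v b\<bar> \<le> (\<Sum>c\<in>I. (v c)\<^sup>2)"
proof -
  have le: "(v c)\<^sup>2 \<le> (\<Sum>c\<in>I. (v c)\<^sup>2)" if "c \<in> I" for c
    using that assms(1) by (intro member_le_sum) auto
  have "2 * (\<bar>v a\<bar> * \<bar>v b\<bar>) \<le> (v a)\<^sup>2 + (v b)\<^sup>2"
    using sum_squares_bound[of "\<bar>v a\<bar>" "\<bar>v b\<bar>"] by (simp add: mult.assoc)
  then show ?thesis using le[OF assms(2)] le[OF assms(3)] by linarith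
qed

text \<open>
  Since \<open>N\<close> is symmetric, \<open>N\<^sup>2\<close> and \<open>N\<close> have the same kernel, so each row of \<open>N\<close> lies in the row space
  of \<open>N\<^sup>2\<close>. This produces a matrix \<open>Y\<close> with \<open>N = N Y N\<close>, and \<open>w\<^sup>T N w\<close> becomes a quadratic form in \<open>N w\<close>.
\<close>
lemma symmetric_form_dominated_by_square:
  fixes N :: "'a \<Rightarrow> 'a \<Rightarrow> real"
  assumes "finite I" and sym: "\<And>a b. a \<in> I \<Longrightarrow> b \<in> I \<Longrightarrow> N a b = N b a"
  shows "\<exists>K>0. \<forall>w. \<bar>bilform I N w w\<bar> \<le> K * (\<Sum>a\<in>I. (\<Sum>b\<in>I. N a b * w b)\<^sup>2)"
proof -
  define ap where "ap w a = (\<Sum>b\<in>I. N a b * w b)" for w :: "'a \<Rightarrow> real" and a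
  define ip where "ip x y = (\<Sum>a\<in>I. x a * y a)" for x y :: "'a \<Rightarrow> real"
  have adj: "ip (ap x) y = ip x (ap y)" for x y
    unfolding ip_def ap_def sum_distrib_left sum_distrib_right
    by (subst sum.swap) (auto intro!: sum.cong simp: sym)
  have ex: "\<exists>y. \<forall>b\<in>I. N k b = ap (ap y) b" if "k \<in> I" for k
  proof -
    have "\<exists>u. \<forall>b\<in>I. N k b = (\<Sum>a\<in>I. u a * (\<Sum>c\<in>I. N a c * N c b))"
    proof (rule functional_in_row_span[OF assms(1,1)])
      fix v assume "\<forall>a\<in>I. (\<Sum>b\<in>I. (\<Sum>c\<in>I. N a c * N c b) * v b) = 0"
      moreover have "(\<Sum>b\<in>I. (\<Sum>c\<in>I. N a c * N c b) * v b) = ap (ap v) a" for a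
        unfolding ap_def sum_distrib_left sum_distrib_right
        by (subst sum.swap) (simp add: mult_ac)
      ultimately have "ip v (ap (ap v)) = 0" by (simp add: ip_def)
      then have "ip (ap v) (ap v) = 0" by (simp add: adj)
      then have "\<forall>a\<in>I. ap v a * ap v a = 0"
        using \<open>finite I\<close> unfolding ip_def by (subst (asm) sum_nonneg_eq_0_iff) auto
      then show "(\<Sum>b\<in>I. N k b * v b) = 0" using that by (simp add: ap_def)
    qed
    then obtain u where u: "\<forall>b\<in>I. N k b = (\<Sum>a\<in>I. u a * (\<Sum>c\<in>I. N a c * N c b))" by blast
    have "(\<Sum>a\<in>I. u a * (\<Sum>c\<in>I. N a c * N c b)) = ap (ap u) b" if "b \<in> I" for b
      unfolding ap_def sum_distrib_left
      by (subst sum.swap) (use that in \<open>auto intro!: sum.cong simp: sym mult_ac\<close>)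
    with u show ?thesis by auto
  qed
  then obtain Y where Y: "\<And>k b. k \<in> I \<Longrightarrow> b \<in> I \<Longrightarrow> N k b = ap (ap (Y k)) b" by metis
  define K where "K = 1 + (\<Sum>k\<in>I. \<Sum>b\<in>I. \<bar>Y k b\<bar>)"
  have K0: "K \<ge> 1" unfolding K_def by (simp add: sum_nonneg)
  have "\<bar>bilform I N w w\<bar> \<le> K * (\<Sum>a\<in>I. (ap w a)\<^sup>2)" for w
  proof -
    define y where "y b = (\<Sum>k\<in>I. w k * Y k b)" for b
    have ap_y: "ap (\<lambda>b. \<Sum>k\<in>I. w k * Z k b) b = (\<Sum>k\<in>I. w k * ap (Z k) b)" for Z b
      unfolding ap_def sum_distrib_left by (subst sum.swap) (simp add: mult_ac)
    have apap: "ap w b = ap (ap y) b" if "b \<in> I" for b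
    proof -
      have "ap w b = (\<Sum>k\<in>I. w k * N k b)"
        using that unfolding ap_def by (auto intro!: sum.cong simp: sym)
      also have "\<dots> = (\<Sum>k\<in>I. w k * ap (ap (Y k)) b)" using Y that by simp
      also have "\<dots> = ap (\<lambda>b. \<Sum>k\<in>I. w k * ap (Y k) b) b" by (simp add: ap_y)
      also have "(\<lambda>b. \<Sum>k\<in>I. w k * ap (Y k) b) = ap y"
        unfolding y_def[abs_def] by (simp add: ap_y fun_eq_iff)
      finally show ?thesis .
    qed
    have ipc: "ip x u = ip x u'" if "\<And>b. b \<in> I \<Longrightarrow> u b = u' b" for x u u'
      using that by (simp add: ip_def)
    have ap_y_k: "ap y k = ip (Y k) (ap w)" if "k \<in> I" for k
    proof -
      have "ap y k = ip (\<lambda>b. N k b) y" by (simp add: ap_def ip_def)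
      also have "\<dots> = ip (ap (ap (Y k))) y" using Y that by (simp add: ip_def)
      also have "\<dots> = ip (Y k) (ap (ap y))" by (simp add: adj)
      also have "\<dots> = ip (Y k) (ap w)" by (rule ipc) (simp add: apap)
      finally show ?thesis .
    qed
    have "bilform I N w w = ip w (ap w)" by (simp add: bilform_col ip_def ap_def)
    also have "\<dots> = ip w (ap (ap y))" by (rule ipc) (rule apap)
    also have "\<dots> = ip (ap w) (ap y)" by (simp add: adj)
    also have "\<dots> = (\<Sum>k\<in>I. ap w k * (\<Sum>b\<in>I. Y k b * ap w b))"
      by (simp add: ip_def[of _ "ap y"] ap_y_k) (simp add: ip_def)
    finally have "\<bar>bilform I N w w\<bar> \<le> (\<Sum>k\<in>I. \<Sum>b\<in>I. \<bar>ap w k * (Y k b * ap w b)\<bar>)"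
      by (simp add: sum_distrib_left) (rule order_trans[OF sum_abs], intro sum_mono sum_abs)
    also have "\<dots> \<le> (\<Sum>k\<in>I. \<Sum>b\<in>I. \<bar>Y k b\<bar> * (\<Sum>a\<in>I. (ap w a)\<^sup>2))"
    proof (intro sum_mono)
      fix k b assume kb: "k \<in> I" "b \<in> I"
      have "\<bar>ap w k\<bar> * \<bar>ap w b\<bar> \<le> (\<Sum>a\<in>I. (ap w a)\<^sup>2)"
        by (rule abs_product_le_sum_squares[OF \<open>finite I\<close> kb])
      then have "\<bar>Y k b\<bar> * (\<bar>ap w k\<bar> * \<bar>ap w b\<bar>) \<le> \<bar>Y k b\<bar> * (\<Sum>a\<in>I. (ap w a)\<^sup>2)"
        by (intro mult_left_mono) auto
      then show "\<bar>ap w k * (Y k b * ap w b)\<bar> \<le> \<bar>Y k b\<bar> * (\<Sum>a\<in>I. (ap w a)\<^sup>2)"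
        by (simp add: abs_mult mult_ac)
    qed
    also have "\<dots> \<le> K * (\<Sum>a\<in>I. (ap w a)\<^sup>2)"
      unfolding K_def by (simp add: sum_distrib_right distrib_right sum_nonneg)
    finally show ?thesis .
  qed
  then show ?thesis using K0 unfolding ap_def by (intro exI[of _ K]) auto
qed

section \<open>Generic linear functionals have unique maximizers\<close>

text \<open>
  The translates of \<open>C\<close> by the vectors \<open>e / (k + 1)\<close> are pairwise disjoint, have equal measure and stay in one ball.
\<close>
lemma bounded_disjoint_translates_null:
  fixes C :: "'a::euclidean_space set"
  assumes "compact C" and disj: "\<And>x s t. x + s *\<^sub>R e \<in> C \<Longrightarrow> x + t *\<^sub>R e \<in> C \<Longrightarrow> s = t"
  shows "emeasure lborel C = 0"
proof -
  define T where "T k = (+) ((1 / Suc k) *\<^sub>R e) ` C" for k :: nat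
  have Tc: "compact (T k)" for k unfolding T_def by (intro compact_translation assms)
  have Ts: "T k \<in> sets lborel" for k
    using Tc[of k] by (simp add: borel_compact)
  have em: "emeasure lborel (T k) = emeasure lborel C" for k
  proof -
    let ?c = "(1 / Suc k) *\<^sub>R e"
    have "emeasure lborel (T k) = emeasure (distr lborel borel ((+) ?c)) (T k)"
      by (simp only: lborel_distr_plus)
    also have "\<dots> = emeasure lborel ((+) ?c -` T k \<inter> space lborel)"
      using Ts[of k] by (intro emeasure_distr) auto
    also have "(+) ?c -` T k \<inter> space lborel = C"
      unfolding T_def by auto
    finally show ?thesis .
  qed
  have dis: "disjoint_family T"
    unfolding disjoint_family_on_def
  proof (intro ballI impI)
    fix k l :: nat assume kl: "k \<noteq> l"
    show "T k \<inter> T l = {}"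
    proof (rule ccontr)
      assume "T k \<inter> T l \<noteq> {}"
      then obtain x y where xy: "x \<in> C" "y \<in> C" "(1 / Suc k) *\<^sub>R e + x = (1 / Suc l) *\<^sub>R e + y"
        unfolding T_def by auto
      then have y: "y = x + (1 / Suc k - 1 / Suc l) *\<^sub>R e"
        by (simp add: scaleR_left_diff_distrib) (metis add.commute add_diff_cancel_left' diff_add_eq)
      have "0 = (1 / Suc k - 1 / Suc l :: real)"
        using disj[of x 0 "1 / Suc k - 1 / Suc l"] xy(1,2) unfolding y by simp
      then have "1 / real (Suc k) = 1 / real (Suc l)" by simp
      then have "real (Suc k) = real (Suc l)" by (subst (asm) divide_cancel_left) auto
      then show False using kl by simp
    qed
  qed
  obtain B where B: "\<And>x. x \<in> C \<Longrightarrow> norm x \<le> B"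
    using compact_imp_bounded[OF assms(1)] unfolding bounded_iff by auto
  have sub: "(\<Union>k. T k) \<subseteq> cball 0 (norm e + B)"
  proof
    fix y assume "y \<in> (\<Union>k. T k)"
    then obtain k x where x: "x \<in> C" "y = (1 / Suc k) *\<^sub>R e + x" unfolding T_def by auto
    have "norm y \<le> norm ((1 / Suc k) *\<^sub>R e) + norm x" 
      unfolding x(2) by (rule norm_triangle_ineq)
    also have "\<dots> \<le> norm e + B"
      using B[OF x(1)] by (intro add_mono) (auto simp: divide_le_eq distrib_left)
    finally show "y \<in> cball 0 (norm e + B)" by simp
  qed
  have "(\<Sum>k. emeasure lborel (T k)) = emeasure lborel (\<Union>k. T k)"
    using Ts by (intro suminf_emeasure dis) auto
  also have "\<dots> \<le> emeasure lborel (cball (0::'a) (norm e + B))"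
    using sub by (intro emeasure_mono) auto
  also have "\<dots> < \<infinity>" by (intro emeasure_bounded_finite) auto
  finally have fin: "(\<Sum>k::nat. emeasure lborel C) < \<infinity>" by (simp add: em)
  have le: "of_nat n * emeasure lborel C \<le> (\<Sum>k::nat. emeasure lborel C)" for n
    using sum_le_suminf[of "\<lambda>_. emeasure lborel C" "{..<n}"] by simp
  obtain s where s: "(\<Sum>k::nat. emeasure lborel C) = ennreal s" "s \<ge> 0"
    using fin by (cases "\<Sum>k::nat. emeasure lborel C") auto
  obtain c where c: "emeasure lborel C = ennreal c" "c \<ge> 0"
    using le[of 1] fin by (cases "emeasure lborel C") auto
  have "real n * c \<le> s" for n
  proof -
    have "ennreal (real n * c) = of_nat n * ennreal c"
      by (subst ennreal_mult) (simp_all only: ennreal_of_nat_eq_real_of_nat c(2) of_nat_0_le_iff)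
    then have "ennreal (real n * c) \<le> ennreal s" using le[of n] unfolding c(1) s(1)[unfolded c(1)] by simp
    then show ?thesis using s(2) by (simp only: ennreal_le_iff)
  qed
  moreover have "\<exists>n. s < real n * c" if "0 < c"
    using reals_Archimedean3[OF that] by blast
  ultimately have "c \<le> 0" by (meson linorder_not_le)
  with c show ?thesis by simp
qed

lemma closed_transversal_null:
  fixes C :: "'a::euclidean_space set"
  assumes "closed C" and disj: "\<And>x s t. x + s *\<^sub>R e \<in> C \<Longrightarrow> x + t *\<^sub>R e \<in> C \<Longrightarrow> s = t"
  shows "C \<in> null_sets lborel"
proof -
  have "C \<inter> cball 0 (real n) \<in> null_sets lborel" for n
  proof (rule null_setsI)
    have c: "compact (C \<inter> cball 0 (real n))" using assms(1) by (intro closed_Int_compact) auto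
    show "emeasure lborel (C \<inter> cball 0 (real n)) = 0"
      by (rule bounded_disjoint_translates_null[OF c, of e]) (elim IntE, rule disj)
    show "C \<inter> cball 0 (real n) \<in> sets lborel" using c by (simp add: borel_compact)
  qed
  then have "(\<Union>n. C \<inter> cball 0 (real n)) \<in> null_sets lborel" by (rule null_sets_UN)
  moreover have "(\<Union>n. C \<inter> cball 0 (real n)) = C"
  proof (intro equalityI subsetI)
    fix x assume "x \<in> C"
    moreover obtain n where "norm x \<le> real n" using real_arch_simple by blast
    ultimately show "x \<in> (\<Union>n. C \<inter> cball 0 (real n))" by auto
  qed blast
  ultimately show ?thesis by simp
qed

text \<open>
  The set is the projection along the compact set \<open>T\<close> of a closed set of pairs \<open>(\<gamma>, l)\<close>.
\<close>
lemma closed_maximizing_functionals: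
  fixes S T :: "'a::euclidean_space set"
  assumes "compact T"
  shows "closed {l. \<exists>\<gamma>\<in>T. \<forall>\<gamma>'\<in>S. l \<bullet> \<gamma>' \<le> l \<bullet> \<gamma>}"
proof -
  let ?R = "\<Inter>\<gamma>'\<in>S. {z. snd z \<bullet> \<gamma>' \<le> snd z \<bullet> fst z}"
  have "closed ?R"
    by (intro closed_INT ballI closed_Collect_le continuous_intros)
  from closed_compact_projection[OF assms this]
  have "closed {l. \<exists>\<gamma>. \<gamma> \<in> T \<and> (\<gamma>, l) \<in> ?R}" .
  moreover have "{l. \<exists>\<gamma>. \<gamma> \<in> T \<and> (\<gamma>, l) \<in> ?R} = {l. \<exists>\<gamma>\<in>T. \<forall>\<gamma>'\<in>S. l \<bullet> \<gamma>' \<le> l \<bullet> \<gamma>}"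
    by auto
  ultimately show ?thesis by simp
qed

text \<open>
  Two maximizers of \<open>l\<close> differ in a coordinate \<open>e\<close>, and rational numbers \<open>p < q\<close> separate the two
  values; \<open>C e p q\<close> is the set of such \<open>l\<close>. On a line \<open>x + s e\<close> the \<open>e\<close>-coordinate of a maximizer
  does not decrease with \<open>s\<close>. So a maximizer with coordinate at least \<open>q\<close> at one parameter rules out
  one with coordinate at most \<open>p\<close> at any larger parameter, and the line meets \<open>C e p q\<close> at most once.
\<close>
lemma unique_maximizer_ae:
  fixes S :: "'a::euclidean_space set"
  assumes "compact S"
  shows "AE l in lborel. \<forall>\<gamma> \<gamma>'. is_arg_max ((\<bullet>) l) (\<lambda>\<gamma>. \<gamma> \<in> S) \<gamma> \<longrightarrow>
    is_arg_max ((\<bullet>) l) (\<lambda>\<gamma>. \<gamma> \<in> S) \<gamma>' \<longrightarrow> \<gamma> = \<gamma>'"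
proof -
  define L where "L T = {l. \<exists>\<gamma>\<in>T. \<forall>\<gamma>'\<in>S. l \<bullet> \<gamma>' \<le> l \<bullet> \<gamma>}" for T
  define C where "C e p q = L (S \<inter> {\<gamma>. \<gamma> \<bullet> e \<le> p}) \<inter> L (S \<inter> {\<gamma>. \<gamma> \<bullet> e \<ge> q})" for e p q
  have "C e p q \<in> null_sets lborel" if "p < q" for e p q
  proof (rule closed_transversal_null)
    show "closed (C e p q)"
      unfolding C_def L_def using assms
      by (intro closed_Int closed_maximizing_functionals compact_Int_closed
          closed_Collect_le continuous_intros)
    have less: False if st: "s < t" "x + s *\<^sub>R e \<in> C e p q" "x + t *\<^sub>R e \<in> C e p q" for x s t
    proof -
      from st(2) obtain a where a: "a \<in> S" "a \<bullet> e \<ge> q" "\<forall>b\<in>S. (x + s *\<^sub>R e) \<bullet> b \<le> (x + s *\<^sub>R e) \<bullet> a"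
        unfolding C_def L_def by auto
      from st(3) obtain b where b: "b \<in> S" "b \<bullet> e \<le> p" "\<forall>a\<in>S. (x + t *\<^sub>R e) \<bullet> a \<le> (x + t *\<^sub>R e) \<bullet> b"
        unfolding C_def L_def by auto
      have "x \<bullet> b + s * (e \<bullet> b) \<le> x \<bullet> a + s * (e \<bullet> a)" using a b by (auto simp: inner_add_left)
      moreover have "x \<bullet> a + t * (e \<bullet> a) \<le> x \<bullet> b + t * (e \<bullet> b)" using a b by (auto simp: inner_add_left)
      ultimately have "(t - s) * (e \<bullet> a) \<le> (t - s) * (e \<bullet> b)" by (simp add: algebra_simps)
      then have "e \<bullet> a \<le> e \<bullet> b" using st(1) by simp
      then show False using a b \<open>p < q\<close> by (simp add: inner_commute)
    qed
    show "s = t" if "x + s *\<^sub>R e \<in> C e p q" "x + t *\<^sub>R e \<in> C e p q" for x s t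
      using less[of s t x] less[of t s x] that by force
  qed
  then have null: "(\<Union>e\<in>Basis. \<Union>p\<in>\<rat>. \<Union>q\<in>\<rat> \<inter> {p<..}. C e p q) \<in> null_sets lborel"
    by (intro null_sets_UN' countable_finite countable_rat countable_Int1) auto
  show ?thesis
  proof (rule AE_I'[OF null], rule subsetI)
    fix l assume "l \<in> {l \<in> space lborel. \<not> (\<forall>\<gamma> \<gamma>'. is_arg_max ((\<bullet>) l) (\<lambda>\<gamma>. \<gamma> \<in> S) \<gamma> \<longrightarrow>
      is_arg_max ((\<bullet>) l) (\<lambda>\<gamma>. \<gamma> \<in> S) \<gamma>' \<longrightarrow> \<gamma> = \<gamma>')}"
    then obtain a b where ab: "is_arg_max ((\<bullet>) l) (\<lambda>\<gamma>. \<gamma> \<in> S) a"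
      "is_arg_max ((\<bullet>) l) (\<lambda>\<gamma>. \<gamma> \<in> S) b" "a \<noteq> b" by auto
    have mx: "\<forall>c\<in>S. l \<bullet> c \<le> l \<bullet> a" "\<forall>c\<in>S. l \<bullet> c \<le> l \<bullet> b" "a \<in> S" "b \<in> S"
      using ab(1,2) unfolding is_arg_max_def by (auto simp: not_less)
    obtain e where e: "e \<in> Basis" "a \<bullet> e \<noteq> b \<bullet> e" using ab(3) euclidean_eqI by blast
    have *: "\<exists>p\<in>\<rat>. \<exists>q\<in>\<rat> \<inter> {p<..}. l \<in> C e p q"
      if h: "\<forall>c\<in>S. l \<bullet> c \<le> l \<bullet> a" "\<forall>c\<in>S. l \<bullet> c \<le> l \<bullet> b" "a \<in> S" "b \<in> S" "a \<bullet> e < b \<bullet> e" for a b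
    proof -
      obtain p where p: "p \<in> \<rat>" "a \<bullet> e < p" "p < b \<bullet> e" using Rats_dense_in_real[OF h(5)] by auto
      obtain q where q: "q \<in> \<rat>" "p < q" "q < b \<bullet> e" using Rats_dense_in_real[OF p(3)] by auto
      have "l \<in> C e p q" unfolding C_def L_def using h p q by (auto intro: less_imp_le)
      then show ?thesis using p q by auto
    qed
    show "l \<in> (\<Union>e\<in>Basis. \<Union>p\<in>\<rat>. \<Union>q\<in>\<rat> \<inter> {p<..}. C e p q)"
    proof (cases "a \<bullet> e < b \<bullet> e")
      case True
      then show ?thesis using *[OF mx] e(1) by blast
    next
      case False
      then have "b \<bullet> e < a \<bullet> e" using e(2) by simp
      then show ?thesis using *[OF mx(2,1,4,3)] e(1) by blast
    qed
  qed
qed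

text \<open>
  If a maximizer lies strictly between two points of \<open>S\<close>, both of them are maximizers as well.
\<close>
lemma unique_maximizer_extreme:
  fixes S :: "'a::euclidean_space set"
  assumes "is_arg_max ((\<bullet>) l) (\<lambda>\<gamma>. \<gamma> \<in> S) \<gamma>"
    and "\<And>\<gamma>'. is_arg_max ((\<bullet>) l) (\<lambda>\<gamma>. \<gamma> \<in> S) \<gamma>' \<Longrightarrow> \<gamma>' = \<gamma>"
  shows "\<gamma> extreme_point_of S"
  unfolding extreme_point_of_def
proof (intro conjI ballI notI)
  have mx: "\<gamma> \<in> S" "\<And>c. c \<in> S \<Longrightarrow> l \<bullet> c \<le> l \<bullet> \<gamma>"
    using assms(1) unfolding is_arg_max_def by (auto simp: not_less)
  then show "\<gamma> \<in> S" by simp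
  fix a b assume ab: "a \<in> S" "b \<in> S" "\<gamma> \<in> open_segment a b"
  then obtain u where u: "0 < u" "u < 1" "\<gamma> = (1 - u) *\<^sub>R a + u *\<^sub>R b" "a \<noteq> b"
    unfolding in_segment by auto
  have eq: "l \<bullet> \<gamma> = (1 - u) * (l \<bullet> a) + u * (l \<bullet> b)" by (simp add: u(3) inner_add_right)
  have "u * (l \<bullet> b) \<le> u * (l \<bullet> \<gamma>)" "(1 - u) * (l \<bullet> a) \<le> (1 - u) * (l \<bullet> \<gamma>)"
    using mx(2)[OF ab(1)] mx(2)[OF ab(2)] u by (auto intro!: mult_left_mono)
  then have "(1 - u) * (l \<bullet> \<gamma>) \<le> (1 - u) * (l \<bullet> a)" "u * (l \<bullet> \<gamma>) \<le> u * (l \<bullet> b)"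
    using eq unfolding left_diff_distrib by linarith+
  then have "l \<bullet> \<gamma> \<le> l \<bullet> a" "l \<bullet> \<gamma> \<le> l \<bullet> b" using u by (simp_all add: mult_le_cancel_left)
  then have "is_arg_max ((\<bullet>) l) (\<lambda>\<gamma>. \<gamma> \<in> S) a" "is_arg_max ((\<bullet>) l) (\<lambda>\<gamma>. \<gamma> \<in> S) b"
    using ab mx unfolding is_arg_max_def by (auto simp: not_less intro: order_trans)
  then have "a = \<gamma>" "b = \<gamma>" using assms(2) by auto
  then show False using u(4) by simp
qed

text \<open>
  The maximizers form a face, and an extreme point of a face is an extreme point of the whole set.
\<close>
lemma compact_has_extreme_maximizer:
  fixes S :: "'a::euclidean_space set"
  assumes "compact S" and "convex S" and "S \<noteq> {}"
  shows "\<exists>\<gamma>. is_arg_max ((\<bullet>) l) (\<lambda>\<gamma>. \<gamma> \<in> S) \<gamma> \<and> \<gamma> extreme_point_of S"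
proof -
  obtain \<gamma> where \<gamma>: "\<gamma> \<in> S" "\<And>c. c \<in> S \<Longrightarrow> l \<bullet> c \<le> l \<bullet> \<gamma>"
    using continuous_attains_sup[OF assms(1,3), of "(\<bullet>) l"] continuous_on_inner[OF continuous_on_const continuous_on_id]
    by blast
  have face: "(S \<inter> {x. l \<bullet> x = l \<bullet> \<gamma>}) face_of S"
    by (rule face_of_Int_supporting_hyperplane_le[OF assms(2) \<gamma>(2)])
  have "compact (S \<inter> {x. l \<bullet> x = l \<bullet> \<gamma>})" using assms(1) by (intro compact_Int_closed closed_hyperplane)
  moreover have "convex (S \<inter> {x. l \<bullet> x = l \<bullet> \<gamma>})" using assms(2) by (intro convex_Int convex_hyperplane)
  ultimately obtain e where e: "e extreme_point_of (S \<inter> {x. l \<bullet> x = l \<bullet> \<gamma>})"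
    using extreme_point_exists_convex[of "S \<inter> {x. l \<bullet> x = l \<bullet> \<gamma>}"] \<gamma>(1) by blast
  then have "e extreme_point_of S" "l \<bullet> e = l \<bullet> \<gamma>" "e \<in> S"
    using extreme_point_of_face[OF face] by (auto simp: extreme_point_of_def)
  then show ?thesis using \<gamma>(2) unfolding is_arg_max_def by (intro exI[of _ e]) (auto simp: not_less)
qed

lemma generic_corner_extreme:
  fixes S :: "(real^'g::finite) set"
  assumes "compact S" "convex S" "S \<noteq> {}"
  shows "AE l in lborel. (\<exists>\<gamma>. \<gamma> \<in> corner_choices (\<lambda>\<gamma> S. True) S l) \<and>
    (\<forall>\<gamma>\<in>corner_choices (\<lambda>\<gamma> S. True) S l. \<gamma> extreme_point_of S)"
  using unique_maximizer_ae[OF assms(1)]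
proof eventually_elim
  case (elim l)
  then show ?case
    unfolding corner_choices_def
    using compact_has_extreme_maximizer[OF assms, of l] unique_maximizer_extreme[of l S] by blast
qed

section \<open>The linear pencil as a bilinear form\<close>

text \<open>
  An element of \<open>\<real>\<^sup>d \<otimes> \<real>\<^sup>n\<close> is represented by the \<open>n\<close>-tuple \<open>V\<close> of its components \<open>V q\<close> in \<open>\<real>\<^sup>d\<close>.
  Multiplication by a matrix on the side of \<open>\<real>\<^sup>n\<close> then takes linear combinations of the \<open>V q\<close>, and
  adding a row and a column to a tuple appends one component.
\<close>
definition dot :: "nat \<Rightarrow> (nat \<Rightarrow> real) \<Rightarrow> (nat \<Rightarrow> real) \<Rightarrow> real" where
  "dot d x y = (\<Sum>p<d. x p * y p)"

definition aform :: "nat \<Rightarrow> real mat \<Rightarrow> (nat \<Rightarrow> real) \<Rightarrow> (nat \<Rightarrow> real) \<Rightarrow> real" where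
  "aform d M x y = (\<Sum>p<d. \<Sum>p'<d. M $$ (p, p') * x p * y p')"

definition Lam_form :: "nat \<Rightarrow> 'g::finite mat_tuple \<Rightarrow> nat \<Rightarrow> nat \<Rightarrow> 'g mat_tuple \<Rightarrow>
    (nat \<Rightarrow> nat \<Rightarrow> real) \<Rightarrow> (nat \<Rightarrow> nat \<Rightarrow> real) \<Rightarrow> real" where
  "Lam_form d A m n M U V = (\<Sum>i\<in>UNIV. \<Sum>q<m. \<Sum>q'<n. M i $$ (q, q') * aform d (A i) (U q) (V q'))"

definition pencil_form :: "nat \<Rightarrow> 'g::finite mat_tuple \<Rightarrow> nat \<Rightarrow> 'g mat_tuple \<Rightarrow>
    (nat \<Rightarrow> nat \<Rightarrow> real) \<Rightarrow> (nat \<Rightarrow> nat \<Rightarrow> real) \<Rightarrow> real" where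
  "pencil_form d A n X V W = (\<Sum>q<n. dot d (V q) (W q)) - Lam_form d A n n X V W"

text \<open>
  The value \<open>\<langle>w, \<Lambda>\<^sub>A(\<beta>\<^sup>T) V\<rangle>\<close> of the operator that occurs in the definition of dilation directions.
\<close>
definition row_form :: "nat \<Rightarrow> 'g::finite mat_tuple \<Rightarrow> nat \<Rightarrow> 'g mat_tuple \<Rightarrow>
    (nat \<Rightarrow> real) \<Rightarrow> (nat \<Rightarrow> nat \<Rightarrow> real) \<Rightarrow> real" where
  "row_form d A n \<beta> w V = (\<Sum>i\<in>UNIV. \<Sum>q<n. \<beta> i $$ (q, 0) * aform d (A i) w (V q))"

text \<open>
  The Kronecker product uses the index \<open>p * n + q\<close> for the pair of \<open>p < d\<close> and \<open>q < n\<close>.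
\<close>
lemma sum_grid:
  fixes f :: "nat \<Rightarrow> 'a::comm_monoid_add"
  shows "(\<Sum>k<d * n. f k) = (\<Sum>p<d. \<Sum>q<n. f (p * n + q))"
proof -
  have "sum f {p * n..<p * n + n} = (\<Sum>q<n. f (p * n + q))" for p
    using sum.shift_bounds_nat_ivl[of f 0 "p * n" n] by (simp add: lessThan_atLeast0 add.commute)
  then show ?thesis by (simp flip: sum.nat_group)
qed

lemma sum_move_inner_out:
  "(\<Sum>p\<in>P. \<Sum>q\<in>Q. \<Sum>p'\<in>P'. \<Sum>q'\<in>Q'. \<Sum>i\<in>I. g p q p' q' i)
    = (\<Sum>i\<in>I. \<Sum>q\<in>Q. \<Sum>q'\<in>Q'. \<Sum>p\<in>P. \<Sum>p'\<in>P'. (g p q p' q' i :: real))"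
  (is "?L = ?R")
proof -
  have "?L = (\<Sum>p\<in>P. \<Sum>q\<in>Q. \<Sum>p'\<in>P'. \<Sum>i\<in>I. \<Sum>q'\<in>Q'. g p q p' q' i)"
    by (rule sum.cong[OF refl], rule sum.cong[OF refl], rule sum.cong[OF refl], rule sum.swap)
  also have "\<dots> = (\<Sum>p\<in>P. \<Sum>q\<in>Q. \<Sum>i\<in>I. \<Sum>p'\<in>P'. \<Sum>q'\<in>Q'. g p q p' q' i)"
    by (rule sum.cong[OF refl], rule sum.cong[OF refl], rule sum.swap)
  also have "\<dots> = (\<Sum>p\<in>P. \<Sum>i\<in>I. \<Sum>q\<in>Q. \<Sum>p'\<in>P'. \<Sum>q'\<in>Q'. g p q p' q' i)"
    by (rule sum.cong[OF refl], rule sum.swap)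
  also have "\<dots> = (\<Sum>i\<in>I. \<Sum>p\<in>P. \<Sum>q\<in>Q. \<Sum>p'\<in>P'. \<Sum>q'\<in>Q'. g p q p' q' i)"
    by (rule sum.swap)
  also have "\<dots> = (\<Sum>i\<in>I. \<Sum>q\<in>Q. \<Sum>p\<in>P. \<Sum>p'\<in>P'. \<Sum>q'\<in>Q'. g p q p' q' i)"
    by (rule sum.cong[OF refl], rule sum.swap)
  also have "\<dots> = (\<Sum>i\<in>I. \<Sum>q\<in>Q. \<Sum>p\<in>P. \<Sum>q'\<in>Q'. \<Sum>p'\<in>P'. g p q p' q' i)"
    by (rule sum.cong[OF refl], rule sum.cong[OF refl], rule sum.cong[OF refl], rule sum.swap)
  also have "\<dots> = ?R"
    by (rule sum.cong[OF refl], rule sum.cong[OF refl], rule sum.swap)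
  finally show ?thesis .
qed

lemma Lam_dims [simp]: "dim_row (Lam d A m n X) = d * m" "dim_col (Lam d A m n X) = d * n"
  by (simp_all add: Lam_def mat_sum_def)

lemma Lam_carrier: "Lam d A m n X \<in> carrier_mat (d * m) (d * n)"
  by (simp add: carrier_matI)

lemma grid_index_less: "p < d \<Longrightarrow> q < n \<Longrightarrow> p * n + q < d * (n::nat)"
  using mult_le_mono1[of "Suc p" d n] by simp

lemma grid_index_exists:
  assumes "a < d * (n::nat)"
  shows "\<exists>p q. a = p * n + q \<and> p < d \<and> q < n"
proof -
  have "0 < n" using assms by (cases n) auto
  then show ?thesis using assms
    by (intro exI[of _ "a div n"] exI[of _ "a mod n"]) (simp add: less_mult_imp_div_less)
qed

lemma Lam_entry:
  assumes "A \<in> tuples d d" and "X \<in> tuples m n" and "p < d" "q < m" "p' < d" "q' < n"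
  shows "Lam d A m n X $$ (p * m + q, p' * n + q') = (\<Sum>i\<in>UNIV. A i $$ (p, p') * X i $$ (q, q'))"
proof -
  have dims: "dim_row (A i) = d" "dim_col (A i) = d" "dim_row (X i) = m" "dim_col (X i) = n" for i
    using assms(1,2) unfolding tuples_def carrier_mat_def by auto
  show ?thesis
    using assms(3-) by (simp add: Lam_def mat_sum_def kronecker_def dims grid_index_less)
qed

lemma Lam_bilinear:
  assumes "A \<in> tuples d d" and "X \<in> tuples m n"
    and "u \<in> carrier_vec (d * m)" and "v \<in> carrier_vec (d * n)"
  shows "u \<bullet> (Lam d A m n X *\<^sub>v v) = Lam_form d A m n X (\<lambda>q p. u $ (p * m + q)) (\<lambda>q p. v $ (p * n + q))"
proof -
  have "u \<bullet> (Lam d A m n X *\<^sub>v v) = (\<Sum>k<d * m. u $ k * (\<Sum>l<d * n. Lam d A m n X $$ (k, l) * v $ l))"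
    using assms(3,4) by (simp add: scalar_prod_def lessThan_atLeast0)
  also have "\<dots> = (\<Sum>p<d. \<Sum>q<m. u $ (p * m + q) * (\<Sum>p'<d. \<Sum>q'<n.
      Lam d A m n X $$ (p * m + q, p' * n + q') * v $ (p' * n + q')))"
    by (simp add: sum_grid)
  also have "\<dots> = (\<Sum>p<d. \<Sum>q<m. \<Sum>p'<d. \<Sum>q'<n. \<Sum>i\<in>UNIV.
      X i $$ (q, q') * (A i $$ (p, p') * u $ (p * m + q) * v $ (p' * n + q')))"
    by (intro sum.cong refl)
      (simp add: Lam_entry[OF assms(1,2)] sum_distrib_left sum_distrib_right mult_ac)
  also have "\<dots> = Lam_form d A m n X (\<lambda>q p. u $ (p * m + q)) (\<lambda>q p. v $ (p * n + q))"
    unfolding Lam_form_def aform_def sum_distrib_left by (rule sum_move_inner_out)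
  finally show ?thesis .
qed

lemma pencil_dims [simp]: "dim_row (pencil d A n X) = d * n" "dim_col (pencil d A n X) = d * n"
  by (simp_all add: pencil_def)

lemma pencil_bilinear:
  assumes "A \<in> tuples d d" and "X \<in> tuples n n"
    and "u \<in> carrier_vec (d * n)" and "v \<in> carrier_vec (d * n)"
  shows "u \<bullet> (pencil d A n X *\<^sub>v v) = pencil_form d A n X (\<lambda>q p. u $ (p * n + q)) (\<lambda>q p. v $ (p * n + q))"
proof -
  have "u \<bullet> (pencil d A n X *\<^sub>v v) = u \<bullet> v - u \<bullet> (Lam d A n n X *\<^sub>v v)"
    unfolding pencil_def using assms(3,4)
    by (simp add: minus_mult_distrib_mat_vec[OF one_carrier_mat Lam_carrier]
        scalar_prod_minus_distrib[OF assms(3)] mult_mat_vec_carrier[OF Lam_carrier])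
  also have "u \<bullet> v = (\<Sum>q<n. dot d (\<lambda>p. u $ (p * n + q)) (\<lambda>p. v $ (p * n + q)))"
    using assms(3,4) unfolding dot_def
    by (subst sum.swap) (simp add: scalar_prod_def sum_grid flip: lessThan_atLeast0)
  finally show ?thesis by (simp add: pencil_form_def Lam_bilinear[OF assms])
qed

lemma aform_cong: "(\<And>p. p < d \<Longrightarrow> x p = x' p) \<Longrightarrow> (\<And>p. p < d \<Longrightarrow> y p = y' p) \<Longrightarrow> aform d M x y = aform d M x' y'"
  by (simp add: aform_def)

lemma dot_cong: "(\<And>p. p < d \<Longrightarrow> x p = x' p) \<Longrightarrow> (\<And>p. p < d \<Longrightarrow> y p = y' p) \<Longrightarrow> dot d x y = dot d x' y'"
  by (simp add: dot_def)

lemma Lam_form_cong: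
  assumes "\<And>p q. p < d \<Longrightarrow> q < m \<Longrightarrow> U q p = U' q p" and "\<And>p q. p < d \<Longrightarrow> q < n \<Longrightarrow> V q p = V' q p"
  shows "Lam_form d A m n X U V = Lam_form d A m n X U' V'"
  unfolding Lam_form_def by (intro sum.cong refl arg_cong[where f="(*) _"] aform_cong) (use assms in auto)

lemma pencil_form_cong:
  assumes "\<And>p q. p < d \<Longrightarrow> q < n \<Longrightarrow> U q p = U' q p" and "\<And>p q. p < d \<Longrightarrow> q < n \<Longrightarrow> V q p = V' q p"
  shows "pencil_form d A n X U V = pencil_form d A n X U' V'"
  unfolding pencil_form_def
  by (intro arg_cong2[where f="(-)"] sum.cong refl Lam_form_cong dot_cong) (use assms in auto)

definition flatten :: "nat \<Rightarrow> nat \<Rightarrow> (nat \<Rightarrow> nat \<Rightarrow> real) \<Rightarrow> real Matrix.vec" where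
  "flatten d n V = Matrix.vec (d * n) (\<lambda>k. V (k mod n) (k div n))"

lemma flatten_carrier [simp]: "flatten d n V \<in> carrier_vec (d * n)"
  by (simp add: flatten_def)

lemma flatten_entry [simp]: "p < d \<Longrightarrow> q < n \<Longrightarrow> flatten d n V $ (p * n + q) = V q p"
  by (simp add: flatten_def grid_index_less)

lemma pencil_form_flatten:
  assumes "A \<in> tuples d d" and "X \<in> tuples n n"
  shows "pencil_form d A n X U V = flatten d n U \<bullet> (pencil d A n X *\<^sub>v flatten d n V)"
  by (subst pencil_bilinear[OF assms]) (auto intro!: pencil_form_cong)

lemma sym_tuples_subset: "sym_tuples n \<subseteq> tuples n n"
  by (auto simp: sym_tuples_def tuples_def)

lemma tuples_entry_sym:
  assumes "X \<in> sym_tuples n" "q < n" "q' < n"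
  shows "X i $$ (q, q') = X i $$ (q', q)"
  using assms unfolding sym_tuples_def
  by (metis (mono_tags, lifting) carrier_matD index_transpose_mat(1) mem_Collect_eq)

lemma transpose_eqI:
  assumes "M \<in> carrier_mat n n" "\<And>a b. a < n \<Longrightarrow> b < n \<Longrightarrow> M $$ (a, b) = M $$ (b, a)"
  shows "transpose_mat M = M"
  using assms by (intro eq_matI) auto

lemma aform_commute:
  assumes "A \<in> sym_tuples d"
  shows "aform d (A i) x y = aform d (A i) y x"
  unfolding aform_def
  by (subst sum.swap) (auto intro!: sum.cong simp: tuples_entry_sym[OF assms] mult_ac)

lemma free_spec_iff:
  assumes "A \<in> sym_tuples d"
  shows "X \<in> free_spec d A n \<longleftrightarrow> X \<in> sym_tuples n \<and> (\<forall>V. 0 \<le> pencil_form d A n X V V)"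
proof (cases "X \<in> sym_tuples n")
  case True
  have A: "A \<in> tuples d d" and X: "X \<in> tuples n n"
    using assms True sym_tuples_subset by auto
  have c: "pencil d A n X \<in> carrier_mat (d * n) (d * n)" by (simp add: carrier_matI)
  have t: "transpose_mat (pencil d A n X) = pencil d A n X"
  proof (rule transpose_eqI[OF c])
    fix a b assume ab: "a < d * n" "b < d * n"
    obtain p q where a: "a = p * n + q" "p < d" "q < n"
      using grid_index_exists[OF ab(1)] by blast
    obtain p' q' where b: "b = p' * n + q'" "p' < d" "q' < n"
      using grid_index_exists[OF ab(2)] by blast
    have "Lam d A n n X $$ (a, b) = Lam d A n n X $$ (b, a)"
      using a b by (simp add: Lam_entry[OF A X] tuples_entry_sym[OF assms, of p p']
          tuples_entry_sym[OF True, of q q'])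
    then show "pencil d A n X $$ (a, b) = pencil d A n X $$ (b, a)"
      using ab by (simp add: pencil_def)
  qed
  have "psd (pencil d A n X) \<longleftrightarrow> (\<forall>V. 0 \<le> pencil_form d A n X V V)"
    unfolding psd_def using c t pencil_bilinear[OF A X] pencil_form_flatten[OF A X] flatten_carrier
    by (metis pencil_dims(1))
  then show ?thesis using True by (simp add: free_spec_def)
next
  case False
  then show ?thesis by (simp add: free_spec_def)
qed

lemma zero_vec_iff_orthogonal:
  assumes "x \<in> carrier_vec n"
  shows "x = 0\<^sub>v n \<longleftrightarrow> (\<forall>u\<in>carrier_vec n. u \<bullet> x = (0::real))"
proof
  assume h: "\<forall>u\<in>carrier_vec n. u \<bullet> x = 0"
  show "x = 0\<^sub>v n"
  proof (rule eq_vecI)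
    fix i assume "i < dim_vec (0\<^sub>v n :: real Matrix.vec)"
    then have i: "i < n" by simp
    have "unit_vec n i \<bullet> x = 0" using h by simp
    then show "x $ i = 0\<^sub>v n $ i" using i assms by simp
  qed (use assms in simp)
qed auto

text \<open>
  Membership in \<open>ker L\<^sub>A(X)\<close>, tested by the bilinear form so that no flat coordinates are needed.
\<close>
definition in_pencil_kernel :: "nat \<Rightarrow> 'g::finite mat_tuple \<Rightarrow> nat \<Rightarrow> 'g mat_tuple \<Rightarrow>
    (nat \<Rightarrow> nat \<Rightarrow> real) \<Rightarrow> bool" where
  "in_pencil_kernel d A n X V \<longleftrightarrow> (\<forall>W. pencil_form d A n X W V = 0)"

lemma mat_kernel_pencil_iff:
  assumes "A \<in> tuples d d" and "X \<in> tuples n n" and "v \<in> carrier_vec (d * n)"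
  shows "v \<in> mat_kernel (pencil d A n X) \<longleftrightarrow> in_pencil_kernel d A n X (\<lambda>q p. v $ (p * n + q))"
proof -
  have "v \<in> mat_kernel (pencil d A n X) \<longleftrightarrow> pencil d A n X *\<^sub>v v = 0\<^sub>v (d * n)"
    using assms(3) by (simp add: mat_kernel_def)
  also have "\<dots> \<longleftrightarrow> (\<forall>u\<in>carrier_vec (d * n). u \<bullet> (pencil d A n X *\<^sub>v v) = 0)"
    by (rule zero_vec_iff_orthogonal) (auto intro!: mult_mat_vec_carrier carrier_matI assms(3))
  also have "\<dots> \<longleftrightarrow> in_pencil_kernel d A n X (\<lambda>q p. v $ (p * n + q))"
  proof
    assume "in_pencil_kernel d A n X (\<lambda>q p. v $ (p * n + q))"
    then show "\<forall>u\<in>carrier_vec (d * n). u \<bullet> (pencil d A n X *\<^sub>v v) = 0"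
      by (simp add: pencil_bilinear[OF assms(1,2) _ assms(3)] in_pencil_kernel_def)
  next
    assume h: "\<forall>u\<in>carrier_vec (d * n). u \<bullet> (pencil d A n X *\<^sub>v v) = 0"
    show "in_pencil_kernel d A n X (\<lambda>q p. v $ (p * n + q))"
      unfolding in_pencil_kernel_def
    proof
      fix W
      have "pencil_form d A n X W (\<lambda>q p. v $ (p * n + q)) = flatten d n W \<bullet> (pencil d A n X *\<^sub>v v)"
        by (subst pencil_bilinear[OF assms(1,2) _ assms(3)]) (auto intro!: pencil_form_cong)
      then show "pencil_form d A n X W (\<lambda>q p. v $ (p * n + q)) = 0" using h by simp
    qed
  qed
  finally show ?thesis .
qed

lemma Lam_form_row:
  assumes "\<beta> \<in> tuples n 1"
  shows "Lam_form d A 1 n (\<lambda>i. transpose_mat (\<beta> i)) U V = row_form d A n \<beta> (U 0) V"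
proof -
  have "dim_row (\<beta> i) = n" "dim_col (\<beta> i) = 1" for i
    using assms unfolding tuples_def carrier_mat_def by auto
  then show ?thesis by (simp add: Lam_form_def row_form_def)
qed

lemma mat_kernel_Lam_row_iff:
  assumes "A \<in> tuples d d" and "\<beta> \<in> tuples n 1" and "v \<in> carrier_vec (d * n)"
  shows "v \<in> mat_kernel (Lam d A 1 n (\<lambda>i. transpose_mat (\<beta> i)))
    \<longleftrightarrow> (\<forall>w. row_form d A n \<beta> w (\<lambda>q p. v $ (p * n + q)) = 0)"
proof -
  let ?L = "Lam d A 1 n (\<lambda>i. transpose_mat (\<beta> i))"
  have bt: "(\<lambda>i. transpose_mat (\<beta> i)) \<in> tuples 1 n" using assms(2) by (auto simp: tuples_def)
  have form: "u \<bullet> (?L *\<^sub>v v) = row_form d A n \<beta> (\<lambda>p. u $ p) (\<lambda>q p. v $ (p * n + q))"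
    if "u \<in> carrier_vec d" for u
    using Lam_bilinear[OF assms(1) bt _ assms(3), of u] that
    by (simp add: Lam_form_row[OF assms(2)] del: One_nat_def)
  have "v \<in> mat_kernel ?L \<longleftrightarrow> ?L *\<^sub>v v = 0\<^sub>v d"
    using assms(3) by (simp add: mat_kernel_def)
  also have "\<dots> \<longleftrightarrow> (\<forall>u\<in>carrier_vec d. u \<bullet> (?L *\<^sub>v v) = 0)"
    by (rule zero_vec_iff_orthogonal) (auto intro!: mult_mat_vec_carrier[of _ _ "d * n"] carrier_matI assms(3))
  also have "\<dots> \<longleftrightarrow> (\<forall>w. row_form d A n \<beta> w (\<lambda>q p. v $ (p * n + q)) = 0)"
  proof
    assume "\<forall>w. row_form d A n \<beta> w (\<lambda>q p. v $ (p * n + q)) = 0"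
    then show "\<forall>u\<in>carrier_vec d. u \<bullet> (?L *\<^sub>v v) = 0" using form by simp
  next
    assume h: "\<forall>u\<in>carrier_vec d. u \<bullet> (?L *\<^sub>v v) = 0"
    show "\<forall>w. row_form d A n \<beta> w (\<lambda>q p. v $ (p * n + q)) = 0"
    proof
      fix w
      have "row_form d A n \<beta> w (\<lambda>q p. v $ (p * n + q)) = row_form d A n \<beta> (\<lambda>p. Matrix.vec d w $ p) (\<lambda>q p. v $ (p * n + q))"
        unfolding row_form_def by (intro sum.cong refl arg_cong[where f="(*) _"] aform_cong) auto
      also have "\<dots> = 0" using h form[of "Matrix.vec d w"] by simp
      finally show "row_form d A n \<beta> w (\<lambda>q p. v $ (p * n + q)) = 0" .
    qed
  qed
  finally show ?thesis .
qed

lemma row_form_cong: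
  assumes "\<And>p. p < d \<Longrightarrow> w p = w' p" "\<And>p q. p < d \<Longrightarrow> q < n \<Longrightarrow> V q p = V' q p"
    "\<And>i q. q < n \<Longrightarrow> \<beta> i $$ (q, 0) = \<beta>' i $$ (q, 0)"
  shows "row_form d A n \<beta> w V = row_form d A n \<beta>' w' V'"
  unfolding row_form_def by (intro sum.cong refl arg_cong2[where f="(*)"] aform_cong) (use assms in auto)

lemma dilation_subspace_iff:
  assumes "A \<in> tuples d d" and "X \<in> tuples n n"
  shows "\<beta> \<in> dilation_subspace d A n X \<longleftrightarrow> \<beta> \<in> tuples n 1 \<and>
    (\<forall>V. in_pencil_kernel d A n X V \<longrightarrow> (\<forall>w. row_form d A n \<beta> w V = 0))"
proof (cases "\<beta> \<in> tuples n 1")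
  case True
  have "(mat_kernel (pencil d A n X) \<subseteq> mat_kernel (Lam d A 1 n (\<lambda>i. transpose_mat (\<beta> i))))
    \<longleftrightarrow> (\<forall>V. in_pencil_kernel d A n X V \<longrightarrow> (\<forall>w. row_form d A n \<beta> w V = 0))"
  proof (intro iffI allI impI subsetI)
    fix V w
    assume sub: "mat_kernel (pencil d A n X) \<subseteq> mat_kernel (Lam d A 1 n (\<lambda>i. transpose_mat (\<beta> i)))"
      and V: "in_pencil_kernel d A n X V"
    have "in_pencil_kernel d A n X (\<lambda>q p. flatten d n V $ (p * n + q))"
      unfolding in_pencil_kernel_def
    proof
      fix W
      have "pencil_form d A n X W (\<lambda>q p. flatten d n V $ (p * n + q)) = pencil_form d A n X W V"
        by (rule pencil_form_cong) auto
      then show "pencil_form d A n X W (\<lambda>q p. flatten d n V $ (p * n + q)) = 0"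
        using V by (simp add: in_pencil_kernel_def)
    qed
    then have "flatten d n V \<in> mat_kernel (Lam d A 1 n (\<lambda>i. transpose_mat (\<beta> i)))"
      using sub mat_kernel_pencil_iff[OF assms] flatten_carrier by blast
    then have "row_form d A n \<beta> w (\<lambda>q p. flatten d n V $ (p * n + q)) = 0"
      using mat_kernel_Lam_row_iff[OF assms(1) True] flatten_carrier by blast
    moreover have "row_form d A n \<beta> w (\<lambda>q p. flatten d n V $ (p * n + q)) = row_form d A n \<beta> w V"
      by (rule row_form_cong) auto
    ultimately show "row_form d A n \<beta> w V = 0" by simp
  next
    fix v
    assume h: "\<forall>V. in_pencil_kernel d A n X V \<longrightarrow> (\<forall>w. row_form d A n \<beta> w V = 0)"
      and v: "v \<in> mat_kernel (pencil d A n X)"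
    then have "v \<in> carrier_vec (d * n)" by (simp add: mat_kernel_def)
    then show "v \<in> mat_kernel (Lam d A 1 n (\<lambda>i. transpose_mat (\<beta> i)))"
      using h v mat_kernel_pencil_iff[OF assms] mat_kernel_Lam_row_iff[OF assms(1) True] by blast
  qed
  with True show ?thesis by (simp add: dilation_subspace_def)
next
  case False
  then show ?thesis by (simp add: dilation_subspace_def)
qed

lemma aform_sum_left: "aform d M (\<lambda>p. \<Sum>k\<in>K. c k * x k p) y = (\<Sum>k\<in>K. c k * aform d M (x k) y)"
proof -
  have "aform d M (\<lambda>p. \<Sum>k\<in>K. c k * x k p) y
      = (\<Sum>p<d. \<Sum>k\<in>K. \<Sum>p'<d. c k * (M $$ (p, p') * x k p * y p'))"
    unfolding aform_def by (rule sum.cong[OF refl], subst sum.swap)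
      (simp add: sum_distrib_left sum_distrib_right mult_ac)
  then show ?thesis unfolding aform_def sum_distrib_left by (subst (asm) sum.swap)
qed

lemma aform_transpose: "aform d M x y = aform d (mat d d (\<lambda>(p, q). M $$ (q, p))) y x"
  unfolding aform_def by (subst sum.swap) (auto intro!: sum.cong simp: mult_ac)

lemma aform_sum_right: "aform d M x (\<lambda>p. \<Sum>k\<in>K. c k * y k p) = (\<Sum>k\<in>K. c k * aform d M x (y k))"
  by (subst (1 2) aform_transpose) (rule aform_sum_left)

lemma dot_commute: "dot d x y = dot d y x"
  by (simp add: dot_def mult.commute)

lemma dot_sum_left: "dot d (\<lambda>p. \<Sum>k\<in>K. c k * x k p) y = (\<Sum>k\<in>K. c k * dot d (x k) y)"
  unfolding dot_def by (simp add: sum_distrib_left sum_distrib_right) (subst sum.swap, simp add: mult_ac)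

lemma dot_sum_right: "dot d x (\<lambda>p. \<Sum>k\<in>K. c k * y k p) = (\<Sum>k\<in>K. c k * dot d x (y k))"
  by (subst (1 2) dot_commute) (rule dot_sum_left)

lemma aform_zero_left [simp]: "aform d M (\<lambda>p. 0) y = 0"
  and aform_zero_right [simp]: "aform d M x (\<lambda>p. 0) = 0"
  and dot_zero_left [simp]: "dot d (\<lambda>p. 0) x = 0"
  and dot_zero_right [simp]: "dot d x (\<lambda>p. 0) = 0"
  by (simp_all add: aform_def dot_def)

lemma aform_scale_left: "aform d M (\<lambda>p. c * x p) y = c * aform d M x y"
  using aform_sum_left[of d M "\<lambda>_. c" "\<lambda>_. x" "{0::nat}"] by simp

lemma aform_scale_right: "aform d M x (\<lambda>p. c * y p) = c * aform d M x y"
  using aform_sum_right[of d M x "\<lambda>_. c" "\<lambda>_. y" "{0::nat}"] by simp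

lemma dot_scale_left: "dot d (\<lambda>p. c * x p) y = c * dot d x y"
  by (simp add: dot_def sum_distrib_left mult_ac)

lemma dot_scale_right: "dot d x (\<lambda>p. c * y p) = c * dot d x y"
  by (simp add: dot_def sum_distrib_left mult_ac)

text \<open>
  The vector \<open>\<Lambda>\<^sub>A(\<beta>\<^sup>T) V\<close>; each coordinate is written as one sum over index pairs, the form of functional
  to which \<open>functionals_dominated_by_psd\<close> applies.
\<close>
definition row_image :: "nat \<Rightarrow> 'g::finite mat_tuple \<Rightarrow> nat \<Rightarrow> 'g mat_tuple \<Rightarrow>
    (nat \<Rightarrow> nat \<Rightarrow> real) \<Rightarrow> nat \<Rightarrow> real" where
  "row_image d A n \<beta> V p = (\<Sum>(p', q)\<in>{..<d} \<times> {..<n}. (\<Sum>i\<in>UNIV. A i $$ (p, p') * \<beta> i $$ (q, 0)) * V q p')"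

lemma row_form_dot: "row_form d A n \<beta> w V = dot d w (row_image d A n \<beta> V)"
proof -
  have "dot d w (row_image d A n \<beta> V) = (\<Sum>p<d. \<Sum>p'<d. \<Sum>q<n. \<Sum>i\<in>UNIV. \<beta> i $$ (q, 0) * (A i $$ (p, p') * w p * V q p'))"
    unfolding dot_def row_image_def
    by (simp add: sum.cartesian_product[symmetric] sum_distrib_left sum_distrib_right mult_ac)
  also have "\<dots> = (\<Sum>p<d. \<Sum>p'<d. \<Sum>i\<in>UNIV. \<Sum>q<n. \<beta> i $$ (q, 0) * (A i $$ (p, p') * w p * V q p'))"
    by (rule sum.cong[OF refl], rule sum.cong[OF refl], rule sum.swap)
  also have "\<dots> = (\<Sum>p<d. \<Sum>i\<in>UNIV. \<Sum>p'<d. \<Sum>q<n. \<beta> i $$ (q, 0) * (A i $$ (p, p') * w p * V q p'))"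
    by (rule sum.cong[OF refl], rule sum.swap)
  also have "\<dots> = (\<Sum>i\<in>UNIV. \<Sum>p<d. \<Sum>p'<d. \<Sum>q<n. \<beta> i $$ (q, 0) * (A i $$ (p, p') * w p * V q p'))"
    by (rule sum.swap)
  also have "\<dots> = (\<Sum>i\<in>UNIV. \<Sum>p<d. \<Sum>q<n. \<Sum>p'<d. \<beta> i $$ (q, 0) * (A i $$ (p, p') * w p * V q p'))"
    by (rule sum.cong[OF refl], rule sum.cong[OF refl], rule sum.swap)
  also have "\<dots> = (\<Sum>i\<in>UNIV. \<Sum>q<n. \<Sum>p<d. \<Sum>p'<d. \<beta> i $$ (q, 0) * (A i $$ (p, p') * w p * V q p'))"
    by (rule sum.cong[OF refl], rule sum.swap)
  finally show ?thesis unfolding row_form_def aform_def sum_distrib_left by simp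
qed

definition pencil_coeff :: "'g::finite mat_tuple \<Rightarrow> 'g mat_tuple \<Rightarrow> nat \<times> nat \<Rightarrow> nat \<times> nat \<Rightarrow> real" where
  "pencil_coeff A X a b = (if a = b then 1 else 0)
    - (\<Sum>i\<in>UNIV. X i $$ (snd a, snd b) * A i $$ (fst a, fst b))"

lemma sum_pairs: "(\<Sum>a\<in>P \<times> Q. f a) = (\<Sum>p\<in>P. \<Sum>q\<in>Q. f (p, q))"
  by (simp add: sum.cartesian_product)

lemma bilform_pencil_coeff:
  "bilform ({..<d} \<times> {..<n}) (pencil_coeff A X) u v = pencil_form d A n X (\<lambda>q p. u (p, q)) (\<lambda>q p. v (p, q))"
proof -
  let ?I = "{..<d} \<times> {..<n}"
  have "bilform ?I (pencil_coeff A X) u v = (\<Sum>a\<in>?I. \<Sum>b\<in>?I. (if a = b then 1 else 0) * u a * v b)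
    - (\<Sum>a\<in>?I. \<Sum>b\<in>?I. (\<Sum>i\<in>UNIV. X i $$ (snd a, snd b) * A i $$ (fst a, fst b)) * u a * v b)"
    by (simp add: bilform_def pencil_coeff_def left_diff_distrib sum_subtractf)
  also have "(\<Sum>a\<in>?I. \<Sum>b\<in>?I. (if a = b then 1 else 0) * u a * v b) = (\<Sum>a\<in>?I. u a * v a)"
  proof (rule sum.cong[OF refl])
    fix a assume "a \<in> ?I"
    have "(\<Sum>b\<in>?I. (if a = b then 1 else 0) * u a * v b) = (\<Sum>b\<in>?I. if a = b then u a * v b else 0)"
      by (rule sum.cong) auto
    then show "(\<Sum>b\<in>?I. (if a = b then 1 else 0) * u a * v b) = u a * v a"
      using \<open>a \<in> ?I\<close> by (simp add: sum.delta')
  qed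
  also have "(\<Sum>a\<in>?I. u a * v a) = (\<Sum>q<n. dot d (\<lambda>p. u (p, q)) (\<lambda>p. v (p, q)))"
    unfolding dot_def by (subst sum.swap) (simp add: sum.cartesian_product case_prod_unfold)
  also have "(\<Sum>a\<in>?I. \<Sum>b\<in>?I. (\<Sum>i\<in>UNIV. X i $$ (snd a, snd b) * A i $$ (fst a, fst b)) * u a * v b)
    = (\<Sum>p<d. \<Sum>q<n. \<Sum>p'<d. \<Sum>q'<n. \<Sum>i\<in>UNIV. X i $$ (q, q') * (A i $$ (p, p') * u (p, q) * v (p', q')))"
    by (simp only: sum_pairs) (simp add: sum_distrib_left sum_distrib_right mult_ac)
  also have "\<dots> = Lam_form d A n n X (\<lambda>q p. u (p, q)) (\<lambda>q p. v (p, q))"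
    unfolding Lam_form_def aform_def sum_distrib_left by (rule sum_move_inner_out)
  finally show ?thesis by (simp add: pencil_form_def)
qed

lemma pencil_coeff_sym:
  assumes "A \<in> sym_tuples d" "X \<in> sym_tuples n" "a \<in> {..<d} \<times> {..<n}" "b \<in> {..<d} \<times> {..<n}"
  shows "pencil_coeff A X a b = pencil_coeff A X b a"
  using assms(3,4) tuples_entry_sym[OF assms(1), of "fst a" "fst b"] tuples_entry_sym[OF assms(2), of "snd a" "snd b"]
  by (auto simp: pencil_coeff_def)

lemma psd_form_zero_imp_kernel:
  assumes "A \<in> sym_tuples d" "X \<in> free_spec d A n" "pencil_form d A n X V V = 0"
  shows "in_pencil_kernel d A n X V"
proof -
  have X: "X \<in> sym_tuples n" and pos: "0 \<le> pencil_form d A n X V V" for V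
    using assms(2) free_spec_iff[OF assms(1)] by auto
  show ?thesis
    unfolding in_pencil_kernel_def
  proof
    fix W
    have "bilform ({..<d} \<times> {..<n}) (pencil_coeff A X) (\<lambda>(p, q). W q p) (\<lambda>(p, q). V q p) = 0"
      by (rule psd_zero_imp_kernel, erule (1) pencil_coeff_sym[OF assms(1) X])
        (simp_all add: bilform_pencil_coeff pos assms(3))
    then show "pencil_form d A n X W V = 0" by (simp add: bilform_pencil_coeff)
  qed
qed

text \<open>
  For a dilation direction, the coordinates of \<open>\<Lambda>\<^sub>A(\<beta>\<^sup>T) V\<close> are functionals that vanish on the kernel of
  the positive semidefinite form of \<open>L\<^sub>A(X)\<close>.
\<close>
lemma direction_dominated:
  assumes A: "A \<in> sym_tuples d" and X: "X \<in> free_spec d A n" and b: "\<beta> \<in> dilation_subspace d A n X"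
  shows "\<exists>K>0. \<forall>V. dot d (row_image d A n \<beta> V) (row_image d A n \<beta> V) \<le> K * pencil_form d A n X V V"
proof -
  have Xs: "X \<in> sym_tuples n" and pos: "0 \<le> pencil_form d A n X V V" for V
    using X free_spec_iff[OF A] by auto
  have ker: "row_form d A n \<beta> w V = 0" if "in_pencil_kernel d A n X V" for w V
    using b that dilation_subspace_iff[of A d X n \<beta>] A Xs sym_tuples_subset by blast
  let ?I = "{..<d} \<times> {..<n}"
  let ?f = "\<lambda>p a. \<Sum>i\<in>UNIV. A i $$ (p, fst a) * \<beta> i $$ (snd a, 0)"
  have f: "(\<Sum>a\<in>?I. ?f p a * v a) = row_image d A n \<beta> (\<lambda>q p. v (p, q)) p" for p v
    unfolding row_image_def by (rule sum.cong) auto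
  have "\<exists>K>0. \<forall>v. (\<Sum>p\<in>{..<d}. (\<Sum>a\<in>?I. ?f p a * v a)\<^sup>2) \<le> K * bilform ?I (pencil_coeff A X) v v"
  proof (rule functionals_dominated_by_psd)
    fix p v assume p: "p \<in> {..<d}" and v: "\<And>u. bilform ?I (pencil_coeff A X) u v = 0"
    have "in_pencil_kernel d A n X (\<lambda>q p. v (p, q))"
      unfolding in_pencil_kernel_def
    proof
      fix W show "pencil_form d A n X W (\<lambda>q p. v (p, q)) = 0"
        using v[of "\<lambda>(p, q). W q p"] by (simp add: bilform_pencil_coeff)
    qed
    then have "dot d (\<lambda>p'. if p' = p then 1 else 0) (row_image d A n \<beta> (\<lambda>q p. v (p, q))) = 0"
      using ker by (simp add: row_form_dot)
    moreover have "dot d (\<lambda>p'. if p' = p then 1 else 0) x = x p" for x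
      using p by (simp add: dot_def if_distrib[of "\<lambda>z. z * _"] sum.delta cong: if_cong)
    ultimately show "(\<Sum>a\<in>?I. ?f p a * v a) = 0" by (simp add: f)
  qed (auto simp: bilform_pencil_coeff pos intro: pencil_coeff_sym[OF A Xs])
  then obtain K where K: "K > 0" "\<And>v. (\<Sum>p\<in>{..<d}. (\<Sum>a\<in>?I. ?f p a * v a)\<^sup>2) \<le> K * bilform ?I (pencil_coeff A X) v v"
    by blast
  have "dot d (row_image d A n \<beta> V) (row_image d A n \<beta> V) \<le> K * pencil_form d A n X V V" for V
    using K(2)[of "\<lambda>(p, q). V q p"] by (simp add: f bilform_pencil_coeff dot_def power2_eq_square)
  with K(1) show ?thesis by blast
qed

lemma sum_lessThan_add: "(\<Sum>q<n + m. f q) = (\<Sum>q<n. f q) + (\<Sum>q<m. f (n + q) :: real)" for m :: nat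
  by (induction m) (auto simp: add.assoc)

section \<open>Dilations and their entries\<close>

definition column :: "nat \<Rightarrow> nat \<Rightarrow> 'g mat_tuple \<Rightarrow> 'g mat_tuple" where
  "column n c \<beta> = (\<lambda>i. mat n 1 (\<lambda>(q, _). \<beta> i $$ (q, c)))"

lemma block_tuple_entries:
  assumes "X \<in> tuples n n" "\<beta> \<in> tuples n m" "\<gamma> \<in> tuples m m"
  shows "q < n \<Longrightarrow> q' < n \<Longrightarrow> block_tuple X \<beta> \<gamma> i $$ (q, q') = X i $$ (q, q')"
    "q < n \<Longrightarrow> c < m \<Longrightarrow> block_tuple X \<beta> \<gamma> i $$ (q, n + c) = \<beta> i $$ (q, c)"
    "c < m \<Longrightarrow> q < n \<Longrightarrow> block_tuple X \<beta> \<gamma> i $$ (n + c, q) = \<beta> i $$ (q, c)"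
    "c < m \<Longrightarrow> c' < m \<Longrightarrow> block_tuple X \<beta> \<gamma> i $$ (n + c, n + c') = \<gamma> i $$ (c, c')"
proof -
  have d: "X i \<in> carrier_mat n n" "\<beta> i \<in> carrier_mat n m" "\<gamma> i \<in> carrier_mat m m"
    using assms by (auto simp: tuples_def)
  show "q < n \<Longrightarrow> q' < n \<Longrightarrow> block_tuple X \<beta> \<gamma> i $$ (q, q') = X i $$ (q, q')"
    "q < n \<Longrightarrow> c < m \<Longrightarrow> block_tuple X \<beta> \<gamma> i $$ (q, n + c) = \<beta> i $$ (q, c)"
    "c < m \<Longrightarrow> q < n \<Longrightarrow> block_tuple X \<beta> \<gamma> i $$ (n + c, q) = \<beta> i $$ (q, c)"
    "c < m \<Longrightarrow> c' < m \<Longrightarrow> block_tuple X \<beta> \<gamma> i $$ (n + c, n + c') = \<gamma> i $$ (c, c')"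
    using d by (auto simp: block_tuple_def)
qed

lemma pencil_form_block:
  assumes "A \<in> sym_tuples d" "X \<in> tuples n n" "\<beta> \<in> tuples n m" "\<gamma> \<in> tuples m m"
  shows "pencil_form d A (n + m) (block_tuple X \<beta> \<gamma>) U V
    = pencil_form d A n X U V - (\<Sum>c<m. row_form d A n (column n c \<beta>) (V (n + c)) U)
      - (\<Sum>c<m. row_form d A n (column n c \<beta>) (U (n + c)) V)
      + pencil_form d A m \<gamma> (\<lambda>c. U (n + c)) (\<lambda>c. V (n + c))"
proof -
  note e = block_tuple_entries[OF assms(2-4)]
  have "Lam_form d A (n + m) (n + m) (block_tuple X \<beta> \<gamma>) U V = Lam_form d A n n X U V
    + (\<Sum>i\<in>UNIV. \<Sum>q<n. \<Sum>c<m. \<beta> i $$ (q, c) * aform d (A i) (U q) (V (n + c)))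
    + (\<Sum>i\<in>UNIV. \<Sum>c<m. \<Sum>q<n. \<beta> i $$ (q, c) * aform d (A i) (U (n + c)) (V q))
    + Lam_form d A m m \<gamma> (\<lambda>c. U (n + c)) (\<lambda>c. V (n + c))"
    unfolding Lam_form_def by (simp add: sum_lessThan_add e sum.distrib)
  also have "(\<Sum>i\<in>UNIV. \<Sum>q<n. \<Sum>c<m. \<beta> i $$ (q, c) * aform d (A i) (U q) (V (n + c)))
    = (\<Sum>i\<in>UNIV. \<Sum>c<m. \<Sum>q<n. \<beta> i $$ (q, c) * aform d (A i) (V (n + c)) (U q))"
    by (rule sum.cong[OF refl], subst sum.swap) (simp add: aform_commute[OF assms(1), of _ "U _"])
  also have "\<dots> = (\<Sum>c<m. row_form d A n (column n c \<beta>) (V (n + c)) U)"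
    unfolding row_form_def by (subst sum.swap) (simp add: column_def)
  also have "(\<Sum>i\<in>UNIV. \<Sum>c<m. \<Sum>q<n. \<beta> i $$ (q, c) * aform d (A i) (U (n + c)) (V q))
    = (\<Sum>c<m. row_form d A n (column n c \<beta>) (U (n + c)) V)"
    unfolding row_form_def by (subst sum.swap) (simp add: column_def)
  finally show ?thesis by (simp add: pencil_form_def sum_lessThan_add)
qed

lemma border_alt: "border Y \<beta> c \<gamma> = block_tuple Y (\<lambda>i. c \<cdot>\<^sub>m \<beta> i) (\<lambda>i. mat 1 1 (\<lambda>_. vec_nth \<gamma> i))"
  by (simp add: border_def)

lemma border_parts:
  "\<beta> \<in> tuples n 1 \<Longrightarrow> (\<lambda>i. c \<cdot>\<^sub>m \<beta> i) \<in> tuples n 1"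
  "(\<lambda>i. mat 1 1 (\<lambda>_. vec_nth \<gamma> i)) \<in> tuples 1 1"
  by (auto simp: tuples_def)

lemma row_form_scale:
  assumes "\<beta> \<in> tuples n 1"
  shows "row_form d A n (\<lambda>i. c \<cdot>\<^sub>m \<beta> i) w V = c * row_form d A n \<beta> w V"
proof -
  have "dim_row (\<beta> i) = n" "dim_col (\<beta> i) = 1" for i
    using assms unfolding tuples_def carrier_mat_def by auto
  then show ?thesis by (simp add: row_form_def sum_distrib_left mult_ac)
qed

lemma pencil_form_border:
  assumes "A \<in> sym_tuples d" "Y \<in> tuples n n" "\<beta> \<in> tuples n 1"
  shows "pencil_form d A (Suc n) (border Y \<beta> c \<gamma>) U V
    = pencil_form d A n Y U V - c * row_form d A n \<beta> (V n) U - c * row_form d A n \<beta> (U n) V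
      + dot d (U n) (V n) - (\<Sum>i\<in>UNIV. \<gamma> $ i * aform d (A i) (U n) (V n))"
proof -
  have b: "row_form d A n (column n 0 (\<lambda>i. c \<cdot>\<^sub>m \<beta> i)) w W = c * row_form d A n \<beta> w W" for w W
    unfolding row_form_scale[OF assms(3), symmetric] by (rule row_form_cong) (auto simp: column_def)
  show ?thesis
    using pencil_form_block[OF assms(1,2) border_parts(1)[OF assms(3)] border_parts(2), of c \<gamma> U V]
    by (simp add: border_alt b pencil_form_def Lam_form_def)
qed

lemma block_tuple_sym:
  assumes "X \<in> sym_tuples n" "\<beta> \<in> tuples n m" "\<gamma> \<in> sym_tuples m"
  shows "block_tuple X \<beta> \<gamma> \<in> sym_tuples (n + m)"
proof -
  have d: "X i \<in> carrier_mat n n" "\<beta> i \<in> carrier_mat n m" "\<gamma> i \<in> carrier_mat m m"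
    "transpose_mat (X i) = X i" "transpose_mat (\<gamma> i) = \<gamma> i" for i
    using assms by (auto simp: tuples_def sym_tuples_def)
  have "transpose_mat (four_block_mat (X i) (\<beta> i) (transpose_mat (\<beta> i)) (\<gamma> i))
    = four_block_mat (X i) (\<beta> i) (transpose_mat (\<beta> i)) (\<gamma> i)" for i
    by (subst transpose_four_block_mat[OF d(1,2) _ d(3)]) (use d in auto)
  then show ?thesis using d unfolding sym_tuples_def block_tuple_def by auto
qed

lemma border_sym:
  assumes "Y \<in> sym_tuples n" "\<beta> \<in> tuples n 1"
  shows "border Y \<beta> c \<gamma> \<in> sym_tuples (Suc n)"
proof -
  have "(\<lambda>i. mat 1 1 (\<lambda>_. vec_nth \<gamma> i)) \<in> sym_tuples 1"
    unfolding sym_tuples_def by (auto intro!: transpose_eqI[where n=1])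
  from block_tuple_sym[OF assms(1) border_parts(1)[OF assms(2)] this, of c]
  show ?thesis by (simp add: border_alt)
qed

lemma border_spec_iff:
  assumes "A \<in> sym_tuples d" "Y \<in> sym_tuples n" "\<beta> \<in> tuples n 1"
  shows "\<gamma> \<in> border_spec d A n Y \<beta> c \<longleftrightarrow> border Y \<beta> c \<gamma> \<in> free_spec d A (Suc n)"
  using border_sym[OF assms(2,3)] by (simp add: border_spec_def free_spec_def)

text \<open>
  Positivity of \<open>L\<^sub>A\<close> at a one-column dilation, as a family of inequalities that are affine in \<open>(c, \<gamma>)\<close>.
  Convexity, closedness and all feasibility arguments for the corner are read off from it.
\<close>
lemma border_spec_iff_form:
  assumes "A \<in> sym_tuples d" "Y \<in> sym_tuples n" "\<beta> \<in> tuples n 1"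
  shows "\<gamma> \<in> border_spec d A n Y \<beta> c \<longleftrightarrow> (\<forall>V w. 0 \<le> pencil_form d A n Y V V - 2 * c * row_form d A n \<beta> w V
      + dot d w w - (\<Sum>i\<in>UNIV. \<gamma> $ i * aform d (A i) w w))"
proof -
  have Y: "Y \<in> tuples n n" using assms(2) sym_tuples_subset by blast
  have diag: "pencil_form d A (Suc n) (border Y \<beta> c \<gamma>) U U = pencil_form d A n Y U U - 2 * c * row_form d A n \<beta> (U n) U
      + dot d (U n) (U n) - (\<Sum>i\<in>UNIV. \<gamma> $ i * aform d (A i) (U n) (U n))" for U
    by (simp add: pencil_form_border[OF assms(1) Y assms(3)])
  have "\<gamma> \<in> border_spec d A n Y \<beta> c \<longleftrightarrow> (\<forall>U. 0 \<le> pencil_form d A (Suc n) (border Y \<beta> c \<gamma>) U U)"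
    using border_spec_iff[OF assms] free_spec_iff[OF assms(1)] border_sym[OF assms(2,3)] by blast
  also have "\<dots> \<longleftrightarrow> (\<forall>V w. 0 \<le> pencil_form d A n Y V V - 2 * c * row_form d A n \<beta> w V
      + dot d w w - (\<Sum>i\<in>UNIV. \<gamma> $ i * aform d (A i) w w))"
  proof (intro iffI allI)
    fix V w assume h: "\<forall>U. 0 \<le> pencil_form d A (Suc n) (border Y \<beta> c \<gamma>) U U"
    have "pencil_form d A n Y (V(n := w)) (V(n := w)) = pencil_form d A n Y V V" by (rule pencil_form_cong) auto
    moreover have "row_form d A n \<beta> w (V(n := w)) = row_form d A n \<beta> w V" by (rule row_form_cong) auto
    ultimately show "0 \<le> pencil_form d A n Y V V - 2 * c * row_form d A n \<beta> w V
      + dot d w w - (\<Sum>i\<in>UNIV. \<gamma> $ i * aform d (A i) w w)"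
      using h[rule_format, of "V(n := w)"] by (simp add: diag)
  qed (simp add: diag)
  finally show ?thesis .
qed

section \<open>Arveson extreme points have no dilation directions\<close>

text \<open>
  A Schur complement argument: if \<open>\<bar>\<Lambda>\<^sub>A(\<beta>\<^sup>T) V\<bar>\<^sup>2 \<le> K L(V, V)\<close> and \<open>t\<^sup>2 K = 1\<close>, then the form of the
  dilation by \<open>t \<beta>\<close> with corner \<open>0\<close> is at least \<open>\<bar>w - t \<Lambda>\<^sub>A(\<beta>\<^sup>T) V\<bar>\<^sup>2\<close>.
\<close>
lemma direction_extends:
  assumes A: "A \<in> sym_tuples d" and X: "X \<in> free_spec d A n" and b: "\<beta> \<in> dilation_subspace d A n X"
  shows "\<exists>t>0. 0 \<in> border_spec d A n X \<beta> t"
proof -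
  obtain K where K: "K > 0" "\<And>V. dot d (row_image d A n \<beta> V) (row_image d A n \<beta> V) \<le> K * pencil_form d A n X V V"
    using direction_dominated[OF assms] by blast
  have Xs: "X \<in> sym_tuples n" and bt: "\<beta> \<in> tuples n 1"
    using X b by (auto simp: free_spec_def dilation_subspace_def)
  define t where "t = 1 / sqrt K"
  have t: "t > 0" "t\<^sup>2 * K = 1" using K(1) by (simp_all add: t_def power_divide)
  have "0 \<le> pencil_form d A n X V V - 2 * t * row_form d A n \<beta> w V + dot d w w" for V w
  proof -
    let ?z = "row_image d A n \<beta> V"
    have "t\<^sup>2 * dot d ?z ?z \<le> t\<^sup>2 * (K * pencil_form d A n X V V)"
      using K(2) by (intro mult_left_mono) auto
    then have "t\<^sup>2 * dot d ?z ?z \<le> pencil_form d A n X V V"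
      using t(2) by (simp flip: mult.assoc)
    moreover have "0 \<le> dot d (\<lambda>p. w p - t * ?z p) (\<lambda>p. w p - t * ?z p)"
      by (simp add: dot_def sum_nonneg)
    moreover have "dot d (\<lambda>p. w p - t * ?z p) (\<lambda>p. w p - t * ?z p)
        = dot d w w - 2 * t * dot d w ?z + t\<^sup>2 * dot d ?z ?z"
      by (simp add: dot_def algebra_simps sum_subtractf sum.distrib sum_distrib_left power2_eq_square)
    ultimately show ?thesis by (simp add: row_form_dot)
  qed
  then have "0 \<in> border_spec d A n X \<beta> t"
    by (simp add: border_spec_iff_form[OF A Xs bt])
  with t(1) show ?thesis by blast
qed

lemma Lam_form_zero_left: "(\<And>q. q < m \<Longrightarrow> U q = (\<lambda>p. 0)) \<Longrightarrow> Lam_form d A m n X U V = 0"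
  and Lam_form_zero_right: "(\<And>q. q < n \<Longrightarrow> V q = (\<lambda>p. 0)) \<Longrightarrow> Lam_form d A m n X U V = 0"
  by (simp_all add: Lam_form_def)

lemma pencil_form_zero_left: "(\<And>q. q < n \<Longrightarrow> U q = (\<lambda>p. 0)) \<Longrightarrow> pencil_form d A n X U V = 0"
  and pencil_form_zero_right: "(\<And>q. q < n \<Longrightarrow> V q = (\<lambda>p. 0)) \<Longrightarrow> pencil_form d A n X U V = 0"
  by (simp_all add: pencil_form_def Lam_form_zero_left Lam_form_zero_right)

lemma row_form_zero_left [simp]: "row_form d A n \<beta> (\<lambda>p. 0) V = 0"
  by (simp add: row_form_def)

text \<open>
  An element of \<open>ker L\<^sub>A(X)\<close>, padded by zeros, has value zero in the positive semidefinite form of the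
  dilation, hence lies in the kernel of that form. Pairing it with a vector supported on the added
  coordinate \<open>c\<close> gives the claim.
\<close>
lemma dilation_column_in_subspace:
  assumes A: "A \<in> sym_tuples d" and X: "X \<in> free_spec d A n"
    and t: "\<beta> \<in> tuples n m" "\<gamma> \<in> tuples m m"
    and blk: "block_tuple X \<beta> \<gamma> \<in> free_spec d A (n + m)" and c: "c < m"
  shows "column n c \<beta> \<in> dilation_subspace d A n X"
proof -
  have Xt: "X \<in> tuples n n" and At: "A \<in> tuples d d"
    using A X sym_tuples_subset by (auto simp: free_spec_def)
  have "row_form d A n (column n c \<beta>) w V = 0" if V: "in_pencil_kernel d A n X V" for V w
  proof -
    let ?U = "\<lambda>q. if q < n then V q else (\<lambda>p. 0)"
    have "pencil_form d A n X ?U ?U = pencil_form d A n X V V" by (rule pencil_form_cong) auto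
    then have "pencil_form d A (n + m) (block_tuple X \<beta> \<gamma>) ?U ?U = 0"
      using V unfolding in_pencil_kernel_def by (simp add: pencil_form_block[OF A Xt t] pencil_form_zero_left)
    then have ker: "in_pencil_kernel d A (n + m) (block_tuple X \<beta> \<gamma>) ?U"
      by (rule psd_form_zero_imp_kernel[OF A blk])
    let ?W = "\<lambda>q. if q = n + c then w else (\<lambda>p. 0)"
    have "(\<Sum>c'<m. row_form d A n (column n c' \<beta>) (?W (n + c')) ?U)
      = (\<Sum>c'<m. if c' = c then row_form d A n (column n c \<beta>) w ?U else 0)"
      by (rule sum.cong) auto
    also have "\<dots> = row_form d A n (column n c \<beta>) w ?U" using c by (simp add: sum.delta)
    finally have "pencil_form d A (n + m) (block_tuple X \<beta> \<gamma>) ?W ?U = - row_form d A n (column n c \<beta>) w ?U"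
      unfolding pencil_form_block[OF A Xt t] by (simp add: pencil_form_zero_left pencil_form_zero_right)
    moreover have "row_form d A n (column n c \<beta>) w ?U = row_form d A n (column n c \<beta>) w V"
      by (rule row_form_cong) auto
    ultimately show ?thesis using ker by (simp add: in_pencil_kernel_def)
  qed
  moreover have "column n c \<beta> \<in> tuples n 1" by (simp add: column_def tuples_def)
  ultimately show ?thesis by (simp add: dilation_subspace_iff[OF At Xt])
qed

text \<open>
  Arveson extremality without reference to dilations, by \<open>arveson_iff_rigid\<close>. In this form it passes
  to direct summands and constrains matrix convex combinations by computations with kernels only.
\<close>
definition rigid :: "nat \<Rightarrow> 'g::finite mat_tuple \<Rightarrow> nat \<Rightarrow> 'g mat_tuple \<Rightarrow> bool" where
  "rigid d A n X \<longleftrightarrow> (\<forall>\<beta>\<in>dilation_subspace d A n X. \<beta> = (\<lambda>i. 0\<^sub>m n 1))"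

text \<open>
  The columns of a dilation are directions; conversely, a nonzero direction can be scaled to a
  dilation by one column.
\<close>
lemma arveson_iff_rigid:
  assumes A: "A \<in> sym_tuples d" and X: "X \<in> free_spec d A n"
  shows "arveson_extreme d A n X \<longleftrightarrow> rigid d A n X"
  unfolding rigid_def
proof
  assume arv: "arveson_extreme d A n X"
  show "\<forall>\<beta>\<in>dilation_subspace d A n X. \<beta> = (\<lambda>i. 0\<^sub>m n 1)"
  proof
    fix \<beta> assume b: "\<beta> \<in> dilation_subspace d A n X"
    have Xs: "X \<in> sym_tuples n" and bt: "\<beta> \<in> tuples n 1"
      using X b by (auto simp: free_spec_def dilation_subspace_def)
    obtain t where t: "t > 0" "0 \<in> border_spec d A n X \<beta> t"
      using direction_extends[OF A X b] by blast
    then have "border X \<beta> t 0 \<in> free_spec d A (n + 1)"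
      using border_spec_iff[OF A Xs bt] by simp
    then have z: "(\<lambda>i. t \<cdot>\<^sub>m \<beta> i) = (\<lambda>i. 0\<^sub>m n 1)"
      using arv border_parts(1)[OF bt] border_parts(2) unfolding arveson_extreme_def border_alt by blast
    show "\<beta> = (\<lambda>i. 0\<^sub>m n 1)"
    proof
      fix i
      have d: "dim_row (\<beta> i) = n" "dim_col (\<beta> i) = 1"
        using bt unfolding tuples_def carrier_mat_def by auto
      show "\<beta> i = 0\<^sub>m n 1"
      proof (rule eq_matI)
        fix q r assume "q < dim_row (0\<^sub>m n 1 :: real mat)" "r < dim_col (0\<^sub>m n 1 :: real mat)"
        then have qr: "q < n" "r < 1" by simp_all
        have "(t \<cdot>\<^sub>m \<beta> i) $$ (q, r) = 0" using fun_cong[OF z, of i] qr by simp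
        then show "\<beta> i $$ (q, r) = 0\<^sub>m n 1 $$ (q, r)" using t(1) qr d by simp
      qed (use d in simp_all)
    qed
  qed
next
  assume triv: "\<forall>\<beta>\<in>dilation_subspace d A n X. \<beta> = (\<lambda>i. 0\<^sub>m n 1)"
  show "arveson_extreme d A n X"
    unfolding arveson_extreme_def
  proof (intro conjI X allI ballI impI)
    fix m \<beta> \<gamma> assume t: "\<beta> \<in> tuples n m" "\<gamma> \<in> tuples m m"
      and blk: "block_tuple X \<beta> \<gamma> \<in> free_spec d A (n + m)"
    show "\<beta> = (\<lambda>i. 0\<^sub>m n m)"
    proof
      fix i
      have d: "dim_row (\<beta> i) = n" "dim_col (\<beta> i) = m"
        using t unfolding tuples_def carrier_mat_def by auto
      show "\<beta> i = 0\<^sub>m n m"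
      proof (rule eq_matI)
        fix q c assume "q < dim_row (0\<^sub>m n m :: real mat)" "c < dim_col (0\<^sub>m n m :: real mat)"
        then have qc: "q < n" "c < m" by simp_all
        have "column n c \<beta> = (\<lambda>i. 0\<^sub>m n 1)"
          using triv dilation_column_in_subspace[OF A X t blk qc(2)] by blast
        then have "column n c \<beta> i $$ (q, 0) = 0" using qc by simp
        then show "\<beta> i $$ (q, c) = 0\<^sub>m n m $$ (q, c)" using qc by (simp add: column_def)
      qed (use d in simp_all)
    qed
  qed
qed

section \<open>A step of the algorithm lowers the dimension\<close>

text \<open>
  Dimensions of dilation subspaces are compared through independent families, given by coordinates.
  Only at the start of a run is their size compared with an actual dimension.
\<close>
definition indep_family :: "nat \<Rightarrow> nat \<Rightarrow> (nat \<Rightarrow> 'g mat_tuple) \<Rightarrow> bool" where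
  "indep_family n k b \<longleftrightarrow> (\<forall>c. (\<forall>i. \<forall>q<n. (\<Sum>j<k. c j * b j i $$ (q, 0)) = 0) \<longrightarrow> (\<forall>j<k. c j = 0))"

definition combination :: "nat \<Rightarrow> nat \<Rightarrow> (nat \<Rightarrow> real) \<Rightarrow> (nat \<Rightarrow> 'g mat_tuple) \<Rightarrow> 'g mat_tuple" where
  "combination n k c b = (\<lambda>i. mat n 1 (\<lambda>(q, _). \<Sum>j<k. c j * b j i $$ (q, 0)))"

lemma combination_in_subspace:
  assumes At: "A \<in> tuples d d" and Xt: "X \<in> tuples n n"
    and b: "\<And>j. j < k \<Longrightarrow> b j \<in> dilation_subspace d A n X"
  shows "combination n k c b \<in> dilation_subspace d A n X"
proof -
  have "row_form d A n (combination n k c b) w V = (\<Sum>j<k. c j * row_form d A n (b j) w V)" for w V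
  proof -
    have "row_form d A n (combination n k c b) w V = (\<Sum>i\<in>UNIV. \<Sum>q<n. \<Sum>j<k. c j * (b j i $$ (q, 0) * aform d (A i) w (V q)))"
      unfolding row_form_def combination_def by (simp add: sum_distrib_right sum_distrib_left mult_ac)
    also have "\<dots> = (\<Sum>i\<in>UNIV. \<Sum>j<k. \<Sum>q<n. c j * (b j i $$ (q, 0) * aform d (A i) w (V q)))"
      by (rule sum.cong[OF refl], rule sum.swap)
    also have "\<dots> = (\<Sum>j<k. \<Sum>i\<in>UNIV. \<Sum>q<n. c j * (b j i $$ (q, 0) * aform d (A i) w (V q)))"
      by (rule sum.swap)
    finally show ?thesis by (simp add: row_form_def sum_distrib_left)
  qed
  moreover have "combination n k c b \<in> tuples n 1" by (simp add: combination_def tuples_def)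
  ultimately show ?thesis using b by (simp add: dilation_subspace_iff[OF At Xt])
qed

lemma pencil_form_border_diag:
  assumes "A \<in> sym_tuples d" "Y \<in> tuples n n" "\<beta> \<in> tuples n 1"
  shows "pencil_form d A (Suc n) (border Y \<beta> c \<gamma>) (V(n := x)) (V(n := x))
    = pencil_form d A n Y V V - 2 * c * row_form d A n \<beta> x V + dot d x x - (\<Sum>i\<in>UNIV. vec_nth \<gamma> i * aform d (A i) x x)"
proof -
  have "pencil_form d A n Y (V(n := x)) (V(n := x)) = pencil_form d A n Y V V" by (rule pencil_form_cong) auto
  moreover have "row_form d A n \<beta> x (V(n := x)) = row_form d A n \<beta> x V" by (rule row_form_cong) auto
  ultimately show ?thesis by (simp add: pencil_form_border[OF assms])
qed

lemma row_form_Suc: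
  "row_form d A (Suc n) \<sigma> w (V(n := x)) = row_form d A n \<sigma> w V + (\<Sum>i\<in>UNIV. \<sigma> i $$ (n, 0) * aform d (A i) w x)"
proof -
  have "row_form d A n \<sigma> w (V(n := x)) = row_form d A n \<sigma> w V" by (rule row_form_cong) auto
  then show ?thesis by (simp add: row_form_def sum.distrib)
qed

text \<open>
  A direction \<open>\<sigma>\<close> supported on the last coordinate \<open>s\<close> would leave the corner free to move both ways.
  With \<open>N = \<Sum>\<^sub>i s\<^sub>i A\<^sub>i\<close>, a move by \<open>e s\<close> changes the form by \<open>e w\<^sup>T N w\<close>. This is bounded by a
  multiple of \<open>\<bar>N w\<bar>\<^sup>2\<close>, as \<open>N\<close> is symmetric, and then by the form itself, as \<open>\<sigma>\<close> is a direction.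
\<close>
lemma extreme_corner_no_vertical_direction:
  assumes A: "A \<in> sym_tuples d" and Y: "Y \<in> sym_tuples n" and bt: "\<beta> \<in> tuples n 1"
    and ext: "\<gamma> extreme_point_of border_spec d A n Y \<beta> c"
    and s: "\<sigma> \<in> dilation_subspace d A (Suc n) (border Y \<beta> c \<gamma>)"
    and top: "\<And>i q. q < n \<Longrightarrow> \<sigma> i $$ (q, 0) = 0"
  shows "\<sigma> i $$ (n, 0) = 0"
proof -
  have Yt: "Y \<in> tuples n n" using Y sym_tuples_subset by blast
  have g: "\<gamma> \<in> border_spec d A n Y \<beta> c" using ext by (simp add: extreme_point_of_def)
  then have Z: "border Y \<beta> c \<gamma> \<in> free_spec d A (Suc n)" using border_spec_iff[OF A Y bt] by simp
  let ?Q = "pencil_form d A (Suc n) (border Y \<beta> c \<gamma>)"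
  define s where "s i = \<sigma> i $$ (n, 0)" for i
  define N where "N p p' = (\<Sum>i\<in>UNIV. s i * A i $$ (p, p'))" for p p'
  obtain K where K: "K > 0" "\<And>U. dot d (row_image d A (Suc n) \<sigma> U) (row_image d A (Suc n) \<sigma> U) \<le> K * ?Q U U"
    using direction_dominated[OF A Z s] by blast
  have bv: "row_image d A (Suc n) \<sigma> U p = (\<Sum>p'<d. N p p' * U n p')" for U p
    unfolding row_image_def N_def s_def
    by (simp add: sum_pairs top sum_distrib_right mult_ac)
  have symN: "N p p' = N p' p" if "p \<in> {..<d}" "p' \<in> {..<d}" for p p'
    using that tuples_entry_sym[OF A, of p p'] by (simp add: N_def)
  obtain L where L: "L > 0" "\<And>w. \<bar>bilform {..<d} N w w\<bar> \<le> L * (\<Sum>p<d. (\<Sum>p'<d. N p p' * w p')\<^sup>2)"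
    using symmetric_form_dominated_by_square[of "{..<d}" N, OF _ symN] by blast
  have bilN: "bilform {..<d} N w w = (\<Sum>i\<in>UNIV. s i * aform d (A i) w w)" for w
  proof -
    have "bilform {..<d} N w w = (\<Sum>p<d. \<Sum>p'<d. \<Sum>i\<in>UNIV. s i * (A i $$ (p, p') * w p * w p'))"
      unfolding bilform_def N_def by (simp add: sum_distrib_right sum_distrib_left mult_ac)
    also have "\<dots> = (\<Sum>p<d. \<Sum>i\<in>UNIV. \<Sum>p'<d. s i * (A i $$ (p, p') * w p * w p'))"
      by (rule sum.cong[OF refl], rule sum.swap)
    also have "\<dots> = (\<Sum>i\<in>UNIV. \<Sum>p<d. \<Sum>p'<d. s i * (A i $$ (p, p') * w p * w p'))"
      by (rule sum.swap)
    finally show ?thesis by (simp add: aform_def sum_distrib_left)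
  qed
  \<comment> \<open>The largest step for which the two estimates still give a nonnegative form.\<close>
  define e where "e = 1 / (L * K)"
  have e: "e > 0" "e * (L * K) = 1" using K(1) L(1) by (simp_all add: e_def)
  have bound: "e * \<bar>\<Sum>i\<in>UNIV. s i * aform d (A i) (U n) (U n)\<bar> \<le> ?Q U U" for U
  proof -
    have "\<bar>\<Sum>i\<in>UNIV. s i * aform d (A i) (U n) (U n)\<bar> \<le> L * dot d (row_image d A (Suc n) \<sigma> U) (row_image d A (Suc n) \<sigma> U)"
      using L(2)[of "U n"] by (simp add: bilN bv dot_def power2_eq_square)
    also have "\<dots> \<le> L * (K * ?Q U U)" using K(2) L(1) by (intro mult_left_mono) auto
    finally have "e * \<bar>\<Sum>i\<in>UNIV. s i * aform d (A i) (U n) (U n)\<bar> \<le> e * (L * (K * ?Q U U))"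
      using e(1) by (intro mult_left_mono) auto
    then show ?thesis using e(2) by (simp add: mult.assoc[symmetric])
  qed
  define S where "S = (\<chi> i. s i)"
  have mem: "\<gamma> + r *\<^sub>R S \<in> border_spec d A n Y \<beta> c" if r: "\<bar>r\<bar> = e" for r
    unfolding border_spec_iff_form[OF A Y bt]
  proof (intro allI)
    fix V w
    let ?a = "\<Sum>i\<in>UNIV. s i * aform d (A i) w w"
    have "r * ?a \<le> \<bar>r\<bar> * \<bar>?a\<bar>" using abs_ge_self[of "r * ?a"] by (simp only: abs_mult)
    also have "\<dots> \<le> ?Q (V(n := w)) (V(n := w))"
      using bound[of "V(n := w)"] r by simp
    finally show "0 \<le> pencil_form d A n Y V V - 2 * c * row_form d A n \<beta> w V + dot d w w
        - (\<Sum>i\<in>UNIV. vec_nth (\<gamma> + r *\<^sub>R S) i * aform d (A i) w w)"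
      unfolding pencil_form_border_diag[OF A Yt bt]
      by (simp add: S_def algebra_simps sum.distrib sum_distrib_left)
  qed
  have "S = 0"
  proof (rule ccontr)
    assume "S \<noteq> 0"
    have m1: "\<gamma> + e *\<^sub>R S \<in> border_spec d A n Y \<beta> c" using mem[of e] e(1) by simp
    have m2: "\<gamma> + (- e) *\<^sub>R S \<in> border_spec d A n Y \<beta> c" using mem[of "- e"] e(1) by simp
    have mid: "midpoint (\<gamma> + e *\<^sub>R S) (\<gamma> + (- e) *\<^sub>R S) = \<gamma>"
      unfolding midpoint_eq_iff by simp
    have ne: "\<gamma> + e *\<^sub>R S \<noteq> \<gamma> + (- e) *\<^sub>R S"
    proof
      assume "\<gamma> + e *\<^sub>R S = \<gamma> + (- e) *\<^sub>R S"
      then have "\<gamma> + e *\<^sub>R S = \<gamma>" using mid by (metis midpoint_eq_endpoint(1))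
      then show False using e(1) \<open>S \<noteq> 0\<close> by simp
    qed
    have "\<gamma> \<in> open_segment (\<gamma> + e *\<^sub>R S) (\<gamma> + (- e) *\<^sub>R S)"
      using midpoint_in_open_segment[of "\<gamma> + e *\<^sub>R S" "\<gamma> + (- e) *\<^sub>R S"] ne unfolding mid by simp
    with m1 m2 ext show False unfolding extreme_point_of_def by blast
  qed
  then have "vec_nth S i = 0" by simp
  then show ?thesis by (simp add: S_def s_def)
qed

text \<open>
  Suppose that \<open>\<beta>\<close> extends to a direction \<open>\<sigma>\<close> of the bordered tuple, and dilate that tuple by \<open>t \<sigma>\<close>
  with \<open>t > 0\<close>. The two added columns then begin with \<open>c \<beta>\<close> and \<open>t \<beta>\<close>. The rotation of the two added
  coordinates with cosine \<open>c / r\<close> and sine \<open>t / r\<close>, where \<open>r = sqrt (c\<^sup>2 + t\<^sup>2)\<close>, collects them in a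
  single column \<open>r \<beta>\<close>. Compressing to the old coordinates and this one shows that the scaling \<open>r > c\<close>
  is feasible.
\<close>
lemma max_scaling_no_repeated_direction:
  assumes A: "A \<in> sym_tuples d" and Y: "Y \<in> sym_tuples n" and bt: "\<beta> \<in> tuples n 1"
    and g: "\<gamma> \<in> border_spec d A n Y \<beta> c" and mx: "max_scaling d A n Y \<beta> c"
    and s: "\<sigma> \<in> dilation_subspace d A (Suc n) (border Y \<beta> c \<gamma>)"
    and top: "\<And>i q. q < n \<Longrightarrow> \<sigma> i $$ (q, 0) = \<beta> i $$ (q, 0)"
  shows False
proof -
  have Yt: "Y \<in> tuples n n" using Y sym_tuples_subset by blast
  let ?Z = "border Y \<beta> c \<gamma>"
  have Z: "?Z \<in> free_spec d A (Suc n)" using border_spec_iff[OF A Y bt] g by simp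
  have Zs: "?Z \<in> sym_tuples (Suc n)" using Z by (simp add: free_spec_def)
  have st: "\<sigma> \<in> tuples (Suc n) 1" using s by (simp add: dilation_subspace_def)
  obtain t where t: "t > 0" "0 \<in> border_spec d A (Suc n) ?Z \<sigma> t"
    using direction_extends[OF A Z s] by blast
  define r where "r = sqrt (c\<^sup>2 + t\<^sup>2)"
  have r2: "r\<^sup>2 = c\<^sup>2 + t\<^sup>2" unfolding r_def by simp
  have r: "r > 0" unfolding r_def using t(1) by (simp add: add_nonneg_pos)
  have "c < r"
  proof (rule ccontr)
    assume "\<not> c < r"
    then have "r\<^sup>2 \<le> c\<^sup>2" using r by (intro power_mono) auto
    then show False using r2 t(1) by simp
  qed
  define x where "x = c / r"
  define y where "y = t / r"
  have "x\<^sup>2 + y\<^sup>2 = r\<^sup>2 / r\<^sup>2" "c * x + t * y = r\<^sup>2 / r"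
    by (simp_all only: x_def y_def power_divide r2 add_divide_distrib) (simp add: power2_eq_square)
  then have xy: "x\<^sup>2 + y\<^sup>2 = 1" "c * x + t * y = r"
    using r by (simp_all add: power2_eq_square)
  \<comment> \<open>The corner after the rotation; the corner that belongs to \<open>t \<sigma>\<close> was \<open>0\<close>, so no term in \<open>y\<^sup>2\<close> occurs.\<close>
  define \<gamma>' where "\<gamma>' = (\<chi> i. x\<^sup>2 * vec_nth \<gamma> i + 2 * t * y * x * \<sigma> i $$ (n, 0))"
  have "\<gamma>' \<in> border_spec d A n Y \<beta> r"
    unfolding border_spec_iff_form[OF A Y bt]
  proof (intro allI)
    fix V :: "nat \<Rightarrow> nat \<Rightarrow> real" and u :: "nat \<Rightarrow> real"
    let ?U = "V(n := (\<lambda>p. x * u p))"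
    let ?w = "\<lambda>p. y * u p"
    have "row_form d A n \<sigma> w V' = row_form d A n \<beta> w V'" for w V' by (rule row_form_cong) (auto simp: top)
    moreover have bsc: "row_form d A n \<beta> (\<lambda>p. k * u p) V = k * row_form d A n \<beta> u V" for k
      by (simp add: row_form_def aform_scale_left sum_distrib_left mult_ac)
    ultimately have b: "row_form d A (Suc n) \<sigma> ?w ?U = y * row_form d A n \<beta> u V
      + x * y * (\<Sum>i\<in>UNIV. \<sigma> i $$ (n, 0) * aform d (A i) u u)"
      unfolding row_form_Suc by (simp add: aform_scale_left aform_scale_right sum_distrib_left mult_ac)
    have p: "pencil_form d A (Suc n) ?Z ?U ?U = pencil_form d A n Y V V - 2 * c * x * row_form d A n \<beta> u V + x\<^sup>2 * dot d u u
      - x\<^sup>2 * (\<Sum>i\<in>UNIV. vec_nth \<gamma> i * aform d (A i) u u)"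
      unfolding pencil_form_border_diag[OF A Yt bt]
      by (simp add: bsc dot_scale_left dot_scale_right aform_scale_left aform_scale_right
          sum_distrib_left power2_eq_square mult_ac)
    have "0 \<le> pencil_form d A (Suc n) ?Z ?U ?U - 2 * t * row_form d A (Suc n) \<sigma> ?w ?U + dot d ?w ?w"
      using t(2) unfolding border_spec_iff_form[OF A Zs st] by simp
    also have "\<dots> = pencil_form d A n Y V V - 2 * (c * x + t * y) * row_form d A n \<beta> u V + (x\<^sup>2 + y\<^sup>2) * dot d u u
      - (x\<^sup>2 * (\<Sum>i\<in>UNIV. vec_nth \<gamma> i * aform d (A i) u u)
        + 2 * t * y * x * (\<Sum>i\<in>UNIV. \<sigma> i $$ (n, 0) * aform d (A i) u u))"
      unfolding b p by (simp add: dot_scale_left dot_scale_right algebra_simps power2_eq_square)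
    also have "x\<^sup>2 * (\<Sum>i\<in>UNIV. vec_nth \<gamma> i * aform d (A i) u u)
        + 2 * t * y * x * (\<Sum>i\<in>UNIV. \<sigma> i $$ (n, 0) * aform d (A i) u u)
        = (\<Sum>i\<in>UNIV. vec_nth \<gamma>' i * aform d (A i) u u)"
      by (simp add: \<gamma>'_def algebra_simps sum.distrib sum_distrib_left)
    finally show "0 \<le> pencil_form d A n Y V V - 2 * r * row_form d A n \<beta> u V + dot d u u
      - (\<Sum>i\<in>UNIV. vec_nth \<gamma>' i * aform d (A i) u u)" by (simp add: xy)
  qed
  then show False using mx \<open>c < r\<close> unfolding max_scaling_def is_arg_max_def by blast
qed

text \<open>
  Deleting the last entry maps the directions of the bordered tuple to directions of \<open>Y\<close>. The two
  preceding lemmas say that the map is injective and that its image misses \<open>\<beta>\<close>, so \<open>\<beta>\<close> may be added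
  to the image of an independent family.
\<close>
lemma independent_family_grows:
  assumes A: "A \<in> sym_tuples d" and Y: "Y \<in> free_spec d A n" and dir: "direction d A n Y \<beta>"
    and mx: "max_scaling d A n Y \<beta> c" and ext: "\<gamma> extreme_point_of border_spec d A n Y \<beta> c"
    and b: "\<And>j. j < k \<Longrightarrow> b j \<in> dilation_subspace d A (Suc n) (border Y \<beta> c \<gamma>)"
    and ind: "indep_family (Suc n) k b"
  shows "\<exists>b'. (\<forall>j<Suc k. b' j \<in> dilation_subspace d A n Y) \<and> indep_family n (Suc k) b'"
proof -
  let ?Z = "border Y \<beta> c \<gamma>"
  have Ys: "Y \<in> sym_tuples n" using Y by (simp add: free_spec_def)
  have bt: "\<beta> \<in> tuples n 1" and bK: "\<beta> \<in> dilation_subspace d A n Y"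
    using dir by (auto simp: direction_def dilation_subspace_def)
  have At: "A \<in> tuples d d" and Yt: "Y \<in> tuples n n" and Zt: "?Z \<in> tuples (Suc n) (Suc n)"
    using A Ys border_sym[OF Ys bt] sym_tuples_subset by blast+
  have g: "\<gamma> \<in> border_spec d A n Y \<beta> c" using ext by (simp add: extreme_point_of_def)
  define b' where "b' j = (if j < k then (\<lambda>i. mat n 1 (\<lambda>(q, _). b j i $$ (q, 0))) else \<beta>)" for j
  have "b' j \<in> dilation_subspace d A n Y" if "j < Suc k" for j
  proof (cases "j < k")
    case True
    have "row_form d A n (b' j) w V = 0" if V: "in_pencil_kernel d A n Y V" for V w
    proof -
      let ?U = "V(n := (\<lambda>p. 0))"
      have "in_pencil_kernel d A (Suc n) ?Z ?U"
        unfolding in_pencil_kernel_def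
      proof
        fix W
        have "pencil_form d A n Y W ?U = pencil_form d A n Y W V" by (rule pencil_form_cong) auto
        moreover have "row_form d A n \<beta> (W n) ?U = row_form d A n \<beta> (W n) V" by (rule row_form_cong) auto
        moreover have "row_form d A n \<beta> (W n) V = 0"
          using bK V dilation_subspace_iff[OF At Yt] by blast
        ultimately show "pencil_form d A (Suc n) ?Z W ?U = 0"
          using V by (simp add: pencil_form_border[OF A Yt bt] in_pencil_kernel_def)
      qed
      then have "row_form d A (Suc n) (b j) w ?U = 0"
        using b[OF True] dilation_subspace_iff[OF At Zt] by blast
      moreover have "row_form d A n (b' j) w V = row_form d A n (b j) w V"
        using True by (intro row_form_cong) (auto simp: b'_def)
      ultimately show ?thesis by (simp add: row_form_Suc)
    qed
    moreover have "b' j \<in> tuples n 1" using True by (simp add: b'_def tuples_def)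
    ultimately show ?thesis by (simp add: dilation_subspace_iff[OF At Yt])
  next
    case False
    then show ?thesis using bK by (simp add: b'_def)
  qed
  moreover have "indep_family n (Suc k) b'"
    unfolding indep_family_def
  proof (intro allI impI)
    fix e j assume rel: "\<forall>i. \<forall>q<n. (\<Sum>j<Suc k. e j * b' j i $$ (q, 0)) = 0" and j: "j < Suc k"
    have top: "(\<Sum>j<k. e j * b j i $$ (q, 0)) = - e k * \<beta> i $$ (q, 0)" if "q < n" for i q
    proof -
      have "(\<Sum>j<k. e j * b' j i $$ (q, 0)) = (\<Sum>j<k. e j * b j i $$ (q, 0))"
        using that by (intro sum.cong) (auto simp: b'_def)
      then show ?thesis using rel that by (auto simp: b'_def eq_neg_iff_add_eq_0)
    qed
    have "e k = 0"
    proof (rule ccontr)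
      assume ek: "e k \<noteq> 0"
      \<comment> \<open>Dividing by the coefficient of \<open>\<beta>\<close> gives a direction that begins with \<open>\<beta>\<close> itself.\<close>
      let ?s = "combination (Suc n) k (\<lambda>j. - e j / e k) b"
      have sK: "?s \<in> dilation_subspace d A (Suc n) ?Z"
        by (rule combination_in_subspace[OF At Zt b])
      have "?s i $$ (q, 0) = \<beta> i $$ (q, 0)" if q: "q < n" for i q
      proof -
        have "?s i $$ (q, 0) = (\<Sum>j<k. (- 1 / e k) * (e j * b j i $$ (q, 0)))"
          using q by (simp add: combination_def)
        also have "\<dots> = (- 1 / e k) * (- e k * \<beta> i $$ (q, 0))"
          unfolding sum_distrib_left[symmetric] top[OF q] ..
        finally show ?thesis using ek by simp
      qed
      then show False
        using max_scaling_no_repeated_direction[OF A Ys bt g mx sK] by blast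
    qed
    let ?s = "combination (Suc n) k e b"
    have t0: "?s i $$ (q, 0) = 0" if "q < n" for i q
      using top[OF that] that \<open>e k = 0\<close> by (simp add: combination_def)
    have "?s i $$ (n, 0) = 0" for i
      by (rule extreme_corner_no_vertical_direction[OF A Ys bt ext combination_in_subspace[OF At Zt b] t0])
    then have "\<forall>i. \<forall>q<Suc n. (\<Sum>j<k. e j * b j i $$ (q, 0)) = 0"
      using t0 by (auto simp: combination_def less_Suc_eq)
    then have "\<forall>j<k. e j = 0" using ind unfolding indep_family_def by blast
    then show "e j = 0" using j \<open>e k = 0\<close> by (auto simp: less_Suc_eq)
  qed
  ultimately show ?thesis by blast
qed

section \<open>Compactness and termination\<close>

text \<open>
  The last diagonal entry of \<open>C - \<Sum>\<^sub>i X\<^sub>i\<^sup>2\<close>, for \<open>X\<close> the bordered tuple, bounds scaling and corner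
  simultaneously.
\<close>
lemma border_corner_bound:
  assumes bd: "\<And>m X. 1 \<le> m \<Longrightarrow> X \<in> free_spec d A m \<Longrightarrow> psd (C \<cdot>\<^sub>m 1\<^sub>m m - mat_sum m m UNIV (\<lambda>i. X i * X i))"
    and A: "A \<in> sym_tuples d" and Y: "Y \<in> sym_tuples n" and bt: "\<beta> \<in> tuples n 1"
    and g: "\<gamma> \<in> border_spec d A n Y \<beta> c"
  shows "c\<^sup>2 * (\<Sum>i\<in>UNIV. \<Sum>q<n. (\<beta> i $$ (q, 0))\<^sup>2) + (norm \<gamma>)\<^sup>2 \<le> C"
proof -
  let ?Z = "border Y \<beta> c \<gamma>"
  let ?M = "C \<cdot>\<^sub>m 1\<^sub>m (Suc n) - mat_sum (Suc n) (Suc n) UNIV (\<lambda>i. ?Z i * ?Z i)"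
  have Yt: "Y \<in> tuples n n" using Y sym_tuples_subset by blast
  have Z: "?Z \<in> free_spec d A (Suc n)" using border_spec_iff[OF A Y bt] g by simp
  then have Zs: "?Z \<in> sym_tuples (Suc n)" by (simp add: free_spec_def)
  have Zd: "dim_row (?Z i) = Suc n" "dim_col (?Z i) = Suc n" for i
    using Zs unfolding sym_tuples_def carrier_mat_def by auto
  have M: "?M \<in> carrier_mat (Suc n) (Suc n)" by (simp add: mat_sum_def carrier_matI)
  have "psd ?M" using bd[OF _ Z] by simp
  then have "0 \<le> unit_vec (Suc n) n \<bullet> (?M *\<^sub>v unit_vec (Suc n) n)"
    using carrier_matD(1)[OF M] unfolding psd_def by (metis unit_vec_carrier)
  also have "\<dots> = ?M $$ (n, n)"
    using M by (subst scalar_prod_left_unit) (auto simp: mat_sum_def)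
  also have "\<dots> = C - (\<Sum>i\<in>UNIV. \<Sum>q<Suc n. (?Z i $$ (n, q))\<^sup>2)"
  proof -
    have "(?Z i * ?Z i) $$ (n, n) = (\<Sum>q<Suc n. (?Z i $$ (n, q))\<^sup>2)" for i
      using Zd tuples_entry_sym[OF Zs, of _ n]
      by (simp add: scalar_prod_def lessThan_atLeast0 power2_eq_square del: sum.lessThan_Suc sum.op_ivl_Suc)
    then show ?thesis by (simp add: mat_sum_def)
  qed
  also have "(\<Sum>i\<in>UNIV. \<Sum>q<Suc n. (?Z i $$ (n, q))\<^sup>2)
    = (\<Sum>i\<in>UNIV. \<Sum>q<n. (c * \<beta> i $$ (q, 0))\<^sup>2) + (\<Sum>i\<in>UNIV. (vec_nth \<gamma> i)\<^sup>2)"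
  proof -
    have bd: "dim_row (\<beta> i) = n" "dim_col (\<beta> i) = 1" for i
      using bt unfolding tuples_def carrier_mat_def by auto
    have "?Z i $$ (n, q) = c * \<beta> i $$ (q, 0)" if "q < n" for i q
      using block_tuple_entries(3)[OF Yt border_parts(1)[OF bt] border_parts(2), of 0 q c \<gamma> i] that bd
      by (simp add: border_alt)
    moreover have "?Z i $$ (n, n) = vec_nth \<gamma> i" for i
      using block_tuple_entries(4)[OF Yt border_parts(1)[OF bt] border_parts(2), of 0 0 c \<gamma> i]
      by (simp add: border_alt)
    ultimately show ?thesis by (simp add: sum.distrib)
  qed
  also have "(\<Sum>i\<in>UNIV. (vec_nth \<gamma> i)\<^sup>2) = (norm \<gamma>)\<^sup>2"
    by (simp add: norm_vec_def L2_set_def sum_nonneg)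
  finally show ?thesis by (simp add: power_mult_distrib sum_distrib_left)
qed

lemma direction_norm_pos:
  assumes "\<beta> \<in> tuples n 1" "\<beta> \<noteq> (\<lambda>i. 0\<^sub>m n 1)"
  shows "0 < (\<Sum>i\<in>UNIV. \<Sum>q<n. (\<beta> (i::'g::finite) $$ (q, 0))\<^sup>2)"
proof -
  obtain i where "\<beta> i \<noteq> 0\<^sub>m n 1" using assms(2) by blast
  moreover have "dim_row (\<beta> i) = n" "dim_col (\<beta> i) = 1"
    using assms(1) unfolding tuples_def carrier_mat_def by auto
  ultimately obtain q where q: "q < n" "\<beta> i $$ (q, 0) \<noteq> 0" by (auto simp: mat_eq_iff)
  have "0 < (\<Sum>q<n. (\<beta> i $$ (q, 0))\<^sup>2)" using q by (intro sum_pos2[of _ q]) auto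
  then show ?thesis by (intro sum_pos2[of UNIV i]) (auto intro: sum_nonneg)
qed

text \<open>
  Closedness jointly in scaling and corner: the maximal scaling is found by maximizing the first
  component over the compact set of all feasible pairs.
\<close>
lemma closed_border_pairs:
  assumes A: "A \<in> sym_tuples d" and Y: "Y \<in> sym_tuples n" and bt: "\<beta> \<in> tuples n 1"
  shows "closed {z. snd z \<in> border_spec d A n Y \<beta> (fst z)}"
proof -
  have "{z. snd z \<in> border_spec d A n Y \<beta> (fst z)} = (\<Inter>V. \<Inter>w. {z. 0 \<le> pencil_form d A n Y V V - 2 * fst z * row_form d A n \<beta> w V
      + dot d w w - (\<Sum>i\<in>UNIV. vec_nth (snd z) i * aform d (A i) w w)})"
    unfolding border_spec_iff_form[OF A Y bt] by blast
  also have "closed \<dots>"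
    by (intro closed_INT ballI closed_Collect_le continuous_intros)
  finally show ?thesis .
qed

lemma convex_border_spec:
  assumes A: "A \<in> sym_tuples d" and Y: "Y \<in> sym_tuples n" and bt: "\<beta> \<in> tuples n 1"
  shows "convex (border_spec d A n Y \<beta> c)"
proof (rule convexI)
  fix x y u v assume h: "x \<in> border_spec d A n Y \<beta> c" "y \<in> border_spec d A n Y \<beta> c" "0 \<le> u" "0 \<le> v" "u + v = (1::real)"
  show "u *\<^sub>R x + v *\<^sub>R y \<in> border_spec d A n Y \<beta> c"
    unfolding border_spec_iff_form[OF A Y bt]
  proof (intro allI)
    fix V w
    let ?B = "pencil_form d A n Y V V - 2 * c * row_form d A n \<beta> w V + dot d w w"
    let ?a = "\<lambda>x. \<Sum>i\<in>UNIV. vec_nth x i * aform d (A i) w w"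
    have "0 \<le> u * (?B - ?a x) + v * (?B - ?a y)"
      using h unfolding border_spec_iff_form[OF A Y bt] by (intro add_nonneg_nonneg mult_nonneg_nonneg) auto
    also have "\<dots> = (u + v) * ?B - (u * ?a x + v * ?a y)" by (simp add: algebra_simps)
    also have "u * ?a x + v * ?a y = ?a (u *\<^sub>R x + v *\<^sub>R y)"
      by (simp add: algebra_simps sum.distrib sum_distrib_left)
    finally show "0 \<le> ?B - ?a (u *\<^sub>R x + v *\<^sub>R y)" using h(5) by simp
  qed
qed

lemma compact_border_spec:
  assumes bdd: "bounded_free_spec d A"
    and A: "A \<in> sym_tuples d" and Y: "Y \<in> sym_tuples n" and bt: "\<beta> \<in> tuples n 1"
  shows "compact (border_spec d A n Y \<beta> c)"
proof -
  obtain C where C: "\<And>m X. 1 \<le> m \<Longrightarrow> X \<in> free_spec d A m \<Longrightarrow> psd (C \<cdot>\<^sub>m 1\<^sub>m m - mat_sum m m UNIV (\<lambda>i. X i * X i))"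
    using bdd unfolding bounded_free_spec_def by blast
  have "bounded (border_spec d A n Y \<beta> c)"
    unfolding bounded_iff
  proof (intro exI[of _ "sqrt C"] ballI)
    fix \<gamma> assume "\<gamma> \<in> border_spec d A n Y \<beta> c"
    from border_corner_bound[OF C A Y bt this]
    have "c\<^sup>2 * (\<Sum>i\<in>UNIV. \<Sum>q<n. (\<beta> i $$ (q, 0))\<^sup>2) + (norm \<gamma>)\<^sup>2 \<le> C" .
    moreover have "0 \<le> c\<^sup>2 * (\<Sum>i\<in>UNIV. \<Sum>q<n. (\<beta> i $$ (q, 0))\<^sup>2)"
      by (intro mult_nonneg_nonneg sum_nonneg) auto
    ultimately show "norm \<gamma> \<le> sqrt C" by (intro real_le_rsqrt) simp
  qed
  moreover have "closed (border_spec d A n Y \<beta> c)"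
  proof -
    have "closed ((\<lambda>\<gamma>. (c, \<gamma>)) -` {z. snd z \<in> border_spec d A n Y \<beta> (fst z)})"
      by (intro continuous_closed_vimage closed_border_pairs[OF A Y bt] continuous_intros)
    then show ?thesis by (simp add: vimage_def)
  qed
  ultimately show ?thesis by (simp add: compact_eq_bounded_closed)
qed

lemma max_scaling_exists:
  assumes bdd: "bounded_free_spec d A"
    and A: "A \<in> sym_tuples d" and Y: "Y \<in> free_spec d A n" and dir: "direction d A n Y \<beta>"
  shows "\<exists>c. max_scaling d A n Y \<beta> c"
proof -
  have Ys: "Y \<in> sym_tuples n" using Y by (simp add: free_spec_def)
  have bt: "\<beta> \<in> tuples n 1" and bnz: "\<beta> \<noteq> (\<lambda>i. 0\<^sub>m n 1)"
    using dir by (auto simp: direction_def dilation_subspace_def)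
  obtain C where C: "\<And>m X. 1 \<le> m \<Longrightarrow> X \<in> free_spec d A m \<Longrightarrow> psd (C \<cdot>\<^sub>m 1\<^sub>m m - mat_sum m m UNIV (\<lambda>i. X i * X i))"
    using bdd unfolding bounded_free_spec_def by blast
  let ?Z = "{z. snd z \<in> border_spec d A n Y \<beta> (fst z)}"
  define B where "B = (\<Sum>i\<in>UNIV. \<Sum>q<n. (\<beta> i $$ (q, 0))\<^sup>2)"
  have B: "B > 0" unfolding B_def by (rule direction_norm_pos[OF bt bnz])
  have "bounded ?Z"
    unfolding bounded_iff
  proof (intro exI[of _ "sqrt (C / B) + sqrt C"] ballI)
    fix z assume "z \<in> ?Z"
    then have z: "(fst z)\<^sup>2 * B + (norm (snd z))\<^sup>2 \<le> C"
      using border_corner_bound[OF C A Ys bt] by (simp add: B_def)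
    have "(norm (snd z))\<^sup>2 \<le> C" using z B by (smt (verit) mult_nonneg_nonneg zero_le_power2)
    then have 1: "norm (snd z) \<le> sqrt C" by (intro real_le_rsqrt)
    have "(fst z)\<^sup>2 * B \<le> C" using z by (smt (verit) zero_le_power2)
    then have "\<bar>fst z\<bar>\<^sup>2 \<le> C / B" using B by (simp add: pos_le_divide_eq)
    then have 2: "norm (fst z) \<le> sqrt (C / B)" unfolding real_norm_def by (intro real_le_rsqrt)
    show "norm z \<le> sqrt (C / B) + sqrt C"
      using norm_Pair_le[of "fst z" "snd z"] 1 2 by simp
  qed
  then have "compact ?Z" using closed_border_pairs[OF A Ys bt] by (simp add: compact_eq_bounded_closed)
  moreover have "(0, 0) \<in> ?Z"
  proof -
    have "0 \<le> dot d w w" for w by (simp add: dot_def sum_nonneg)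
    then show ?thesis using Y by (simp add: border_spec_iff_form[OF A Ys bt] free_spec_iff[OF A])
  qed
  ultimately obtain z where z: "z \<in> ?Z" "\<And>y. y \<in> ?Z \<Longrightarrow> fst y \<le> fst z"
    using continuous_attains_sup[of ?Z fst] continuous_on_fst[OF continuous_on_id] by blast
  have "max_scaling d A n Y \<beta> (fst z)"
    unfolding max_scaling_def is_arg_max_def
  proof (intro conjI notI)
    show "\<exists>\<gamma>. \<gamma> \<in> border_spec d A n Y \<beta> (fst z)" using z(1) by blast
    assume "\<exists>y. (\<exists>\<gamma>. \<gamma> \<in> border_spec d A n Y \<beta> y) \<and> fst z < y"
    then obtain y \<gamma> where "\<gamma> \<in> border_spec d A n Y \<beta> y" "fst z < y" by blast
    then show False using z(2)[of "(y, \<gamma>)"] by simp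
  qed
  then show ?thesis by blast
qed

lemma is_dilation_iff:
  assumes X: "X \<in> tuples n n"
  shows "is_dilation n X k Y \<longleftrightarrow>
    Y \<in> sym_tuples (n + k) \<and> (\<forall>i. \<forall>q<n. \<forall>q'<n. Y i $$ (q, q') = X i $$ (q, q'))"
proof
  assume "is_dilation n X k Y"
  then obtain \<beta> \<gamma> where Y: "Y \<in> sym_tuples (n + k)" "\<beta> \<in> tuples n k" "\<gamma> \<in> tuples k k" "Y = block_tuple X \<beta> \<gamma>"
    unfolding is_dilation_def by blast
  then show "Y \<in> sym_tuples (n + k) \<and> (\<forall>i. \<forall>q<n. \<forall>q'<n. Y i $$ (q, q') = X i $$ (q, q'))"
    using block_tuple_entries(1)[OF X Y(2,3)] by simp
next
  assume h: "Y \<in> sym_tuples (n + k) \<and> (\<forall>i. \<forall>q<n. \<forall>q'<n. Y i $$ (q, q') = X i $$ (q, q'))"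
  let ?b = "\<lambda>i. mat n k (\<lambda>(q, c). Y i $$ (q, n + c))"
  let ?g = "\<lambda>i. mat k k (\<lambda>(c, c'). Y i $$ (n + c, n + c'))"
  have "Y = block_tuple X ?b ?g"
  proof
    fix i
    have d: "dim_row (Y i) = n + k" "dim_col (Y i) = n + k" "dim_row (X i) = n" "dim_col (X i) = n"
      using h X unfolding sym_tuples_def tuples_def carrier_mat_def by auto
    show "Y i = block_tuple X ?b ?g i"
    proof (rule eq_matI)
      fix q q' assume "q < dim_row (block_tuple X ?b ?g i)" "q' < dim_col (block_tuple X ?b ?g i)"
      then have "q < n + k" "q' < n + k" by (auto simp: block_tuple_def d)
      then show "Y i $$ (q, q') = block_tuple X ?b ?g i $$ (q, q')"
        using h tuples_entry_sym[of Y "n + k" q q' i] by (auto simp: block_tuple_def d)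
    qed (auto simp: block_tuple_def d)
  qed
  then show "is_dilation n X k Y"
    unfolding is_dilation_def using h
    by (intro conjI bexI[of _ ?b] bexI[of _ ?g]) (auto simp: tuples_def)
qed

lemma is_dilation_border:
  assumes X: "X \<in> tuples n n" and dil: "is_dilation n X k Y" and bt: "\<beta> \<in> tuples (n + k) 1"
  shows "is_dilation n X (Suc k) (border Y \<beta> c \<gamma>)"
proof -
  have Ys: "Y \<in> sym_tuples (n + k)" using dil by (simp add: is_dilation_def)
  then have Yt: "Y \<in> tuples (n + k) (n + k)" using sym_tuples_subset by blast
  have "border Y \<beta> c \<gamma> i $$ (q, q') = Y i $$ (q, q')" if "q < n" "q' < n" for i q q'
    unfolding border_alt using that
    by (intro block_tuple_entries(1)[OF Yt border_parts(1)[OF bt] border_parts(2)]) auto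
  then show ?thesis
    using dil border_sym[OF Ys bt] by (simp add: is_dilation_iff[OF X])
qed

text \<open>
  The number \<open>b\<close> of remaining steps bounds the independent families of directions of the current
  tuple; this invariant is kept by \<open>independent_family_grows\<close>. The assumption \<open>gen\<close> is all that the
  two variants of the algorithm have to provide: for generic functionals a corner can be chosen, and
  each admissible corner is an extreme point.
\<close>
lemma algorithm_terminates:
  assumes A: "A \<in> sym_tuples d" and bdd: "bounded_free_spec d A"
    and X: "X \<in> tuples n n"
    and gen: "\<And>S. compact S \<Longrightarrow> convex S \<Longrightarrow> S \<noteq> {} \<Longrightarrow>
      \<forall>\<^sub>F l in F. (\<exists>\<gamma>. \<gamma> \<in> corner_choices adm S l) \<and> (\<forall>\<gamma>\<in>corner_choices adm S l. \<gamma> extreme_point_of S)"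
    and P: "\<And>k Y. k \<le> \<mu> \<Longrightarrow> arveson_extreme d A (n + k) Y \<Longrightarrow> is_dilation n X k Y \<Longrightarrow> P k Y"
  shows "Y \<in> free_spec d A (n + k) \<Longrightarrow> is_dilation n X k Y \<Longrightarrow> k + b \<le> \<mu> \<Longrightarrow>
    (\<And>m f. (\<And>j. j < m \<Longrightarrow> f j \<in> dilation_subspace d A (n + k) Y) \<Longrightarrow> indep_family (n + k) m f \<Longrightarrow> m \<le> b) \<Longrightarrow>
    terminates_within d A n F adm P b k Y"
proof (induction b arbitrary: k Y)
  case 0
  have "\<beta> = (\<lambda>i. 0\<^sub>m (n + k) 1)" if b: "\<beta> \<in> dilation_subspace d A (n + k) Y" for \<beta>
  proof (rule ccontr)
    assume nz: "\<beta> \<noteq> (\<lambda>i. 0\<^sub>m (n + k) 1)"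
    have bt: "\<beta> \<in> tuples (n + k) 1" using b by (simp add: dilation_subspace_def)
    have "indep_family (n + k) 1 (\<lambda>_. \<beta>)"
      unfolding indep_family_def
    proof (intro allI impI)
      fix c :: "nat \<Rightarrow> real" and j :: nat assume h: "\<forall>i. \<forall>q<n + k. (\<Sum>j<1. c j * \<beta> i $$ (q, 0)) = 0" and "j < 1"
      have "c 0 = 0"
      proof (rule ccontr)
        assume "c 0 \<noteq> 0"
        then have "\<forall>i. \<forall>q<n + k. \<beta> i $$ (q, 0) = 0" using h by simp
        then show False using direction_norm_pos[OF bt nz] by simp
      qed
      then show "c j = 0" using \<open>j < 1\<close> by simp
    qed
    then have "(1::nat) \<le> 0" by (rule 0(4)[OF b])
    then show False by simp
  qed
  then have arv: "arveson_extreme d A (n + k) Y"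
    using arveson_iff_rigid[OF A 0(1)] unfolding rigid_def by blast
  have "P k Y" by (rule P[OF _ arv 0(2)]) (use 0(3) in simp)
  with arv show ?case by simp
next
  case (Suc b)
  show ?case
  proof (cases "arveson_extreme d A (n + k) Y")
    case True
    have "P k Y" by (rule P[OF _ True Suc.prems(2)]) (use Suc.prems(3) in simp)
    with True show ?thesis by simp
  next
    case False
    have Ys: "Y \<in> sym_tuples (n + k)" using Suc.prems(1) by (simp add: free_spec_def)
    have "\<exists>\<beta>. direction d A (n + k) Y \<beta>"
      using False arveson_iff_rigid[OF A Suc.prems(1)] unfolding direction_def rigid_def by blast
    moreover have "\<exists>c. max_scaling d A (n + k) Y \<beta> c" if "direction d A (n + k) Y \<beta>" for \<beta>
      by (rule max_scaling_exists[OF bdd A Suc.prems(1) that])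
    moreover have "\<forall>\<^sub>F l in F.
              (\<exists>\<gamma>. \<gamma> \<in> corner_choices adm (border_spec d A (n + k) Y \<beta> c) l) \<and>
              (\<forall>\<gamma> \<in> corner_choices adm (border_spec d A (n + k) Y \<beta> c) l.
                 terminates_within d A n F adm P b (Suc k) (border Y \<beta> c \<gamma>))"
      if dir: "direction d A (n + k) Y \<beta>" and mx: "max_scaling d A (n + k) Y \<beta> c" for \<beta> c
    proof -
      let ?S = "border_spec d A (n + k) Y \<beta> c"
      have bt: "\<beta> \<in> tuples (n + k) 1" using dir by (simp add: direction_def dilation_subspace_def)
      have "?S \<noteq> {}" using mx unfolding max_scaling_def is_arg_max_def by blast
      from gen[OF compact_border_spec[OF bdd A Ys bt] convex_border_spec[OF A Ys bt] this]
      show ?thesis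
      proof eventually_elim
        case (elim l)
        have "terminates_within d A n F adm P b (Suc k) (border Y \<beta> c \<gamma>)"
          if "\<gamma> \<in> corner_choices adm ?S l" for \<gamma>
        proof (rule Suc.IH)
          have ext: "\<gamma> extreme_point_of ?S" using elim that by blast
          then have "\<gamma> \<in> ?S" by (simp add: extreme_point_of_def)
          then show "border Y \<beta> c \<gamma> \<in> free_spec d A (n + Suc k)"
            using border_spec_iff[OF A Ys bt] by simp
          show "is_dilation n X (Suc k) (border Y \<beta> c \<gamma>)"
            by (rule is_dilation_border[OF X Suc.prems(2) bt])
          show "Suc k + b \<le> \<mu>" using Suc.prems(3) by simp
          fix m f assume f: "\<And>j. j < m \<Longrightarrow> f j \<in> dilation_subspace d A (n + Suc k) (border Y \<beta> c \<gamma>)"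
            and ind: "indep_family (n + Suc k) m f"
          obtain f' where "\<forall>j<Suc m. f' j \<in> dilation_subspace d A (n + k) Y" "indep_family (n + k) (Suc m) f'"
            using independent_family_grows[OF A Suc.prems(1) dir mx ext, of m f] f ind
            unfolding add_Suc_right by blast
          then have "Suc m \<le> Suc b" by (intro Suc.prems(4)[of "Suc m" f']) blast+
          then show "m \<le> b" by simp
        qed
        then show ?case using elim by blast
      qed
    qed
    ultimately show ?thesis unfolding terminates_within.simps if_not_P[OF False] by blast
  qed
qed

section \<open>The dimension of the dilation subspace\<close>

definition tuple_subspace :: "nat \<Rightarrow> 'g mat_tuple set \<Rightarrow> bool" where
  "tuple_subspace n W \<longleftrightarrow> W \<subseteq> tuples n 1 \<and> (\<lambda>i. 0\<^sub>m n 1) \<in> W \<and>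
    (\<forall>x\<in>W. \<forall>y\<in>W. (\<lambda>i. x i + y i) \<in> W) \<and> (\<forall>c. \<forall>x\<in>W. (\<lambda>i. c \<cdot>\<^sub>m x i) \<in> W)"

lemma tuple_subspace_vectorspace:
  assumes "tuple_subspace n W"
  shows "vectorspace class_ring ((tuple_module n 1)\<lparr>carrier := W\<rparr>)"
proof -
  have c: "x i \<in> carrier_mat n 1" if "x \<in> W" for x i
    using assms that by (auto simp: tuple_subspace_def tuples_def)
  have neg: "\<exists>y\<in>W. (\<lambda>i. x i + y i) = (\<lambda>i. 0\<^sub>m n 1)" if x: "x \<in> W" for x
  proof (intro bexI[of _ "\<lambda>i. (- 1) \<cdot>\<^sub>m x i"] ext)
    show "(\<lambda>i. (- 1) \<cdot>\<^sub>m x i) \<in> W" using assms x by (simp add: tuple_subspace_def)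
    show "x i + (- 1) \<cdot>\<^sub>m x i = 0\<^sub>m n 1" for i
      using c[OF x, of i] by (intro eq_matI) auto
  qed
  have dims: "dim_row (x i) = n" "dim_col (x i) = 1" if "x \<in> W" for x i
    using c[OF that, of i] by auto
  let ?M = "(tuple_module n 1)\<lparr>carrier := W\<rparr>"
  have M: "carrier ?M = W" "zero ?M = (\<lambda>i. 0\<^sub>m n 1)" "add ?M = (\<lambda>\<beta> \<beta>' i. \<beta> i + \<beta>' i)"
    "module.smult ?M = (\<lambda>c \<beta> i. c \<cdot>\<^sub>m \<beta> i)"
    by (simp_all add: tuple_module_def)
  show ?thesis
  proof (rule vs_criteria)
    show "field (class_ring :: real ring)" by (rule class_field)
  qed (unfold M, use assms neg in \<open>auto simp: tuple_subspace_def fun_eq_iff dims algebra_simps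
      simp del: One_nat_def intro!: eq_matI\<close>)
qed

lemma dilation_subspace_is_subspace:
  assumes At: "A \<in> tuples d d" and Xt: "X \<in> tuples n n"
  shows "tuple_subspace n (dilation_subspace d A n X)"
proof -
  have zero: "row_form d A n (\<lambda>i. 0\<^sub>m n 1) w V = 0" for w V by (simp add: row_form_def)
  have add: "row_form d A n (\<lambda>i. x i + y i) w V = row_form d A n x w V + row_form d A n y w V"
    if "x \<in> tuples n 1" "y \<in> tuples n 1" for x y w V
  proof -
    have "dim_row (y i) = n" "dim_col (y i) = 1" for i
      using that unfolding tuples_def carrier_mat_def by auto
    then show ?thesis by (simp add: row_form_def distrib_right sum.distrib)
  qed
  have mem: "x \<in> tuples n 1" "in_pencil_kernel d A n X V \<Longrightarrow> row_form d A n x w V = 0"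
    if "x \<in> dilation_subspace d A n X" for x V w
    using that dilation_subspace_iff[OF At Xt, of x] by blast+
  have iff: "x \<in> dilation_subspace d A n X \<longleftrightarrow> x \<in> tuples n 1 \<and>
      (\<forall>V. in_pencil_kernel d A n X V \<longrightarrow> (\<forall>w. row_form d A n x w V = 0))" for x
    by (rule dilation_subspace_iff[OF At Xt])
  show ?thesis
    unfolding tuple_subspace_def
  proof (intro conjI ballI allI subsetI)
    show "x \<in> tuples n 1" if "x \<in> dilation_subspace d A n X" for x by (rule mem(1)[OF that])
    show "(\<lambda>i. 0\<^sub>m n 1) \<in> dilation_subspace d A n X"
      unfolding iff zero by (simp add: tuples_def)
    show "(\<lambda>i. c \<cdot>\<^sub>m x i) \<in> dilation_subspace d A n X" if x: "x \<in> dilation_subspace d A n X" for c x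
      unfolding iff row_form_scale[OF mem(1)[OF x]] using border_parts(1)[OF mem(1)[OF x]] mem(2)[OF x] by simp
    show "(\<lambda>i. x i + y i) \<in> dilation_subspace d A n X"
      if x: "x \<in> dilation_subspace d A n X" and y: "y \<in> dilation_subspace d A n X" for x y
    proof -
      have "(\<lambda>i. x i + y i) \<in> tuples n 1" using mem(1)[OF x] mem(1)[OF y] by (auto simp: tuples_def)
      then show ?thesis
        unfolding iff add[OF mem(1)[OF x] mem(1)[OF y]] using mem(2)[OF x] mem(2)[OF y] by simp
    qed
  qed
qed

lemma lincomb_entry:
  assumes W: "tuple_subspace n W" and "finite B" "B \<subseteq> W" and q: "q < n"
  shows "module.lincomb ((tuple_module n 1)\<lparr>carrier := W\<rparr>) a B i $$ (q, 0) = (\<Sum>v\<in>B. a v * v i $$ (q, 0))"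
proof -
  interpret V: vectorspace class_ring "(tuple_module n 1)\<lparr>carrier := W\<rparr>"
    by (rule tuple_subspace_vectorspace[OF W])
  have sm: "(\<lambda>i. c \<cdot>\<^sub>m v i) \<in> W" if "v \<in> W" for c v
    using W that by (simp add: tuple_subspace_def)
  have dims: "dim_row (v i) = n" "dim_col (v i) = 1" if "v \<in> W" for v i
    using W that unfolding tuple_subspace_def tuples_def carrier_mat_def by auto
  from assms(2,3) show ?thesis
  proof (induction B)
    case empty
    show ?case using q unfolding V.lincomb_def V.finsum_empty by (simp add: tuple_module_def)
  next
    case (insert v B)
    let ?M = "(tuple_module n 1)\<lparr>carrier := W\<rparr>"
    have m: "V.lincomb a B \<in> W"
      using V.lincomb_closed[of B a] insert.prems by (auto simp: tuple_module_def)
    have "V.lincomb a (insert v B) = (a v \<odot>\<^bsub>?M\<^esub> v) \<oplus>\<^bsub>?M\<^esub> V.lincomb a B"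
      unfolding V.lincomb_def
      using insert by (intro V.finsum_insert) (auto simp: tuple_module_def sm)
    then have "V.lincomb a (insert v B) i = (a v \<cdot>\<^sub>m v i) + V.lincomb a B i"
      by (simp add: tuple_module_def)
    then show ?case
      using insert q dims[OF m] dims[of v] by simp
  qed
qed

lemma tuple_eq_zero_iff:
  assumes "x \<in> tuples n 1"
  shows "x = (\<lambda>i. 0\<^sub>m n 1) \<longleftrightarrow> (\<forall>i. \<forall>q<n. x i $$ (q, 0) = 0)"
proof -
  have "dim_row (x i) = n" "dim_col (x i) = 1" for i
    using assms unfolding tuples_def carrier_mat_def by auto
  then show ?thesis by (auto simp: fun_eq_iff mat_eq_iff)
qed

text \<open>
  By elimination a linearly independent set of columns has at most \<open>n g\<close> elements. So a maximal one
  exists and is a basis, which gives finite dimension and the first bound. A family that is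
  independent in coordinates is injective with linearly independent range, which gives the second.
\<close>
lemma tuple_subspace_dim:
  fixes W :: "'g::finite mat_tuple set"
  assumes W: "tuple_subspace n W"
  defines "D \<equiv> vectorspace.dim class_ring ((tuple_module n 1)\<lparr>carrier := W\<rparr>)"
  shows "D \<le> n * CARD('g)"
    and "\<And>k b. (\<And>j. j < k \<Longrightarrow> b j \<in> W) \<Longrightarrow> indep_family n k b \<Longrightarrow> k \<le> D"
proof -
  let ?M = "(tuple_module n 1)\<lparr>carrier := W\<rparr>"
  interpret V: vectorspace class_ring ?M
    by (rule tuple_subspace_vectorspace[OF W])
  have carr: "carrier ?M = W" by (simp add: tuple_module_def)
  have Wt: "W \<subseteq> tuples n 1" using W by (simp add: tuple_subspace_def)
  have zero_iff: "V.lincomb a B = \<zero>\<^bsub>?M\<^esub> \<longleftrightarrow> (\<forall>i. \<forall>q<n. (\<Sum>v\<in>B. a v * v i $$ (q, 0)) = 0)"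
    if "finite B" "B \<subseteq> W" for a B
  proof -
    have "V.lincomb a B \<in> carrier ?M"
      using that by (intro V.lincomb_closed) (auto simp: carr)
    then have "V.lincomb a B \<in> tuples n 1" using Wt carr by blast
    then show ?thesis
      using tuple_eq_zero_iff[of "V.lincomb a B"] lincomb_entry[OF W that]
      by (simp add: tuple_module_def)
  qed
  have small: "card B \<le> n * CARD('g)" if B: "finite B" "B \<subseteq> W" "V.lin_indpt B" for B
  proof (rule ccontr)
    assume "\<not> ?thesis"
    then have lt: "card ({..<n} \<times> (UNIV :: 'g set)) < card B" by simp
    obtain a where a: "\<exists>v\<in>B. a v \<noteq> 0" "\<forall>e\<in>{..<n} \<times> UNIV. (\<Sum>v\<in>B. v (snd e) $$ (fst e, 0) * a v) = 0"
      using homogeneous_system_nonzero_solution[OF _ B(1) lt, of "\<lambda>e v. v (snd e) $$ (fst e, 0)"] by auto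
    have "V.lincomb a B = \<zero>\<^bsub>?M\<^esub>"
      using a(2) by (subst zero_iff[OF B(1,2)]) (auto simp: mult.commute)
    then have "V.lin_dep B"
      unfolding V.lin_dep_def using a(1) B(1) by (intro exI[of _ B] exI[of _ a]) auto
    with B(3) show False by simp
  qed
  have fin: "finite B \<and> card B \<le> n * CARD('g)" if B: "B \<subseteq> W" "V.lin_indpt B" for B
  proof (cases "finite B")
    case False
    then obtain C where C: "C \<subseteq> B" "finite C" "card C = Suc (n * CARD('g))"
      using infinite_arbitrarily_large by blast
    have "V.lin_indpt C" using V.subset_li_is_li[OF B(2) C(1)] .
    then have "card C \<le> n * CARD('g)" using small C B(1) by blast
    then show ?thesis using C(3) by simp
  qed (use small B in blast)
  have "V.lin_indpt {}" unfolding V.lin_dep_def by auto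
  then have "\<exists>B. finite B \<and> maximal B (\<lambda>S. S \<subseteq> carrier ?M \<and> V.lin_indpt S)"
    by (intro maximal_exists[where B="{}" and N="n * CARD('g)"]) (use fin carr in auto)
  then obtain B where B: "finite B" "maximal B (\<lambda>S. S \<subseteq> carrier ?M \<and> V.lin_indpt S)" by blast
  have bas: "V.basis B" by (rule V.max_li_is_basis[OF B(2)])
  have fd: "V.fin_dim" unfolding V.fin_dim_def using bas B(1) unfolding V.basis_def by blast
  have "D = card B" unfolding D_def by (rule V.dim_basis[OF B(1) bas])
  then show "D \<le> n * CARD('g)"
    using fin[of B] bas unfolding V.basis_def carr by simp
  fix k and b :: "nat \<Rightarrow> 'g mat_tuple"
  assume b: "\<And>j. j < k \<Longrightarrow> b j \<in> W" and ind: "indep_family n k b"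
  have inj: "inj_on b {..<k}"
  proof (rule inj_onI)
    fix j l assume jl: "j \<in> {..<k}" "l \<in> {..<k}" "b j = b l"
    show "j = l"
    proof (rule ccontr)
      assume ne: "j \<noteq> l"
      let ?c = "\<lambda>m. (if m = j then 1 else 0) - (if m = l then 1 else 0 :: real)"
      have zero: "(\<Sum>m<k. ?c m * b m i $$ (q, 0)) = 0" for i q
      proof -
        have "(\<Sum>m<k. ?c m * b m i $$ (q, 0))
          = (\<Sum>m<k. if m = j then b m i $$ (q, 0) else 0) - (\<Sum>m<k. if m = l then b m i $$ (q, 0) else 0)"
          unfolding sum_subtractf[symmetric] by (rule sum.cong) auto
        then show ?thesis using jl by (simp add: sum.delta)
      qed
      have "\<forall>m<k. ?c m = 0"
        by (rule ind[unfolded indep_family_def, THEN spec, THEN mp]) (use zero in blast)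
      then show False using jl ne by auto
    qed
  qed
  have "V.lin_indpt (b ` {..<k})"
  proof
    assume "V.lin_dep (b ` {..<k})"
    then obtain a v where av: "V.lincomb a (b ` {..<k}) = \<zero>\<^bsub>?M\<^esub>" "v \<in> b ` {..<k}" "a v \<noteq> 0"
      using V.finite_lin_dep[of "b ` {..<k}"] b carr by auto
    have "\<forall>i. \<forall>q<n. (\<Sum>v\<in>b ` {..<k}. a v * v i $$ (q, 0)) = 0"
      using av(1) b by (subst (asm) zero_iff) auto
    then have "\<forall>i. \<forall>q<n. (\<Sum>j<k. a (b j) * b j i $$ (q, 0)) = 0"
      by (simp add: sum.reindex[OF inj])
    then have "\<forall>j<k. a (b j) = 0" using ind[unfolded indep_family_def, rule_format, of "\<lambda>j. a (b j)"] by blast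
    then show False using av(2,3) by auto
  qed
  then have "card (b ` {..<k}) \<le> V.dim"
    using b carr by (intro V.li_le_dim(2)[OF fd]) auto
  then show "k \<le> D" by (simp add: D_def card_image[OF inj])
qed

section \<open>Change of tuples under matrix multiplication\<close>

text \<open>
  The pencil form is a difference of terms of this kind, with \<open>f\<close> the inner product or a form \<open>A\<^sub>i\<close>.
  Matrix identities for \<open>M\<close> can thus be used without expanding the sums over \<open>\<real>\<^sup>d\<close>.
\<close>
definition matrix_form :: "nat \<Rightarrow> nat \<Rightarrow> real mat \<Rightarrow> ((nat \<Rightarrow> real) \<Rightarrow> (nat \<Rightarrow> real) \<Rightarrow> real) \<Rightarrow>
    (nat \<Rightarrow> nat \<Rightarrow> real) \<Rightarrow> (nat \<Rightarrow> nat \<Rightarrow> real) \<Rightarrow> real" where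
  "matrix_form m n M f U V = (\<Sum>q<m. \<Sum>q'<n. M $$ (q, q') * f (U q) (V q'))"

text \<open>
  The operator \<open>I \<otimes> C\<close> on \<open>\<real>\<^sup>d \<otimes> \<real>\<^sup>n\<close>.
\<close>
definition recombine :: "nat \<Rightarrow> real mat \<Rightarrow> (nat \<Rightarrow> nat \<Rightarrow> real) \<Rightarrow> nat \<Rightarrow> nat \<Rightarrow> real" where
  "recombine n C V = (\<lambda>r p. \<Sum>q<n. C $$ (r, q) * V q p)"

text \<open>
  Compatibility with finite linear combinations of functions, pointwise; this is the part of
  bilinearity that moving matrices across a form uses.
\<close>
definition sum_bilinear :: "((nat \<Rightarrow> real) \<Rightarrow> (nat \<Rightarrow> real) \<Rightarrow> real) \<Rightarrow> bool" where
  "sum_bilinear f \<longleftrightarrow> (\<forall>K c x y. f (\<lambda>p. \<Sum>k<(K::nat). c k * x k p) y = (\<Sum>k<K. c k * f (x k) y)) \<and>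
    (\<forall>K c x y. f y (\<lambda>p. \<Sum>k<(K::nat). c k * x k p) = (\<Sum>k<K. c k * f y (x k)))"

lemma sum_bilinear_aform: "sum_bilinear (aform d M)" and sum_bilinear_dot: "sum_bilinear (dot d)"
  by (simp_all add: sum_bilinear_def aform_sum_left aform_sum_right dot_sum_left dot_sum_right)

lemma Lam_form_matrix_form: "Lam_form d A m n M U V = (\<Sum>i\<in>UNIV. matrix_form m n (M i) (aform d (A i)) U V)"
  by (simp add: Lam_form_def matrix_form_def)

lemma dot_matrix_form: "(\<Sum>q<n. dot d (U q) (V q)) = matrix_form n n (1\<^sub>m n) (dot d) U V"
proof -
  have "(\<Sum>q'<n. 1\<^sub>m n $$ (q, q') * dot d (U q) (V q')) = dot d (U q) (V q)" if "q < n" for q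
  proof -
    have "(\<Sum>q'<n. 1\<^sub>m n $$ (q, q') * dot d (U q) (V q')) = (\<Sum>q'<n. if q' = q then dot d (U q) (V q') else 0)"
      using that by (intro sum.cong) auto
    then show ?thesis using that by (simp add: sum.delta)
  qed
  then show ?thesis by (simp add: matrix_form_def)
qed

lemma pencil_form_matrix_form: "pencil_form d A n X U V = matrix_form n n (1\<^sub>m n) (dot d) U V - (\<Sum>i\<in>UNIV. matrix_form n n (X i) (aform d (A i)) U V)"
  by (simp add: pencil_form_def dot_matrix_form Lam_form_matrix_form)

lemma mat_mult_entry:
  "M \<in> carrier_mat a b \<Longrightarrow> N \<in> carrier_mat b c \<Longrightarrow> i < a \<Longrightarrow> j < c \<Longrightarrow>
    (M * N) $$ (i, j) = (\<Sum>k<b. M $$ (i, k) * N $$ (k, j))"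
  by (auto simp: scalar_prod_def lessThan_atLeast0)

lemma matrix_form_recombine_right:
  assumes f: "sum_bilinear f" and M: "M \<in> carrier_mat k m" and C: "C \<in> carrier_mat m n"
  shows "matrix_form k m M f U (recombine n C V) = matrix_form k n (M * C) f U V"
proof -
  have "matrix_form k m M f U (recombine n C V) = (\<Sum>a<k. \<Sum>b<m. \<Sum>q<n. M $$ (a, b) * (C $$ (b, q) * f (U a) (V q)))"
    using f unfolding matrix_form_def recombine_def sum_bilinear_def by (simp add: sum_distrib_left)
  also have "\<dots> = (\<Sum>a<k. \<Sum>q<n. \<Sum>b<m. M $$ (a, b) * (C $$ (b, q) * f (U a) (V q)))"
    by (rule sum.cong[OF refl], rule sum.swap)
  also have "\<dots> = matrix_form k n (M * C) f U V"
    unfolding matrix_form_def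
    by (intro sum.cong refl, subst mat_mult_entry[OF M C]) (auto simp: sum_distrib_left sum_distrib_right mult_ac)
  finally show ?thesis .
qed

lemma matrix_form_recombine_left:
  assumes f: "sum_bilinear f" and M: "M \<in> carrier_mat m k" and C: "C \<in> carrier_mat m n"
  shows "matrix_form m k M f (recombine n C U) V = matrix_form n k (transpose_mat C * M) f U V"
proof -
  have Ct: "transpose_mat C \<in> carrier_mat n m" using C by simp
  have "matrix_form m k M f (recombine n C U) V = (\<Sum>a<m. \<Sum>b<k. \<Sum>q<n. M $$ (a, b) * (C $$ (a, q) * f (U q) (V b)))"
    using f unfolding matrix_form_def recombine_def sum_bilinear_def by (simp add: sum_distrib_left)
  also have "\<dots> = (\<Sum>a<m. \<Sum>q<n. \<Sum>b<k. M $$ (a, b) * (C $$ (a, q) * f (U q) (V b)))"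
    by (rule sum.cong[OF refl], rule sum.swap)
  also have "\<dots> = (\<Sum>q<n. \<Sum>a<m. \<Sum>b<k. M $$ (a, b) * (C $$ (a, q) * f (U q) (V b)))"
    by (rule sum.swap)
  also have "\<dots> = (\<Sum>q<n. \<Sum>b<k. \<Sum>a<m. M $$ (a, b) * (C $$ (a, q) * f (U q) (V b)))"
    by (rule sum.cong[OF refl], rule sum.swap)
  also have "\<dots> = matrix_form n k (transpose_mat C * M) f U V"
    unfolding matrix_form_def
    by (intro sum.cong refl, subst mat_mult_entry[OF Ct M]) (use C in \<open>auto simp: sum_distrib_left sum_distrib_right mult_ac\<close>)
  finally show ?thesis .
qed

lemma matrix_form_congruence:
  assumes f: "sum_bilinear f" and M: "M \<in> carrier_mat m m" and C: "C \<in> carrier_mat m n"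
  shows "matrix_form m m M f (recombine n C U) (recombine n C V) = matrix_form n n (transpose_mat C * M * C) f U V"
proof -
  have Ct: "transpose_mat C \<in> carrier_mat n m" using C by simp
  show ?thesis
    unfolding matrix_form_recombine_right[OF f M C] matrix_form_recombine_left[OF f mult_carrier_mat[OF M C] C]
    by (simp add: assoc_mult_mat[OF Ct M C])
qed

lemma matrix_form_mat_sum: "matrix_form n n (mat_sum n n J M) f U V = (\<Sum>j\<in>J. matrix_form n n (M j) f U V)"
proof -
  have "matrix_form n n (mat_sum n n J M) f U V = (\<Sum>q<n. \<Sum>q'<n. \<Sum>j\<in>J. M j $$ (q, q') * f (U q) (V q'))"
    by (simp add: matrix_form_def mat_sum_def sum_distrib_right)
  also have "\<dots> = (\<Sum>q<n. \<Sum>j\<in>J. \<Sum>q'<n. M j $$ (q, q') * f (U q) (V q'))"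
    by (rule sum.cong[OF refl], rule sum.swap)
  also have "\<dots> = (\<Sum>j\<in>J. \<Sum>q<n. \<Sum>q'<n. M j $$ (q, q') * f (U q) (V q'))"
    by (rule sum.swap)
  finally show ?thesis by (simp add: matrix_form_def)
qed

lemma sym_tuplesD: "X \<in> sym_tuples n \<Longrightarrow> X i \<in> carrier_mat n n" "X \<in> sym_tuples n \<Longrightarrow> transpose_mat (X i) = X i"
  by (auto simp: sym_tuples_def)

text \<open>
  The identity \<open>\<Sum>\<^sub>j V\<^sub>j\<^sup>T V\<^sub>j = I\<close> is what turns the constant term of \<open>L\<^sub>A\<close> into a sum over \<open>j\<close>.
\<close>
lemma pencil_form_convex_combination:
  fixes r :: nat
  assumes Y: "\<And>j. j < r \<Longrightarrow> Y j \<in> tuples (m j) (m j)" and V: "\<And>j. j < r \<Longrightarrow> V j \<in> carrier_mat (m j) n"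
    and one: "mat_sum n n {..<r} (\<lambda>j. transpose_mat (V j) * V j) = 1\<^sub>m n"
    and X: "\<And>i. X i = mat_sum n n {..<r} (\<lambda>j. transpose_mat (V j) * Y j i * V j)"
  shows "pencil_form d A n X U W = (\<Sum>j<r. pencil_form d A (m j) (Y j) (recombine n (V j) U) (recombine n (V j) W))"
proof -
  have "pencil_form d A (m j) (Y j) (recombine n (V j) U) (recombine n (V j) W)
    = matrix_form n n (transpose_mat (V j) * V j) (dot d) U W
      - (\<Sum>i\<in>UNIV. matrix_form n n (transpose_mat (V j) * Y j i * V j) (aform d (A i)) U W)" if j: "j < r" for j
  proof -
    have Yi: "Y j i \<in> carrier_mat (m j) (m j)" for i using Y[OF j] by (simp add: tuples_def)
    have t: "transpose_mat (V j) \<in> carrier_mat n (m j)" using V[OF j] by simp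
    show ?thesis
      unfolding pencil_form_matrix_form by (simp add: matrix_form_congruence[OF sum_bilinear_dot one_carrier_mat V[OF j]]
          matrix_form_congruence[OF sum_bilinear_aform Yi V[OF j]] right_mult_one_mat[OF t])
  qed
  then have "(\<Sum>j<r. pencil_form d A (m j) (Y j) (recombine n (V j) U) (recombine n (V j) W))
    = matrix_form n n (1\<^sub>m n) (dot d) U W - (\<Sum>j<r. \<Sum>i\<in>UNIV. matrix_form n n (transpose_mat (V j) * Y j i * V j) (aform d (A i)) U W)"
    by (simp add: sum_subtractf one[symmetric] matrix_form_mat_sum)
  also have "(\<Sum>j<r. \<Sum>i\<in>UNIV. matrix_form n n (transpose_mat (V j) * Y j i * V j) (aform d (A i)) U W)
    = (\<Sum>i\<in>UNIV. matrix_form n n (X i) (aform d (A i)) U W)"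
    unfolding X matrix_form_mat_sum by (rule sum.swap)
  finally show ?thesis by (simp add: pencil_form_matrix_form)
qed

lemma pencil_form_intertwine:
  assumes Y: "Y \<in> tuples m m" and X: "X \<in> tuples n n" and C: "C \<in> carrier_mat m n"
    and CY: "\<And>i. transpose_mat C * Y i = X i * transpose_mat C"
  shows "pencil_form d A m Y (recombine n C U) V = pencil_form d A n X U (recombine m (transpose_mat C) V)"
proof -
  have Yi: "Y i \<in> carrier_mat m m" and Xi: "X i \<in> carrier_mat n n" for i
    using X Y by (simp_all add: tuples_def)
  have t: "transpose_mat C \<in> carrier_mat n m" using C by simp
  show ?thesis
    unfolding pencil_form_matrix_form
    by (simp add: matrix_form_recombine_left[OF sum_bilinear_dot one_carrier_mat C] matrix_form_recombine_left[OF sum_bilinear_aform Yi C]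
        matrix_form_recombine_right[OF sum_bilinear_dot one_carrier_mat t] matrix_form_recombine_right[OF sum_bilinear_aform Xi t]
        CY right_mult_one_mat[OF t] left_mult_one_mat[OF t])
qed

lemma compression_in_free_spec:
  assumes A: "A \<in> sym_tuples d" and Y: "Y \<in> free_spec d A m" and C: "C \<in> carrier_mat m n"
    and iso: "transpose_mat C * C = 1\<^sub>m n"
  shows "(\<lambda>i. transpose_mat C * Y i * C) \<in> free_spec d A n"
proof -
  have Ys: "Y \<in> sym_tuples m" using Y by (simp add: free_spec_def)
  note Yi = sym_tuplesD[OF Ys]
  have t: "transpose_mat C \<in> carrier_mat n m" using C by simp
  let ?X = "\<lambda>i. transpose_mat C * Y i * C"
  have Xc: "?X i \<in> carrier_mat n n" for i using mult_carrier_mat[OF mult_carrier_mat[OF t Yi(1)] C] .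
  have "transpose_mat (?X i) = ?X i" for i
    using transpose_mult[OF mult_carrier_mat[OF t Yi(1)] C, of i] transpose_mult[OF t Yi(1), of i]
      assoc_mult_mat[OF t Yi(1) C, of i] by (simp add: Yi(2))
  then have Xs: "?X \<in> sym_tuples n" using Xc by (simp add: sym_tuples_def)
  have one: "mat_sum n n {..<1::nat} (\<lambda>j. transpose_mat C * C) = 1\<^sub>m n"
    unfolding iso by (rule eq_matI) (auto simp: mat_sum_def)
  have sumX: "?X i = mat_sum n n {..<1::nat} (\<lambda>j. ?X i)" for i
    using Xc[of i] by (intro eq_matI) (auto simp: mat_sum_def)
  have Yt: "Y \<in> tuples m m" using Ys sym_tuples_subset by blast
  have "pencil_form d A n ?X U U = pencil_form d A m Y (recombine n C U) (recombine n C U)" for U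
    using pencil_form_convex_combination[of 1 "\<lambda>_. Y" "\<lambda>_. m" "\<lambda>_. C" n ?X d A U U, OF Yt C one sumX] by simp
  then show ?thesis
    using Y Xs by (simp add: free_spec_iff[OF A])
qed

lemma row_form_intertwine:
  assumes b: "\<beta> \<in> tuples n 1" and C: "C \<in> carrier_mat m n"
  shows "row_form d A m (\<lambda>i. C * \<beta> i) w V = row_form d A n \<beta> w (recombine m (transpose_mat C) V)"
proof -
  have bi: "\<beta> i \<in> carrier_mat n 1" for i using b by (simp add: tuples_def)
  have t: "transpose_mat C \<in> carrier_mat n m" using C by simp
  have Cb: "(\<lambda>i. C * \<beta> i) \<in> tuples m 1" using bi C by (auto simp: tuples_def)
  have bt: "transpose_mat (\<beta> i) \<in> carrier_mat 1 n" for i using bi[of i] by simp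
  have "transpose_mat (C * \<beta> i) = transpose_mat (\<beta> i) * transpose_mat C" for i
    by (rule transpose_mult[OF C bi])
  then have "Lam_form d A 1 m (\<lambda>i. transpose_mat (C * \<beta> i)) (\<lambda>_. w) V
    = Lam_form d A 1 n (\<lambda>i. transpose_mat (\<beta> i)) (\<lambda>_. w) (recombine m (transpose_mat C) V)"
    by (simp add: Lam_form_matrix_form matrix_form_recombine_right[OF sum_bilinear_aform bt t] del: One_nat_def)
  then show ?thesis using Lam_form_row[OF Cb] Lam_form_row[OF b] by metis
qed

text \<open>
  \<open>C\<close> maps directions of \<open>Z\<close> to directions of \<open>Y\<close>: the intertwining relation makes \<open>C\<^sup>T\<close> map
  \<open>ker L\<^sub>A(Y)\<close> to \<open>ker L\<^sub>A(Z)\<close>. As \<open>C\<close> is an isometry, no direction is lost.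
\<close>
lemma rigid_summand:
  assumes A: "A \<in> sym_tuples d" and Y: "Y \<in> sym_tuples m" and Z: "Z \<in> sym_tuples n"
    and C: "C \<in> carrier_mat m n" and iso: "transpose_mat C * C = 1\<^sub>m n"
    and CY: "\<And>i. transpose_mat C * Y i = Z i * transpose_mat C" and rig: "rigid d A m Y"
  shows "rigid d A n Z"
  unfolding rigid_def
proof
  have At: "A \<in> tuples d d" and Yt: "Y \<in> tuples m m" and Zt: "Z \<in> tuples n n"
    using A Y Z sym_tuples_subset by blast+
  have t: "transpose_mat C \<in> carrier_mat n m" using C by simp
  fix \<beta> assume b: "\<beta> \<in> dilation_subspace d A n Z"
  have bt: "\<beta> \<in> tuples n 1" using b by (simp add: dilation_subspace_def)
  then have bi: "\<beta> i \<in> carrier_mat n 1" for i by (simp add: tuples_def)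
  have "row_form d A m (\<lambda>i. C * \<beta> i) w V = 0" if V: "in_pencil_kernel d A m Y V" for w V
  proof -
    have "in_pencil_kernel d A n Z (recombine m (transpose_mat C) V)"
      using V unfolding in_pencil_kernel_def pencil_form_intertwine[OF Yt Zt C CY, symmetric] by blast
    then show ?thesis
      using b dilation_subspace_iff[OF At Zt] unfolding row_form_intertwine[OF bt C] by blast
  qed
  moreover have "(\<lambda>i. C * \<beta> i) \<in> tuples m 1" using bi C by (auto simp: tuples_def)
  ultimately have "(\<lambda>i. C * \<beta> i) \<in> dilation_subspace d A m Y"
    by (simp add: dilation_subspace_iff[OF At Yt])
  then have z: "(\<lambda>i. C * \<beta> i) = (\<lambda>i. 0\<^sub>m m 1)" using rig unfolding rigid_def by blast
  show "\<beta> = (\<lambda>i. 0\<^sub>m n 1)"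
  proof
    fix i
    have "\<beta> i = transpose_mat C * C * \<beta> i" using bi[of i] by (simp add: iso)
    also have "\<dots> = transpose_mat C * (C * \<beta> i)" by (rule assoc_mult_mat[OF t C bi])
    also have "\<dots> = 0\<^sub>m n 1" using fun_cong[OF z, of i] t by simp
    finally show "\<beta> i = 0\<^sub>m n 1" .
  qed
qed

text \<open>
  Let \<open>U\<close> be in \<open>ker L\<^sub>A(X)\<close>. Its form is the sum of the nonnegative forms of the \<open>Y j\<close> at the images
  \<open>V j U\<close>, so each \<open>V j U\<close> lies in \<open>ker L\<^sub>A(Y j)\<close>. Subtract \<open>V j\<close> applied to the kernel equation of \<open>U\<close>
  from the kernel equation of \<open>V j U\<close>: the constant terms cancel, and what remains says that \<open>U\<close> is in
  the kernel of \<open>\<Lambda>\<^sub>A\<close> at each row of \<open>Y j i * V j - V j * X i\<close>. So these rows, as columns, are directions.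
\<close>
lemma rigid_convex_combination_intertwines:
  fixes r :: nat
  assumes A: "A \<in> sym_tuples d" and X: "X \<in> sym_tuples n" and rig: "rigid d A n X"
    and Y: "\<And>j. j < r \<Longrightarrow> Y j \<in> free_spec d A (m j)" and V: "\<And>j. j < r \<Longrightarrow> V j \<in> carrier_mat (m j) n"
    and one: "mat_sum n n {..<r} (\<lambda>j. transpose_mat (V j) * V j) = 1\<^sub>m n"
    and Xeq: "\<And>i. X i = mat_sum n n {..<r} (\<lambda>j. transpose_mat (V j) * Y j i * V j)"
    and j: "j < r"
  shows "Y j i * V j = V j * X i"
proof -
  have At: "A \<in> tuples d d" and Xt: "X \<in> tuples n n" using A X sym_tuples_subset by blast+
  have Yt: "Y j \<in> tuples (m j) (m j)" if "j < r" for j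
    using Y[OF that] sym_tuples_subset by (auto simp: free_spec_def)
  have Yi: "Y j i \<in> carrier_mat (m j) (m j)" and Xi: "X i \<in> carrier_mat n n" for i
    using Yt[OF j] Xt by (simp_all add: tuples_def)
  note Vj = V[OF j]
  have t: "transpose_mat (V j) \<in> carrier_mat n (m j)" using Vj by simp
  have c1: "Y j i * V j \<in> carrier_mat (m j) n" for i using mult_carrier_mat[OF Yi Vj] .
  have c2: "V j * X i \<in> carrier_mat (m j) n" for i using mult_carrier_mat[OF Vj Xi] .
  define b where "b c = (\<lambda>i. mat n 1 (\<lambda>(q, _). (Y j i * V j) $$ (c, q) - (V j * X i) $$ (c, q)))" for c
  have "b c \<in> dilation_subspace d A n X" if c: "c < m j" for c
  proof -
    have "row_form d A n (b c) w U = 0" if U: "in_pencil_kernel d A n X U" for w U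
    proof -
      have "(\<Sum>j<r. pencil_form d A (m j) (Y j) (recombine n (V j) U) (recombine n (V j) U)) = 0"
        using U pencil_form_convex_combination[of r Y m V n X d A U U, OF Yt V one Xeq]
        unfolding in_pencil_kernel_def by simp
      moreover have "0 \<le> pencil_form d A (m j) (Y j) (recombine n (V j) U) (recombine n (V j) U)" if "j < r" for j
        using Y[OF that] free_spec_iff[OF A] by blast
      ultimately have "pencil_form d A (m j) (Y j) (recombine n (V j) U) (recombine n (V j) U) = 0"
        using j by (subst (asm) sum_nonneg_eq_0_iff) auto
      then have ker: "in_pencil_kernel d A (m j) (Y j) (recombine n (V j) U)"
        by (rule psd_form_zero_imp_kernel[OF A Y[OF j]])
      \<comment> \<open>A test vector with one component \<open>w\<close> reads off row \<open>c\<close> of the kernel equations.\<close>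
      let ?W = "\<lambda>a. if a = c then w else (\<lambda>p. 0)"
      have row: "matrix_form (m j) n M (aform d (A i)) ?W U = (\<Sum>q<n. M $$ (c, q) * aform d (A i) w (U q))" for M i
      proof -
        have "matrix_form (m j) n M (aform d (A i)) ?W U = (\<Sum>a<m j. if a = c then \<Sum>q<n. M $$ (c, q) * aform d (A i) w (U q) else 0)"
          unfolding matrix_form_def by (rule sum.cong) auto
        then show ?thesis using c by (simp add: sum.delta)
      qed
      have 1: "pencil_form d A (m j) (Y j) ?W (recombine n (V j) U)
        = matrix_form (m j) n (V j) (dot d) ?W U - (\<Sum>i\<in>UNIV. matrix_form (m j) n (Y j i * V j) (aform d (A i)) ?W U)"
        unfolding pencil_form_matrix_form by (simp add: matrix_form_recombine_right[OF sum_bilinear_dot one_carrier_mat Vj]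
            matrix_form_recombine_right[OF sum_bilinear_aform Yi Vj] left_mult_one_mat[OF Vj])
      have 2: "pencil_form d A n X (recombine (m j) (transpose_mat (V j)) ?W) U
        = matrix_form (m j) n (V j) (dot d) ?W U - (\<Sum>i\<in>UNIV. matrix_form (m j) n (V j * X i) (aform d (A i)) ?W U)"
        unfolding pencil_form_matrix_form by (simp add: matrix_form_recombine_left[OF sum_bilinear_dot one_carrier_mat t]
            matrix_form_recombine_left[OF sum_bilinear_aform Xi t] right_mult_one_mat[OF Vj])
      have "(\<Sum>i\<in>UNIV. matrix_form (m j) n (Y j i * V j) (aform d (A i)) ?W U)
        = (\<Sum>i\<in>UNIV. matrix_form (m j) n (V j * X i) (aform d (A i)) ?W U)"
      proof -
        have "pencil_form d A (m j) (Y j) ?W (recombine n (V j) U) = 0" using ker by (simp only: in_pencil_kernel_def)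
        moreover have "pencil_form d A n X (recombine (m j) (transpose_mat (V j)) ?W) U = 0"
          using U by (simp only: in_pencil_kernel_def)
        ultimately show ?thesis using 1 2 by linarith
      qed
      then show ?thesis
        unfolding row by (simp add: row_form_def b_def left_diff_distrib sum_subtractf)
    qed
    moreover have "b c \<in> tuples n 1" by (simp add: b_def tuples_def)
    ultimately show ?thesis by (simp add: dilation_subspace_iff[OF At Xt])
  qed
  then have z: "b c = (\<lambda>i. 0\<^sub>m n 1)" if "c < m j" for c using rig that unfolding rigid_def by blast
  show ?thesis
  proof (rule eq_matI)
    fix c q assume "c < dim_row (V j * X i)" "q < dim_col (V j * X i)"
    then have cq: "c < m j" "q < n" using c2[of i] by auto
    have "b c i $$ (q, 0) = 0" using z[OF cq(1)] cq(2) by simp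
    then show "(Y j i * V j) $$ (c, q) = (V j * X i) $$ (c, q)" using cq by (simp add: b_def)
  qed (simp_all only: carrier_matD[OF c1] carrier_matD[OF c2])
qed

section \<open>Irreducible tuples and isometries\<close>

text \<open>
  The largest eigenvalue is the least \<open>l\<close> with \<open>v\<^sup>T G v \<le> l \<bar>v\<bar>\<^sup>2\<close> for all \<open>v\<close>. If \<open>l I - G\<close> had trivial
  kernel, its form would dominate the coordinates of \<open>v\<close>, thus \<open>\<bar>v\<bar>\<^sup>2\<close>, and \<open>l\<close> could be lowered.
\<close>
lemma symmetric_has_eigenvector:
  fixes G :: "nat \<Rightarrow> nat \<Rightarrow> real"
  assumes n: "0 < n" and sym: "\<And>a b. a < n \<Longrightarrow> b < n \<Longrightarrow> G a b = G b a"
  shows "\<exists>l v. (\<exists>a<n. v a \<noteq> 0) \<and> (\<forall>a<n. (\<Sum>b<n. G a b * v b) = l * v a)"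
proof -
  define N where "N v = (\<Sum>a<n. (v a)\<^sup>2)" for v :: "nat \<Rightarrow> real"
  define M where "M t a b = (if a = b then t else 0) - G a b" for t and a b :: nat
  have row: "(\<Sum>b<n. M t a b * v b) = t * v a - (\<Sum>b<n. G a b * v b)" if "a < n" for t a v
  proof -
    have "(\<Sum>b<n. (if a = b then t else 0) * v b) = (\<Sum>b<n. if b = a then t * v b else 0)"
      by (rule sum.cong) auto
    then show ?thesis using that by (simp add: M_def left_diff_distrib sum_subtractf sum.delta)
  qed
  have bilM: "bilform {..<n} (M t) u v = t * (\<Sum>a<n. u a * v a) - bilform {..<n} G u v" for t u v
  proof -
    have "bilform {..<n} (M t) u v = (\<Sum>a<n. u a * (t * v a - (\<Sum>b<n. G a b * v b)))"
      unfolding bilform_col by (rule sum.cong) (simp_all add: row)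
    then show ?thesis
      by (simp add: bilform_col right_diff_distrib sum_subtractf sum_distrib_left mult_ac)
  qed
  have Q: "bilform {..<n} (M t) v v = t * N v - bilform {..<n} G v v" for t v
    unfolding bilM N_def by (simp add: power2_eq_square)
  define S where "S = {t. \<forall>v. bilform {..<n} G v v \<le> t * N v}"
  define T where "T = (\<Sum>a<n. \<Sum>b<n. \<bar>G a b\<bar>)"
  have "T \<in> S"
    unfolding S_def
  proof (intro CollectI allI)
    fix v
    have "bilform {..<n} G v v \<le> (\<Sum>a<n. \<Sum>b<n. \<bar>G a b\<bar> * N v)"
      unfolding bilform_def
    proof (intro sum_mono)
      fix a b assume ab: "a \<in> {..<n}" "b \<in> {..<n}"
      have "\<bar>v a\<bar> * \<bar>v b\<bar> \<le> N v"
        unfolding N_def by (rule abs_product_le_sum_squares[OF _ ab]) simp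
      then have "\<bar>G a b\<bar> * (\<bar>v a\<bar> * \<bar>v b\<bar>) \<le> \<bar>G a b\<bar> * N v" by (intro mult_left_mono) auto
      moreover have "G a b * v a * v b \<le> \<bar>G a b\<bar> * (\<bar>v a\<bar> * \<bar>v b\<bar>)"
        using abs_ge_self[of "G a b * v a * v b"] by (simp add: abs_mult mult.assoc)
      ultimately show "G a b * v a * v b \<le> \<bar>G a b\<bar> * N v" by linarith
    qed
    then show "bilform {..<n} G v v \<le> T * N v" by (simp add: T_def sum_distrib_right)
  qed
  have lower: "G 0 0 \<le> t" if "t \<in> S" for t
  proof -
    \<comment> \<open>The first unit vector gives a lower bound for the admissible values.\<close>
    let ?e = "\<lambda>a. if a = 0 then 1 else (0::real)"
    have r: "(\<Sum>b<n. G a b * ?e b) = G a 0" for a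
    proof -
      have "(\<Sum>b<n. G a b * ?e b) = (\<Sum>b<n. if b = 0 then G a b else 0)" by (rule sum.cong) auto
      then show ?thesis using n by (simp add: sum.delta)
    qed
    have "bilform {..<n} G ?e ?e = (\<Sum>a<n. if a = 0 then G a 0 else 0)"
      unfolding bilform_col r by (rule sum.cong) auto
    moreover have "N ?e = (\<Sum>a<n. if a = 0 then 1 else 0)" unfolding N_def by (rule sum.cong) auto
    ultimately have "bilform {..<n} G ?e ?e = G 0 0" "N ?e = 1" using n by (simp_all add: sum.delta)
    moreover have "bilform {..<n} G ?e ?e \<le> t * N ?e" using that unfolding S_def by blast
    ultimately show ?thesis by (simp only: mult_1_right)
  qed
  have bdd: "bdd_below S" using lower by (intro bdd_belowI)
  define l where "l = Inf S"
  have N0: "0 \<le> N v" for v by (simp add: N_def sum_nonneg)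
  have lS: "bilform {..<n} G v v \<le> l * N v" for v
  proof (cases "N v = 0")
    case True
    moreover have "bilform {..<n} G v v \<le> T * N v" using \<open>T \<in> S\<close> unfolding S_def by blast
    ultimately show ?thesis by simp
  next
    case False
    then have "N v > 0" using N0[of v] by simp
    have "bilform {..<n} G v v / N v \<le> l"
      unfolding l_def
    proof (rule cInf_greatest)
      show "S \<noteq> {}" using \<open>T \<in> S\<close> by blast
      fix t assume "t \<in> S"
      then show "bilform {..<n} G v v / N v \<le> t" using \<open>N v > 0\<close> by (simp add: S_def pos_divide_le_eq)
    qed
    then show ?thesis using \<open>N v > 0\<close> by (simp add: pos_divide_le_eq)
  qed
  show ?thesis
  proof (rule ccontr)
    assume no: "\<not> ?thesis"
    have "\<exists>K>0. \<forall>v. (\<Sum>p\<in>{..<n}. (\<Sum>b\<in>{..<n}. (if b = p then 1 else 0) * v b)\<^sup>2) \<le> K * bilform {..<n} (M l) v v"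
    proof (rule functionals_dominated_by_psd)
      show "M l a b = M l b a" if "a \<in> {..<n}" "b \<in> {..<n}" for a b using that sym by (simp add: M_def)
      show "0 \<le> bilform {..<n} (M l) v v" for v using lS[of v] by (simp add: Q)
      fix p v assume p: "p \<in> {..<n}" and ker: "\<And>u. bilform {..<n} (M l) u v = 0"
      have "(\<Sum>b<n. M l a b * v b) = 0" if "a < n" for a
      proof -
        have "bilform {..<n} (M l) (\<lambda>c. if c = a then 1 else 0) v = (\<Sum>c<n. if c = a then \<Sum>b<n. M l c b * v b else 0)"
          unfolding bilform_col by (rule sum.cong) auto
        then show ?thesis using ker that by (simp add: sum.delta)
      qed
      then have "\<forall>a<n. (\<Sum>b<n. G a b * v b) = l * v a" by (simp add: row)
      then have v0: "\<forall>a<n. v a = 0" using no by blast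
      then show "(\<Sum>b\<in>{..<n}. (if b = p then 1 else 0) * v b) = 0" by simp
    qed simp_all
    then obtain K where K: "K > 0"
      "\<And>v. (\<Sum>p\<in>{..<n}. (\<Sum>b\<in>{..<n}. (if b = p then 1 else 0) * v b)\<^sup>2) \<le> K * bilform {..<n} (M l) v v" by blast
    have "N v \<le> K * (l * N v - bilform {..<n} G v v)" for v
    proof -
      have "(\<Sum>b\<in>{..<n}. (if b = p then 1 else 0) * v b) = v p" if "p \<in> {..<n}" for p
      proof -
        have "(\<Sum>b<n. (if b = p then 1 else 0) * v b) = (\<Sum>b<n. if b = p then v b else 0)" by (rule sum.cong) auto
        then show ?thesis using that by (simp add: sum.delta)
      qed
      then show ?thesis using K(2)[of v] by (simp add: N_def[of v] Q)
    qed
    then have "bilform {..<n} G v v \<le> (l - 1 / K) * N v" for v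
      using K(1) by (simp add: field_simps)
    then have "l - 1 / K \<in> S" by (simp add: S_def)
    then have "l \<le> l - 1 / K" unfolding l_def by (intro cInf_lower bdd)
    then show False using K(1) by simp
  qed
qed

lemma eigenspace_subspace:
  fixes G :: "real mat"
  assumes G: "G \<in> carrier_mat n n"
  shows "VectorSpace.subspace class_ring {v \<in> carrier_vec n. G *\<^sub>v v = l \<cdot>\<^sub>v v} (module_vec TYPE(real) n)"
proof -
  have vs: "vectorspace class_ring (module_vec TYPE(real) n)" by (rule vec_vs)
  have "submodule class_ring {v \<in> carrier_vec n. G *\<^sub>v v = l \<cdot>\<^sub>v v} (module_vec TYPE(real) n)"
  proof (rule submodule.intro)
    show "module class_ring (module_vec TYPE(real) n)" by (rule vec_module)
  qed (use G in \<open>auto simp: module_vec_simps mult_add_distrib_mat_vec[OF G] mult_mat_vec[OF G]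
      smult_add_distrib_vec smult_smult_assoc mult.commute\<close>)
  with vs show ?thesis unfolding subspace_def by blast
qed

text \<open>
  Schur's lemma: an eigenspace of \<open>G\<close> is invariant under every \<open>X i\<close>, and so is its orthogonal
  complement because the \<open>X i\<close> are symmetric.
\<close>
lemma irreducible_commutant_scalar:
  fixes G :: "real mat"
  assumes irr: "irreducible_tuple n X" and n: "0 < n" and G: "G \<in> carrier_mat n n"
    and Gs: "transpose_mat G = G" and comm: "\<And>i. G * X i = X i * G"
  shows "\<exists>l. G = l \<cdot>\<^sub>m 1\<^sub>m n"
proof -
  have Xs: "X \<in> sym_tuples n" using irr by (simp add: irreducible_tuple_def)
  note Xi = sym_tuplesD[OF Xs]
  have Gsym: "G $$ (a, b) = G $$ (b, a)" if "a < n" "b < n" for a b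
  proof -
    have "transpose_mat G $$ (a, b) = G $$ (b, a)" using that G by simp
    then show ?thesis by (simp only: Gs)
  qed
  obtain l v where lv: "\<exists>a<n. v a \<noteq> 0" "\<forall>a<n. (\<Sum>b<n. G $$ (a, b) * v b) = l * v a"
    using symmetric_has_eigenvector[OF n, of "\<lambda>a b. G $$ (a, b)"] Gsym by blast
  let ?W = "{w \<in> carrier_vec n. G *\<^sub>v w = l \<cdot>\<^sub>v w}"
  have "reducing_subspace n X ?W"
    unfolding reducing_subspace_def
  proof (intro conjI allI ballI eigenspace_subspace[OF G])
    show inv: "X i *\<^sub>v w \<in> ?W" if w: "w \<in> ?W" for i w
    proof -
      have wc: "w \<in> carrier_vec n" using w by simp
      have "G *\<^sub>v (X i *\<^sub>v w) = (G * X i) *\<^sub>v w" by (rule assoc_mult_mat_vec[OF G Xi(1) wc, symmetric])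
      also have "\<dots> = X i *\<^sub>v (G *\<^sub>v w)" unfolding comm by (rule assoc_mult_mat_vec[OF Xi(1) G wc])
      also have "\<dots> = l \<cdot>\<^sub>v (X i *\<^sub>v w)" using w mult_mat_vec[OF Xi(1) wc] by simp
      finally show ?thesis using mult_mat_vec_carrier[OF Xi(1) wc] by simp
    qed
    show "X i *\<^sub>v u \<in> vec_module.orthogonal_complement n ?W"
      if u: "u \<in> vec_module.orthogonal_complement n ?W" for i u
    proof -
      have uc: "u \<in> carrier_vec n" and ort: "\<And>w. w \<in> ?W \<Longrightarrow> u \<bullet> w = 0"
        using u unfolding vec_module.orthogonal_complement_def by auto
      have "(X i *\<^sub>v u) \<bullet> w = 0" if w: "w \<in> ?W" for w
      proof -
        have wc: "w \<in> carrier_vec n" using w by simp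
        have "(X i *\<^sub>v u) \<bullet> w = (transpose_mat (X i) *\<^sub>v u) \<bullet> w" by (simp add: Xi(2))
        also have "\<dots> = u \<bullet> (X i *\<^sub>v w)" by (rule transpose_vec_mult_scalar[OF Xi(1) wc uc])
        also have "\<dots> = 0" by (rule ort[OF inv[OF w]])
        finally show ?thesis .
      qed
      then show ?thesis
        unfolding vec_module.orthogonal_complement_def using mult_mat_vec_carrier[OF Xi(1) uc] by simp
    qed
  qed
  then have "?W = {0\<^sub>v n} \<or> ?W = carrier_vec n" using irr unfolding irreducible_tuple_def by blast
  moreover have "?W \<noteq> {0\<^sub>v n}"
  proof -
    have "G *\<^sub>v Matrix.vec n v = l \<cdot>\<^sub>v Matrix.vec n v"
    proof (rule eq_vecI)
      fix a assume "a < dim_vec (l \<cdot>\<^sub>v Matrix.vec n v)"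
      then show "(G *\<^sub>v Matrix.vec n v) $ a = (l \<cdot>\<^sub>v Matrix.vec n v) $ a"
        using lv(2) G by (simp add: scalar_prod_def lessThan_atLeast0)
    qed (use G in simp)
    then have "Matrix.vec n v \<in> ?W" by simp
    moreover have "Matrix.vec n v \<noteq> 0\<^sub>v n"
    proof
      assume z: "Matrix.vec n v = 0\<^sub>v n"
      obtain a where "a < n" "v a \<noteq> 0" using lv(1) by blast
      then show False using arg_cong[OF z, of "\<lambda>x. x $ a"] by simp
    qed
    ultimately show ?thesis by blast
  qed
  ultimately have W: "?W = carrier_vec n" by blast
  have "G = l \<cdot>\<^sub>m 1\<^sub>m n"
  proof (rule eq_matI)
    fix a b assume "a < dim_row (l \<cdot>\<^sub>m 1\<^sub>m n :: real mat)" "b < dim_col (l \<cdot>\<^sub>m 1\<^sub>m n :: real mat)"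
    then have ab: "a < n" "b < n" by simp_all
    have "G *\<^sub>v unit_vec n b = l \<cdot>\<^sub>v unit_vec n b" using W unit_vec_carrier[of n b] by blast
    then have "(G *\<^sub>v unit_vec n b) $ a = (l \<cdot>\<^sub>v unit_vec n b) $ a" by simp
    then show "G $$ (a, b) = (l \<cdot>\<^sub>m 1\<^sub>m n) $$ (a, b)"
      using ab G by (simp add: index_mult_mat_vec)
  qed (use G in auto)
  then show ?thesis by blast
qed

text \<open>
  Add columns one at a time; fewer than \<open>m\<close> columns have a common orthogonal vector by elimination.
\<close>
lemma isometry_extends_to_orthogonal:
  fixes W :: "real mat"
  assumes W: "W \<in> carrier_mat m n" and iso: "transpose_mat W * W = 1\<^sub>m n" and nm: "n \<le> m"
  shows "\<exists>U\<in>carrier_mat m m. transpose_mat U * U = 1\<^sub>m m \<and> (\<forall>a<m. \<forall>b<n. U $$ (a, b) = W $$ (a, b))"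
proof -
  have ent: "(transpose_mat C * C) $$ (b, b') = (\<Sum>a<m. C $$ (a, b) * C $$ (a, b'))"
    if "C \<in> carrier_mat m k" "b < k" "b' < k" for C :: "real mat" and k b b'
    using mat_mult_entry[of "transpose_mat C" k m C k b b'] that by simp
  have "\<exists>U\<in>carrier_mat m (n + k). transpose_mat U * U = 1\<^sub>m (n + k) \<and> (\<forall>a<m. \<forall>b<n. U $$ (a, b) = W $$ (a, b))"
    if "n + k \<le> m" for k
    using that
  proof (induction k)
    case 0
    then show ?case using W iso by auto
  next
    case (Suc k)
    then obtain U where U: "U \<in> carrier_mat m (n + k)" "transpose_mat U * U = 1\<^sub>m (n + k)"
      "\<forall>a<m. \<forall>b<n. U $$ (a, b) = W $$ (a, b)" by auto
    obtain v where v: "\<exists>a\<in>{..<m}. v a \<noteq> 0" "\<forall>b\<in>{..<n + k}. (\<Sum>a<m. U $$ (a, b) * v a) = 0"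
      using homogeneous_system_nonzero_solution[of "{..<n + k}" "{..<m}" "\<lambda>b a. U $$ (a, b)"] Suc.prems by auto
    define s where "s = (\<Sum>a<m. (v a)\<^sup>2)"
    have s: "s > 0" unfolding s_def using v(1) by (auto intro!: sum_pos2)
    define U' where "U' = mat m (Suc (n + k)) (\<lambda>(a, b). if b < n + k then U $$ (a, b) else v a / sqrt s)"
    have U': "U' \<in> carrier_mat m (Suc (n + k))" by (simp add: U'_def)
    have UU: "(\<Sum>a<m. U $$ (a, b) * U $$ (a, b')) = (if b = b' then 1 else 0)" if "b < n + k" "b' < n + k" for b b'
      using ent[OF U(1) that] U(2) that by simp
    have Uv: "(\<Sum>a<m. U $$ (a, b) * (v a / sqrt s)) = 0" "(\<Sum>a<m. v a / sqrt s * U $$ (a, b)) = 0" if "b < n + k" for b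
    proof -
      have "(\<Sum>a<m. U $$ (a, b) * (v a / sqrt s)) = (\<Sum>a<m. U $$ (a, b) * v a) / sqrt s"
        by (simp add: sum_divide_distrib)
      then show "(\<Sum>a<m. U $$ (a, b) * (v a / sqrt s)) = 0" using v(2) that by simp
      then show "(\<Sum>a<m. v a / sqrt s * U $$ (a, b)) = 0" by (simp add: mult.commute)
    qed
    have vv: "(\<Sum>a<m. v a / sqrt s * (v a / sqrt s)) = 1"
    proof -
      have "(\<Sum>a<m. v a / sqrt s * (v a / sqrt s)) = (\<Sum>a<m. (v a)\<^sup>2) / s"
        using s by (simp add: sum_divide_distrib power2_eq_square)
      then show ?thesis using s by (simp add: s_def)
    qed
    have "transpose_mat U' * U' = 1\<^sub>m (Suc (n + k))"
    proof (rule eq_matI)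
      fix b b' assume "b < dim_row (1\<^sub>m (Suc (n + k)) :: real mat)" "b' < dim_col (1\<^sub>m (Suc (n + k)) :: real mat)"
      then have bb: "b < Suc (n + k)" "b' < Suc (n + k)" by simp_all
      have "(\<Sum>a<m. U' $$ (a, b) * U' $$ (a, b')) = (if b = b' then 1 else 0)"
        using bb UU[of b b'] Uv[of b] Uv[of b'] vv
        by (cases "b < n + k"; cases "b' < n + k") (simp_all add: U'_def less_Suc_eq)
      then show "(transpose_mat U' * U') $$ (b, b') = 1\<^sub>m (Suc (n + k)) $$ (b, b')"
        using ent[OF U' bb] bb by simp
    qed (use U' in auto)
    moreover have "\<forall>a<m. \<forall>b<n. U' $$ (a, b) = W $$ (a, b)" using U(3) by (simp add: U'_def)
    ultimately show ?case using U' by auto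
  qed
  from this[of "m - n"] nm show ?thesis by simp
qed

lemma isometry_dims:
  fixes W :: "real mat"
  assumes W: "W \<in> carrier_mat m n" and iso: "transpose_mat W * W = 1\<^sub>m n"
  shows "n \<le> m"
proof (rule ccontr)
  assume "\<not> ?thesis"
  then obtain v where v: "\<exists>b\<in>{..<n}. v b \<noteq> 0" "\<forall>a\<in>{..<m}. (\<Sum>b<n. W $$ (a, b) * v b) = 0"
    using homogeneous_system_nonzero_solution[of "{..<m}" "{..<n}" "\<lambda>a b. W $$ (a, b)"] by auto
  let ?v = "Matrix.vec n v"
  have vc: "?v \<in> carrier_vec n" by simp
  have "W *\<^sub>v ?v = 0\<^sub>v m"
    using W v(2) by (auto simp: scalar_prod_def lessThan_atLeast0 intro!: eq_vecI)
  moreover have t: "transpose_mat W \<in> carrier_mat n m" using W by simp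
  moreover have "?v = transpose_mat W *\<^sub>v (W *\<^sub>v ?v)"
    using assoc_mult_mat_vec[OF t W vc] by (simp add: iso)
  moreover have "transpose_mat W *\<^sub>v 0\<^sub>v m = 0\<^sub>v n"
    using W by (auto intro!: eq_vecI simp: scalar_prod_def)
  ultimately have "?v = 0\<^sub>v n" by (simp only:)
  then have z: "Matrix.vec n v = 0\<^sub>v n" .
  obtain b where "b < n" "v b \<noteq> 0" using v(1) by auto
  then show False using arg_cong[OF z, of "\<lambda>x. x $ b"] by simp
qed

section \<open>Free extreme points and the Caratheodory decomposition\<close>

text \<open>
  The entry depends only on one column of \<open>B\<close> and one of \<open>C\<close>, which is how blocks of a congruence by
  an orthogonal matrix are identified with congruences by groups of its columns.
\<close>
lemma congruence_entry:
  fixes Y :: "real mat"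
  assumes Y: "Y \<in> carrier_mat m m" and B: "B \<in> carrier_mat m n" and C: "C \<in> carrier_mat m k"
    and b: "b < n" and c: "c < k"
  shows "(transpose_mat B * Y * C) $$ (b, c) = (\<Sum>a'<m. (\<Sum>a<m. B $$ (a, b) * Y $$ (a, a')) * C $$ (a', c))"
proof -
  have t: "transpose_mat B \<in> carrier_mat n m" using B by simp
  have e: "(transpose_mat B * Y) $$ (b, a') = (\<Sum>a<m. B $$ (a, b) * Y $$ (a, a'))" if "a' < m" for a'
    using mat_mult_entry[OF t Y b that] B b by simp
  show ?thesis
    unfolding mat_mult_entry[OF mult_carrier_mat[OF t Y] C b c] by (rule sum.cong) (auto simp: e)
qed

text \<open>
  Complete \<open>W\<close> to an orthogonal matrix with further columns \<open>W'\<close>. The off-diagonal blocks of the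
  conjugated tuple are \<open>W\<^sup>T Y W' = X W\<^sup>T W' = 0\<close> and its transpose, and the last block is the compression
  of \<open>Y\<close> to the range of \<open>W'\<close>.
\<close>
lemma isometric_intertwiner_splits_summand:
  assumes A: "A \<in> sym_tuples d" and X: "X \<in> sym_tuples n" and Y: "Y \<in> free_spec d A m"
    and W: "W \<in> carrier_mat m n" and iso: "transpose_mat W * W = 1\<^sub>m n"
    and YW: "\<And>i. Y i * W = W * X i"
  shows "(m = n \<and> unitarily_equiv n Y X) \<or> (m > n \<and> (\<exists>Z\<in>free_spec d A (m - n).
    unitarily_equiv m Y (direct_sum n X (m - n) Z)))"
proof -
  have Ys: "Y \<in> sym_tuples m" using Y by (simp add: free_spec_def)
  note Yi = sym_tuplesD[OF Ys] and Xi = sym_tuplesD[OF X]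
  have t: "transpose_mat W \<in> carrier_mat n m" using W by simp
  have WYW: "transpose_mat W * Y i * W = X i" for i
  proof -
    have "transpose_mat W * Y i * W = transpose_mat W * (W * X i)"
      unfolding YW[symmetric] by (rule assoc_mult_mat[OF t Yi(1) W])
    also have "\<dots> = transpose_mat W * W * X i" by (rule assoc_mult_mat[OF t W Xi(1), symmetric])
    finally show ?thesis using left_mult_one_mat[OF Xi(1)] by (simp add: iso)
  qed
  have WY: "transpose_mat W * Y i = X i * transpose_mat W" for i
    using arg_cong[OF YW[of i], of transpose_mat]
    unfolding transpose_mult[OF Yi(1) W] transpose_mult[OF W Xi(1)] Yi(2) Xi(2) .
  have "n \<le> m" by (rule isometry_dims[OF W iso])
  then consider "m = n" | "m > n" by linarith
  then show ?thesis
  proof cases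
    case 1
    then have "unitarily_equiv n Y X"
      unfolding unitarily_equiv_def using W iso WYW by blast
    with 1 show ?thesis by blast
  next
    case 2
    obtain U where U: "U \<in> carrier_mat m m" "transpose_mat U * U = 1\<^sub>m m"
      "\<And>a b. a < m \<Longrightarrow> b < n \<Longrightarrow> U $$ (a, b) = W $$ (a, b)"
      using isometry_extends_to_orthogonal[OF W iso \<open>n \<le> m\<close>] by blast
    define W' where "W' = mat m (m - n) (\<lambda>(a, b). U $$ (a, n + b))"
    have W': "W' \<in> carrier_mat m (m - n)" by (simp add: W'_def)
    have t': "transpose_mat W' \<in> carrier_mat (m - n) m" using W' by simp
    have UU: "(\<Sum>a<m. U $$ (a, b) * U $$ (a, b')) = (if b = b' then 1 else 0)" if "b < m" "b' < m" for b b'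
      using mat_mult_entry[of "transpose_mat U" m m U m b b'] U that by simp
    have iso': "transpose_mat W' * W' = 1\<^sub>m (m - n)"
    proof (rule eq_matI)
      fix b c assume "b < dim_row (1\<^sub>m (m - n) :: real mat)" "c < dim_col (1\<^sub>m (m - n) :: real mat)"
      then have bc: "b < m - n" "c < m - n" by simp_all
      have "(transpose_mat W' * W') $$ (b, c) = (\<Sum>a<m. U $$ (a, n + b) * U $$ (a, n + c))"
        unfolding mat_mult_entry[OF t' W' bc] using bc by (intro sum.cong) (auto simp: W'_def)
      then show "(transpose_mat W' * W') $$ (b, c) = 1\<^sub>m (m - n) $$ (b, c)"
        using UU[of "n + b" "n + c"] bc by simp
    qed (use W' in auto)
    have orth: "transpose_mat W * W' = 0\<^sub>m n (m - n)"
    proof (rule eq_matI)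
      fix b c assume "b < dim_row (0\<^sub>m n (m - n) :: real mat)" "c < dim_col (0\<^sub>m n (m - n) :: real mat)"
      then have bc: "b < n" "c < m - n" by simp_all
      have "(transpose_mat W * W') $$ (b, c) = (\<Sum>a<m. U $$ (a, b) * U $$ (a, n + c))"
        unfolding mat_mult_entry[OF t W' bc] using bc W by (intro sum.cong) (auto simp: W'_def U(3))
      then show "(transpose_mat W * W') $$ (b, c) = 0\<^sub>m n (m - n) $$ (b, c)"
        using UU[of b "n + c"] bc by simp
    qed (use W W' in auto)
    have orth': "transpose_mat W' * W = 0\<^sub>m (m - n) n"
      using arg_cong[OF orth, of transpose_mat] transpose_mult[OF t W'] by simp
    define Z where "Z = (\<lambda>i. transpose_mat W' * Y i * W')"
    have Z: "Z \<in> free_spec d A (m - n)"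
      unfolding Z_def by (rule compression_in_free_spec[OF A Y W' iso'])
    have Zi: "Z i \<in> carrier_mat (m - n) (m - n)" for i
      using Z by (simp add: free_spec_def sym_tuples_def)
    have o1: "transpose_mat W * Y i * W' = 0\<^sub>m n (m - n)" for i
    proof -
      have "transpose_mat W * Y i * W' = X i * (transpose_mat W * W')"
        unfolding WY by (rule assoc_mult_mat[OF Xi(1) t W'])
      then show ?thesis by (simp add: orth right_mult_zero_mat[OF Xi(1)])
    qed
    have o2: "transpose_mat W' * Y i * W = 0\<^sub>m (m - n) n" for i
    proof -
      have "transpose_mat W' * Y i * W = transpose_mat W' * (W * X i)"
        unfolding YW[symmetric] by (rule assoc_mult_mat[OF t' Yi(1) W])
      also have "\<dots> = transpose_mat W' * W * X i" by (rule assoc_mult_mat[OF t' W Xi(1), symmetric])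
      finally show ?thesis by (simp add: orth' left_mult_zero_mat[OF Xi(1)])
    qed
    have "transpose_mat U * Y i * U = direct_sum n X (m - n) Z i" for i
    proof (rule eq_matI)
      have ds: "direct_sum n X (m - n) Z i = four_block_mat (X i) (0\<^sub>m n (m - n)) (0\<^sub>m (m - n) n) (Z i)"
        by (simp add: direct_sum_def)
      have dm: "dim_row (X i) = n" "dim_col (X i) = n" "dim_row (Z i) = m - n" "dim_col (Z i) = m - n"
        using Xi(1)[of i] Zi[of i] by auto
      show "dim_row (transpose_mat U * Y i * U) = dim_row (direct_sum n X (m - n) Z i)"
        "dim_col (transpose_mat U * Y i * U) = dim_col (direct_sum n X (m - n) Z i)"
        using U(1) 2 by (simp_all add: ds dm)
      fix b c assume "b < dim_row (direct_sum n X (m - n) Z i)" "c < dim_col (direct_sum n X (m - n) Z i)"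
      then have bc: "b < m" "c < m" using 2 by (simp_all add: ds dm)
      have e: "(transpose_mat U * Y i * U) $$ (b, c)
        = (transpose_mat B * Y i * C) $$ (b', c')"
        if B: "B \<in> carrier_mat m k" and C: "C \<in> carrier_mat m l" and bc': "b' < k" "c' < l"
          and eq: "\<And>a. a < m \<Longrightarrow> B $$ (a, b') = U $$ (a, b)" "\<And>a. a < m \<Longrightarrow> C $$ (a, c') = U $$ (a, c)"
        for B C b' c' k l
        unfolding congruence_entry[OF Yi(1) U(1) U(1) bc] congruence_entry[OF Yi(1) B C bc']
        by (simp add: eq)
      show "(transpose_mat U * Y i * U) $$ (b, c) = direct_sum n X (m - n) Z i $$ (b, c)"
      proof (cases "b < n"; cases "c < n")
        assume h: "b < n" "c < n"
        then show ?thesis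
          using e[OF W W h] U(3) dm WYW[of i] by (simp add: ds)
      next
        assume h: "b < n" "\<not> c < n"
        then have c': "c - n < m - n" using bc by simp
        then show ?thesis
          using e[OF W W' h(1) c'] U(3) h dm o1[of i] bc by (simp add: ds W'_def)
      next
        assume h: "\<not> b < n" "c < n"
        then have b': "b - n < m - n" using bc by simp
        then show ?thesis
          using e[OF W' W b' h(2)] U(3) h dm o2[of i] bc by (simp add: ds W'_def)
      next
        assume h: "\<not> b < n" "\<not> c < n"
        then have b': "b - n < m - n" "c - n < m - n" using bc by simp_all
        have "(transpose_mat U * Y i * U) $$ (b, c) = Z i $$ (b - n, c - n)"
          unfolding Z_def using h bc b' by (intro e[OF W' W']) (auto simp: W'_def)
        then show ?thesis using h dm b' bc by (simp add: ds)
      qed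
    qed
    then have "unitarily_equiv m Y (direct_sum n X (m - n) Z)"
      unfolding unitarily_equiv_def using U(1,2) by blast
    with 2 Z show ?thesis by blast
  qed
qed

text \<open>
  By rigidity each \<open>V j\<close> intertwines, so \<open>(V j)\<^sup>T V j\<close> commutes with the irreducible tuple \<open>X\<close> and equals \<open>l I\<close>
  with \<open>l > 0\<close>. Then \<open>V j / sqrt l\<close> is an isometry to which the preceding lemma applies.
\<close>
lemma irreducible_rigid_imp_free_extreme:
  assumes A: "A \<in> sym_tuples d" and n: "1 \<le> n" and X: "X \<in> free_spec d A n"
    and irr: "irreducible_tuple n X" and rig: "rigid d A n X"
  shows "free_extreme d A n X"
  unfolding free_extreme_def
proof (intro conjI X allI impI)
  fix r :: nat and m Y V j
  assume h: "(\<forall>j<r. 1 \<le> m j \<and> Y j \<in> free_spec d A (m j) \<and>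
               V j \<in> carrier_mat (m j) n \<and> V j \<noteq> 0\<^sub>m (m j) n) \<and>
        mat_sum n n {..<r} (\<lambda>j. transpose_mat (V j) * V j) = 1\<^sub>m n \<and>
        (\<forall>i. X i = mat_sum n n {..<r} (\<lambda>j. transpose_mat (V j) * Y j i * V j))"
    and j: "j < r"
  have Xs: "X \<in> sym_tuples n" using X by (simp add: free_spec_def)
  have Y: "\<And>j. j < r \<Longrightarrow> Y j \<in> free_spec d A (m j)" and V: "\<And>j. j < r \<Longrightarrow> V j \<in> carrier_mat (m j) n"
    and one: "mat_sum n n {..<r} (\<lambda>j. transpose_mat (V j) * V j) = 1\<^sub>m n"
    and Xeq: "\<And>i. X i = mat_sum n n {..<r} (\<lambda>j. transpose_mat (V j) * Y j i * V j)"
    and nz: "V j \<noteq> 0\<^sub>m (m j) n"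
    using h j by blast+
  have Ys: "Y j \<in> sym_tuples (m j)" using Y[OF j] by (simp add: free_spec_def)
  note Yi = sym_tuplesD[OF Ys] and Xi = sym_tuplesD[OF Xs] and Vj = V[OF j]
  have t: "transpose_mat (V j) \<in> carrier_mat n (m j)" using Vj by simp
  have YV: "Y j i * V j = V j * X i" for i
    by (rule rigid_convex_combination_intertwines[OF A Xs rig Y V one Xeq j])
  have VY: "transpose_mat (V j) * Y j i = X i * transpose_mat (V j)" for i
    using arg_cong[OF YV[of i], of transpose_mat]
    unfolding transpose_mult[OF Yi(1) Vj] transpose_mult[OF Vj Xi(1)] Yi(2) Xi(2) .
  let ?G = "transpose_mat (V j) * V j"
  have G: "?G \<in> carrier_mat n n" by (rule mult_carrier_mat[OF t Vj])
  have Gs: "transpose_mat ?G = ?G" using transpose_mult[OF t Vj] by simp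
  have comm: "?G * X i = X i * ?G" for i
  proof -
    have "?G * X i = transpose_mat (V j) * (Y j i * V j)"
      unfolding YV by (rule assoc_mult_mat[OF t Vj Xi(1)])
    also have "\<dots> = X i * transpose_mat (V j) * V j"
      unfolding VY[symmetric] by (rule assoc_mult_mat[OF t Yi(1) Vj, symmetric])
    also have "\<dots> = X i * ?G" by (rule assoc_mult_mat[OF Xi(1) t Vj])
    finally show ?thesis .
  qed
  obtain l where l: "?G = l \<cdot>\<^sub>m 1\<^sub>m n"
    using irreducible_commutant_scalar[OF irr _ G Gs comm] n by auto
  have "l > 0"
  proof -
    obtain a q where aq: "a < m j" "q < n" "V j $$ (a, q) \<noteq> 0"
      using nz Vj by (auto simp: mat_eq_iff)
    have "?G $$ (q, q) = (\<Sum>a<m j. (V j $$ (a, q))\<^sup>2)"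
      unfolding mat_mult_entry[OF t Vj aq(2,2)] using Vj aq(2) by (intro sum.cong) (auto simp: power2_eq_square)
    also have "\<dots> > 0" using aq by (intro sum_pos2[of _ a]) auto
    finally show ?thesis using aq(2) by (simp add: l)
  qed
  define s where "s = 1 / sqrt l"
  have s: "s * s * l = 1" using \<open>l > 0\<close> by (simp add: s_def)
  let ?W = "s \<cdot>\<^sub>m V j"
  have W: "?W \<in> carrier_mat (m j) n" using Vj by simp
  have Wt: "transpose_mat ?W = s \<cdot>\<^sub>m transpose_mat (V j)" by (rule eq_matI) auto
  have "transpose_mat ?W * ?W = s \<cdot>\<^sub>m (s \<cdot>\<^sub>m ?G)"
    unfolding Wt mult_smult_assoc_mat[OF t W] mult_smult_distrib[OF t Vj] ..
  also have "\<dots> = 1\<^sub>m n" unfolding l by (rule eq_matI) (use s in auto)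
  finally have iso: "transpose_mat ?W * ?W = 1\<^sub>m n" .
  have YW: "Y j i * ?W = ?W * X i" for i
    unfolding mult_smult_distrib[OF Yi(1) Vj] mult_smult_assoc_mat[OF Vj Xi(1)] YV ..
  show "(m j = n \<and> unitarily_equiv n (Y j) X) \<or>
                   (m j > n \<and> (\<exists>Z \<in> free_spec d A (m j - n).
                      unitarily_equiv (m j) (Y j) (direct_sum n X (m j - n) Z)))"
    by (rule isometric_intertwiner_splits_summand[OF A Xs Y[OF j] W iso YW])
qed

definition block_offset :: "(nat \<Rightarrow> nat) \<Rightarrow> nat \<Rightarrow> nat" where
  "block_offset m j = (\<Sum>l<j. m l)"

lemma block_offset_less: "j < r \<Longrightarrow> b < m j \<Longrightarrow> block_offset m j + b < block_offset m r"
proof (induction r)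
  case (Suc r)
  then show ?case by (cases "j = r") (auto simp: block_offset_def less_Suc_eq)
qed simp

lemma sum_blocks:
  fixes f :: "nat \<Rightarrow> real"
  shows "(\<Sum>e<block_offset m r. f e) = (\<Sum>j<r. \<Sum>b<m j. f (block_offset m j + b))"
proof (induction r)
  case (Suc r)
  have "block_offset m (Suc r) = block_offset m r + m r" by (simp add: block_offset_def)
  then show ?case using Suc by (simp add: sum_lessThan_add)
qed (simp add: block_offset_def)

lemma diag_block_mat_entries:
  fixes M :: "nat \<Rightarrow> real mat"
  assumes "\<And>j. j < r \<Longrightarrow> M j \<in> carrier_mat (m j) (m j)"
  shows "diag_block_mat (map M [0..<r]) \<in> carrier_mat (block_offset m r) (block_offset m r) \<and>
    (\<forall>j<r. \<forall>l<r. \<forall>b<m j. \<forall>c<m l. diag_block_mat (map M [0..<r]) $$ (block_offset m j + b, block_offset m l + c)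
      = (if j = l then M j $$ (b, c) else 0))"
  using assms
proof (induction r)
  case 0
  then show ?case by (simp add: block_offset_def)
next
  case (Suc r)
  let ?D = "diag_block_mat (map M [0..<r])" and ?o = "block_offset m"
  have D: "?D \<in> carrier_mat (?o r) (?o r)"
    and ent: "\<And>j l b c. j < r \<Longrightarrow> l < r \<Longrightarrow> b < m j \<Longrightarrow> c < m l \<Longrightarrow>
      ?D $$ (?o j + b, ?o l + c) = (if j = l then M j $$ (b, c) else 0)"
    using Suc by auto
  have Mr: "M r \<in> carrier_mat (m r) (m r)" using Suc.prems by simp
  have eq: "diag_block_mat (map M [0..<Suc r]) = four_block_mat ?D (0\<^sub>m (?o r) (m r)) (0\<^sub>m (m r) (?o r)) (M r)"
    using D Mr by (simp add: diag_block_mat_last Let_def)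
  have oS: "?o (Suc r) = ?o r + m r" by (simp add: block_offset_def)
  have dm: "dim_row ?D = ?o r" "dim_col ?D = ?o r" "dim_row (M r) = m r" "dim_col (M r) = m r"
    using D Mr by auto
  have "four_block_mat ?D (0\<^sub>m (?o r) (m r)) (0\<^sub>m (m r) (?o r)) (M r) $$ (?o j + b, ?o l + c)
      = (if j = l then M j $$ (b, c) else 0)"
    if jl: "j < Suc r" "l < Suc r" "b < m j" "c < m l" for j l b c
  proof (cases "j < r"; cases "l < r")
    assume h: "j < r" "l < r"
    then show ?thesis using block_offset_less[of j r b m] block_offset_less[of l r c m] jl ent[OF h jl(3,4)] dm by simp
  next
    assume h: "j < r" "\<not> l < r"
    then have lr: "l = r" using jl by simp
    show ?thesis
      unfolding lr using block_offset_less[of j r b m] h(1) jl(3) jl(4)[unfolded lr] dm by simp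
  next
    assume h: "\<not> j < r" "l < r"
    then have jr: "j = r" using jl by simp
    show ?thesis
      unfolding jr using block_offset_less[of l r c m] h(2) jl(4) jl(3)[unfolded jr] dm by simp
  next
    assume h: "\<not> j < r" "\<not> l < r"
    then have "j = r" "l = r" using jl by simp_all
    then show ?thesis using jl dm by simp
  qed
  then show ?case unfolding eq oS using D Mr by auto
qed

text \<open>
  The columns of \<open>U\<close> that belong to block \<open>j\<close> form an isometry \<open>E j\<close> that intertwines \<open>Y\<close> and \<open>Z j\<close>. So
  \<open>Z j\<close> inherits rigidity from \<open>Y\<close>, and \<open>Y\<close> is the sum of the \<open>E j * Z j * (E j)\<^sup>T\<close>. Restricting this sum to the
  first \<open>n\<close> coordinates expresses \<open>X\<close>, with \<open>V j\<close> the transpose of the upper part of \<open>E j\<close>.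
\<close>
lemma block_decomposition_of_arveson_dilation:
  assumes A: "A \<in> sym_tuples d" and Y: "Y \<in> free_spec d A (n + k)" and rig: "rigid d A (n + k) Y"
    and top: "\<And>i q q'. q < n \<Longrightarrow> q' < n \<Longrightarrow> Y i $$ (q, q') = X i $$ (q, q')" and X: "X \<in> tuples n n"
    and U: "U \<in> carrier_mat (n + k) (n + k)" and orth: "transpose_mat U * U = 1\<^sub>m (n + k)"
    and Z: "\<And>j. j < r \<Longrightarrow> 1 \<le> m j \<and> Z j \<in> sym_tuples (m j) \<and> irreducible_tuple (m j) (Z j)"
    and dec: "\<And>i. transpose_mat U * Y i * U = diag_block_mat (map (\<lambda>j. Z j i) [0..<r])"
  shows "(\<forall>j<r. free_extreme d A (m j) (Z j)) \<and>
    (\<exists>V. (\<forall>j<r. V j \<in> carrier_mat (m j) n) \<and>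
       (\<forall>i. X i = mat_sum n n {..<r} (\<lambda>j. transpose_mat (V j) * Z j i * V j)) \<and>
       mat_sum n n {..<r} (\<lambda>j. transpose_mat (V j) * V j) = 1\<^sub>m n) \<and> (\<Sum>j<r. m j) = n + k"
proof -
  let ?N = "n + k" and ?o = "block_offset m"
  have Ys: "Y \<in> sym_tuples ?N" using Y by (simp add: free_spec_def)
  note Yi = sym_tuplesD[OF Ys]
  have Ut: "transpose_mat U \<in> carrier_mat ?N ?N" using U by simp
  have UUt: "U * transpose_mat U = 1\<^sub>m ?N" by (rule mat_mult_left_right_inverse[OF Ut U orth])
  have Zc: "Z j i \<in> carrier_mat (m j) (m j)" if "j < r" for j i
    using Z[OF that] by (simp add: sym_tuples_def)
  let ?D = "\<lambda>i. diag_block_mat (map (\<lambda>j. Z j i) [0..<r])"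
  have De: "?D i \<in> carrier_mat (?o r) (?o r)"
    "\<And>j l b c. j < r \<Longrightarrow> l < r \<Longrightarrow> b < m j \<Longrightarrow> c < m l \<Longrightarrow>
      ?D i $$ (?o j + b, ?o l + c) = (if j = l then Z j i $$ (b, c) else 0)" for i
    using diag_block_mat_entries[of r "\<lambda>j. Z j i" m] Zc by auto
  have D: "?D i \<in> carrier_mat ?N ?N" for i
    unfolding dec[symmetric] by (rule mult_carrier_mat[OF mult_carrier_mat[OF Ut Yi(1)] U])
  have oN: "?o r = ?N" using carrier_matD(1)[OF De(1)] carrier_matD(1)[OF D] by simp
  have idx: "?o j + b < ?N" if "j < r" "b < m j" for j b
    using block_offset_less[of j r b m] that oN by simp
  define E where "E j = mat ?N (m j) (\<lambda>(a, b). U $$ (a, ?o j + b))" for j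
  have E: "E j \<in> carrier_mat ?N (m j)" for j by (simp add: E_def)
  have Et: "transpose_mat (E j) \<in> carrier_mat (m j) ?N" for j using E by simp
  have isoE: "transpose_mat (E j) * E j = 1\<^sub>m (m j)" if j: "j < r" for j
  proof (rule eq_matI)
    fix b c assume "b < dim_row (1\<^sub>m (m j) :: real mat)" "c < dim_col (1\<^sub>m (m j) :: real mat)"
    then have bc: "b < m j" "c < m j" by simp_all
    have "(transpose_mat (E j) * E j) $$ (b, c) = (\<Sum>a<?N. U $$ (a, ?o j + b) * U $$ (a, ?o j + c))"
      unfolding mat_mult_entry[OF Et E bc] using bc by (intro sum.cong) (auto simp: E_def)
    also have "\<dots> = (transpose_mat U * U) $$ (?o j + b, ?o j + c)"
      unfolding mat_mult_entry[OF Ut U idx[OF j bc(1)] idx[OF j bc(2)]]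
      using U idx[OF j bc(1)] by (intro sum.cong) auto
    finally show "(transpose_mat (E j) * E j) $$ (b, c) = 1\<^sub>m (m j) $$ (b, c)"
      using bc idx[OF j bc(1)] idx[OF j bc(2)] by (simp add: orth)
  qed (simp_all add: E_def)
  have UY: "transpose_mat U * Y i = ?D i * transpose_mat U" for i
  proof -
    have "?D i * transpose_mat U = transpose_mat U * Y i * (U * transpose_mat U)"
      unfolding dec[symmetric] by (rule assoc_mult_mat[OF mult_carrier_mat[OF Ut Yi(1)] U Ut])
    then show ?thesis using right_mult_one_mat[OF mult_carrier_mat[OF Ut Yi(1)]] by (simp add: UUt)
  qed
  have row: "(transpose_mat U * Y i) $$ (?o j + b, a) = (\<Sum>c<m j. Z j i $$ (b, c) * U $$ (a, ?o j + c))"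
    if j: "j < r" and b: "b < m j" and a: "a < ?N" for i j b a
  proof -
    have "(transpose_mat U * Y i) $$ (?o j + b, a) = (\<Sum>e<?o r. ?D i $$ (?o j + b, e) * U $$ (a, e))"
      unfolding UY mat_mult_entry[OF D Ut idx[OF j b] a] oN using U a by (intro sum.cong) auto
    also have "\<dots> = (\<Sum>l<r. \<Sum>c<m l. ?D i $$ (?o j + b, ?o l + c) * U $$ (a, ?o l + c))"
      by (rule sum_blocks)
    also have "\<dots> = (\<Sum>l<r. if l = j then \<Sum>c<m j. Z j i $$ (b, c) * U $$ (a, ?o j + c) else 0)"
      by (rule sum.cong) (auto simp: De(2)[OF j _ b])
    finally show ?thesis using j by (simp add: sum.delta)
  qed
  have EY: "transpose_mat (E j) * Y i = Z j i * transpose_mat (E j)" if j: "j < r" for i j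
  proof (rule eq_matI)
    fix b a assume "b < dim_row (Z j i * transpose_mat (E j))" "a < dim_col (Z j i * transpose_mat (E j))"
    then have ba: "b < m j" "a < ?N" using Zc[OF j, of i] by (auto simp: E_def)
    have "(transpose_mat (E j) * Y i) $$ (b, a) = (transpose_mat U * Y i) $$ (?o j + b, a)"
      unfolding mat_mult_entry[OF Et Yi(1) ba] mat_mult_entry[OF Ut Yi(1) idx[OF j ba(1)] ba(2)]
      using U idx[OF j ba(1)] ba by (intro sum.cong) (auto simp: E_def)
    also have "\<dots> = (Z j i * transpose_mat (E j)) $$ (b, a)"
      unfolding row[OF j ba] mat_mult_entry[OF Zc[OF j] Et ba] using ba by (intro sum.cong) (auto simp: E_def)
    finally show "(transpose_mat (E j) * Y i) $$ (b, a) = (Z j i * transpose_mat (E j)) $$ (b, a)" .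
  qed (use Zc[OF j, of i] Yi(1)[of i] in \<open>auto simp: E_def\<close>)
  have "free_extreme d A (m j) (Z j)" if j: "j < r" for j
  proof (rule irreducible_rigid_imp_free_extreme[OF A])
    show "1 \<le> m j" "irreducible_tuple (m j) (Z j)" using Z[OF j] by auto
    have Zs: "Z j \<in> sym_tuples (m j)" using Z[OF j] by blast
    show "rigid d A (m j) (Z j)" by (rule rigid_summand[OF A Ys Zs E isoE[OF j] EY[OF j] rig])
    have "transpose_mat (E j) * Y i * E j = Z j i" for i
    proof -
      have "transpose_mat (E j) * Y i * E j = Z j i * (transpose_mat (E j) * E j)"
        unfolding EY[OF j] by (rule assoc_mult_mat[OF Zc[OF j] Et E])
      then show ?thesis using right_mult_one_mat[OF Zc[OF j]] by (simp add: isoE[OF j])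
    qed
    then show "Z j \<in> free_spec d A (m j)"
      using compression_in_free_spec[OF A Y E isoE[OF j]] by simp
  qed
  moreover have "\<exists>V. (\<forall>j<r. V j \<in> carrier_mat (m j) n) \<and>
       (\<forall>i. X i = mat_sum n n {..<r} (\<lambda>j. transpose_mat (V j) * Z j i * V j)) \<and>
       mat_sum n n {..<r} (\<lambda>j. transpose_mat (V j) * V j) = 1\<^sub>m n"
  proof -
    define V where "V j = mat (m j) n (\<lambda>(b, q). U $$ (q, ?o j + b))" for j
    have V: "V j \<in> carrier_mat (m j) n" for j by (simp add: V_def)
    have Vt: "transpose_mat (V j) \<in> carrier_mat n (m j)" for j using V by simp
    have "X i = mat_sum n n {..<r} (\<lambda>j. transpose_mat (V j) * Z j i * V j)" for i
    proof (rule eq_matI)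
      fix q q' assume "q < dim_row (mat_sum n n {..<r} (\<lambda>j. transpose_mat (V j) * Z j i * V j))"
        "q' < dim_col (mat_sum n n {..<r} (\<lambda>j. transpose_mat (V j) * Z j i * V j))"
      then have qq: "q < n" "q' < n" by (simp_all add: mat_sum_def)
      have qN: "q < ?N" "q' < ?N" using qq by simp_all
      have "Y i = U * (transpose_mat U * Y i)"
        using assoc_mult_mat[OF U Ut Yi(1), of i] left_mult_one_mat[OF Yi(1), of i] by (simp add: UUt)
      then have "Y i $$ (q, q') = (U * (transpose_mat U * Y i)) $$ (q, q')"
        by (rule arg_cong[where f="\<lambda>M. M $$ (q, q')"])
      also have "\<dots> = (\<Sum>e<?o r. U $$ (q, e) * (transpose_mat U * Y i) $$ (e, q'))"
        unfolding oN by (rule mat_mult_entry[OF U mult_carrier_mat[OF Ut Yi(1)] qN])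
      also have "\<dots> = (\<Sum>j<r. \<Sum>b<m j. U $$ (q, ?o j + b) * (transpose_mat U * Y i) $$ (?o j + b, q'))"
        by (rule sum_blocks)
      also have "\<dots> = (\<Sum>j<r. (transpose_mat (V j) * Z j i * V j) $$ (q, q'))"
      proof (rule sum.cong[OF refl])
        fix j assume "j \<in> {..<r}"
        then have j: "j < r" by simp
        have ZV: "(Z j i * V j) $$ (b, q') = (transpose_mat U * Y i) $$ (?o j + b, q')" if "b < m j" for b
          unfolding row[OF j that qN(2)] mat_mult_entry[OF Zc[OF j] V that qq(2)]
          using qq by (intro sum.cong) (auto simp: V_def)
        have "(transpose_mat (V j) * Z j i * V j) $$ (q, q') = (transpose_mat (V j) * (Z j i * V j)) $$ (q, q')"
          by (simp only: assoc_mult_mat[OF Vt Zc[OF j] V])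
        also have "\<dots> = (\<Sum>b<m j. U $$ (q, ?o j + b) * (transpose_mat U * Y i) $$ (?o j + b, q'))"
          unfolding mat_mult_entry[OF Vt mult_carrier_mat[OF Zc[OF j] V] qq]
        proof (rule sum.cong[OF refl])
          fix b assume "b \<in> {..<m j}"
          then have b: "b < m j" by simp
          have "transpose_mat (V j) $$ (q, b) = U $$ (q, ?o j + b)" using b qq by (simp add: V_def)
          then show "transpose_mat (V j) $$ (q, b) * (Z j i * V j) $$ (b, q')
            = U $$ (q, ?o j + b) * (transpose_mat U * Y i) $$ (?o j + b, q')" by (simp only: ZV[OF b])
        qed
        finally show "(\<Sum>b<m j. U $$ (q, ?o j + b) * (transpose_mat U * Y i) $$ (?o j + b, q'))
          = (transpose_mat (V j) * Z j i * V j) $$ (q, q')" ..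
      qed
      finally show "X i $$ (q, q') = mat_sum n n {..<r} (\<lambda>j. transpose_mat (V j) * Z j i * V j) $$ (q, q')"
        using qq top by (simp add: mat_sum_def)
    qed (use X in \<open>auto simp: tuples_def mat_sum_def\<close>)
    moreover have "mat_sum n n {..<r} (\<lambda>j. transpose_mat (V j) * V j) = 1\<^sub>m n"
    proof (rule eq_matI)
      fix q q' assume "q < dim_row (1\<^sub>m n :: real mat)" "q' < dim_col (1\<^sub>m n :: real mat)"
      then have qq: "q < n" "q' < n" by simp_all
      then have qN: "q < ?N" "q' < ?N" by simp_all
      have "(U * transpose_mat U) $$ (q, q') = (\<Sum>e<?o r. U $$ (q, e) * U $$ (q', e))"
        unfolding mat_mult_entry[OF U Ut qN] oN using U qN by (intro sum.cong) auto
      also have "\<dots> = (\<Sum>j<r. \<Sum>b<m j. U $$ (q, ?o j + b) * U $$ (q', ?o j + b))"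
        by (rule sum_blocks)
      also have "\<dots> = (\<Sum>j<r. (transpose_mat (V j) * V j) $$ (q, q'))"
        unfolding mat_mult_entry[OF Vt V qq] using qq by (intro sum.cong) (auto simp: V_def)
      finally show "mat_sum n n {..<r} (\<lambda>j. transpose_mat (V j) * V j) $$ (q, q') = 1\<^sub>m n $$ (q, q')"
        using qq qN by (simp add: mat_sum_def UUt)
    qed (simp_all add: mat_sum_def)
    ultimately show ?thesis using V by blast
  qed
  moreover have "(\<Sum>j<r. m j) = n + k" using oN by (simp add: block_offset_def)
  ultimately show ?thesis by blast
qed

theorem proposition2p8:
  fixes A X :: "'g::finite mat_tuple" and d n :: nat
  assumes "1 \<le> d" and "1 \<le> n"
    and "A \<in> sym_tuples d"
    and "bounded_free_spec d A"
    and "X \<in> free_spec d A n"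
  shows
    "let g = CARD('g); \<mu> = dilation_dim d A n X;
         result = (\<lambda>k Y.
           k \<le> \<mu> \<and> arveson_extreme d A (n + k) Y \<and> is_dilation n X k Y \<and>
           (\<forall>(r::nat) m Z U.
              U \<in> carrier_mat (n + k) (n + k) \<and> transpose_mat U * U = 1\<^sub>m (n + k) \<and>
              (\<forall>j<r. 1 \<le> m j \<and> Z j \<in> sym_tuples (m j) \<and> irreducible_tuple (m j) (Z j)) \<and>
              (\<forall>i. transpose_mat U * Y i * U = diag_block_mat (map (\<lambda>j. Z j i) [0..<r]))
              \<longrightarrow> (\<forall>j<r. free_extreme d A (m j) (Z j)) \<and>
                  (\<exists>V. (\<forall>j<r. V j \<in> carrier_mat (m j) n) \<and>
                     (\<forall>i. X i = mat_sum n n {..<r} (\<lambda>j. transpose_mat (V j) * Z j i * V j)) \<and>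
                     mat_sum n n {..<r} (\<lambda>j. transpose_mat (V j) * V j) = 1\<^sub>m n \<and>
                     (\<Sum>j<r. m j) = n + k \<and> n + k \<le> n * (g + 1) \<and> k \<le> \<mu>)))
     in \<mu> \<le> n * g \<and>
        terminates_within d A n (ae_filter lborel) (\<lambda>\<gamma> S. True) result \<mu> 0 X \<and>
        terminates_within d A n (principal UNIV) (\<lambda>\<gamma> S. \<gamma> extreme_point_of S) result \<mu> 0 X"
proof -
  note A = assms(3) and bdd = assms(4) and X = assms(5)
  have Xs: "X \<in> sym_tuples n" using X by (simp add: free_spec_def)
  have At: "A \<in> tuples d d" and Xt: "X \<in> tuples n n" using A Xs sym_tuples_subset by blast+
  define \<mu> where "\<mu> = dilation_dim d A n X"
  have sub: "tuple_subspace n (dilation_subspace d A n X)"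
    by (rule dilation_subspace_is_subspace[OF At Xt])
  have mu: "\<mu> \<le> n * CARD('g)"
    unfolding \<mu>_def dilation_dim_def by (rule tuple_subspace_dim(1)[OF sub])
  have ind: "k \<le> \<mu>" if "\<And>j. j < k \<Longrightarrow> b j \<in> dilation_subspace d A n X" "indep_family n k b" for k b
    unfolding \<mu>_def dilation_dim_def by (rule tuple_subspace_dim(2)[OF sub that])
  define result where "result = (\<lambda>k Y.
           k \<le> \<mu> \<and> arveson_extreme d A (n + k) Y \<and> is_dilation n X k Y \<and>
           (\<forall>(r::nat) m Z U.
              U \<in> carrier_mat (n + k) (n + k) \<and> transpose_mat U * U = 1\<^sub>m (n + k) \<and>
              (\<forall>j<r. 1 \<le> m j \<and> Z j \<in> sym_tuples (m j) \<and> irreducible_tuple (m j) (Z j)) \<and>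
              (\<forall>i. transpose_mat U * Y i * U = diag_block_mat (map (\<lambda>j. Z j i) [0..<r]))
              \<longrightarrow> (\<forall>j<r. free_extreme d A (m j) (Z j)) \<and>
                  (\<exists>V. (\<forall>j<r. V j \<in> carrier_mat (m j) n) \<and>
                     (\<forall>i. X i = mat_sum n n {..<r} (\<lambda>j. transpose_mat (V j) * Z j i * V j)) \<and>
                     mat_sum n n {..<r} (\<lambda>j. transpose_mat (V j) * V j) = 1\<^sub>m n \<and>
                     (\<Sum>j<r. m j) = n + k \<and> n + k \<le> n * (CARD('g) + 1) \<and> k \<le> \<mu>)))"
  have res: "result k Y" if k: "k \<le> \<mu>" and arv: "arveson_extreme d A (n + k) Y" and dil: "is_dilation n X k Y"
    for k Y
  proof -
    have Y: "Y \<in> free_spec d A (n + k)" using arv by (simp add: arveson_extreme_def)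
    have rig: "rigid d A (n + k) Y"
      using arv arveson_iff_rigid[OF A Y] by simp
    have top: "Y i $$ (q, q') = X i $$ (q, q')" if "q < n" "q' < n" for i q q'
      using dil is_dilation_iff[OF Xt] that by blast
    have bound: "n + k \<le> n * (CARD('g) + 1)" using k mu by (simp add: add_mult_distrib2)
    show ?thesis
      unfolding result_def
    proof (intro conjI allI impI k arv dil)
      fix r :: nat and m Z U
      assume h: "U \<in> carrier_mat (n + k) (n + k) \<and> transpose_mat U * U = 1\<^sub>m (n + k) \<and>
              (\<forall>j<r. 1 \<le> m j \<and> Z j \<in> sym_tuples (m j) \<and> irreducible_tuple (m j) (Z j)) \<and>
              (\<forall>i. transpose_mat U * Y i * U = diag_block_mat (map (\<lambda>j. Z j i) [0..<r]))"
      have main: "(\<forall>j<r. free_extreme d A (m j) (Z j)) \<and>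
        (\<exists>V. (\<forall>j<r. V j \<in> carrier_mat (m j) n) \<and>
           (\<forall>i. X i = mat_sum n n {..<r} (\<lambda>j. transpose_mat (V j) * Z j i * V j)) \<and>
           mat_sum n n {..<r} (\<lambda>j. transpose_mat (V j) * V j) = 1\<^sub>m n) \<and> (\<Sum>j<r. m j) = n + k"
        using h by (intro block_decomposition_of_arveson_dilation[OF A Y rig top Xt]) blast+
      then show "\<exists>V. (\<forall>j<r. V j \<in> carrier_mat (m j) n) \<and>
                     (\<forall>i. X i = mat_sum n n {..<r} (\<lambda>j. transpose_mat (V j) * Z j i * V j)) \<and>
                     mat_sum n n {..<r} (\<lambda>j. transpose_mat (V j) * V j) = 1\<^sub>m n \<and>
                     (\<Sum>j<r. m j) = n + k \<and> n + k \<le> n * (CARD('g) + 1) \<and> k \<le> \<mu>"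
        using bound k by blast
      show "free_extreme d A (m j) (Z j)" if "j < r" for j using main that by blast
    qed
  qed
  have dil0: "is_dilation n X 0 X" using Xs by (simp add: is_dilation_iff[OF Xt] Xt)
  have run: "terminates_within d A n F adm result \<mu> 0 X"
    if "\<And>S. compact S \<Longrightarrow> convex S \<Longrightarrow> S \<noteq> {} \<Longrightarrow>
      \<forall>\<^sub>F l in F. (\<exists>\<gamma>. \<gamma> \<in> corner_choices adm S l) \<and> (\<forall>\<gamma>\<in>corner_choices adm S l. \<gamma> extreme_point_of S)"
    for F adm
  proof (rule algorithm_terminates[OF A bdd Xt that res])
    show "X \<in> free_spec d A (n + 0)" using X by simp
    show "k \<le> \<mu>" if "\<And>j. j < k \<Longrightarrow> b j \<in> dilation_subspace d A (n + 0) X" "indep_family (n + 0) k b" for k b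
      using ind[of k b] that by simp
    show "is_dilation n X 0 X" by (rule dil0)
    show "0 + \<mu> \<le> \<mu>" by simp
  qed
  have "terminates_within d A n (ae_filter lborel) (\<lambda>\<gamma> S. True) result \<mu> 0 X"
    by (rule run, rule generic_corner_extreme)
  moreover have "terminates_within d A n (principal UNIV) (\<lambda>\<gamma> S. \<gamma> extreme_point_of S) result \<mu> 0 X"
  proof (rule run)
    fix S :: "(real^'g) set" assume S: "compact S" "convex S" "S \<noteq> {}"
    show "\<forall>\<^sub>F l in principal UNIV. (\<exists>\<gamma>. \<gamma> \<in> corner_choices (\<lambda>\<gamma> S. \<gamma> extreme_point_of S) S l) \<and>
      (\<forall>\<gamma>\<in>corner_choices (\<lambda>\<gamma> S. \<gamma> extreme_point_of S) S l. \<gamma> extreme_point_of S)"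
      using compact_has_extreme_maximizer[OF S] by (simp add: corner_choices_def eventually_principal)
  qed
  ultimately show ?thesis
    using mu unfolding Let_def \<mu>_def[symmetric] result_def[symmetric] by blast
qed

end
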